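(* Let $N\ge2$, $\Omega=\mathbb{R}^{N-1}\times(0,\infty)$, $(\phi,\psi)\in L^\infty(\Omega)\times L^\infty(\partial\Omega)$. For $\epsilon>0$, $k\ge0$ define, for $(x,y,t)\in\overline\Omega\times\overline\Omega\times(0,\infty)$, \[\hat H_k(x,y,t):=-2\int_0^\infty\Gamma_{N-1}\!\left(x'-y',\frac t\epsilon+k\tau\right)\partial_\xi\Gamma_1\!\left(x_N+y_N+\tau,\frac t\epsilon\right)d\tau,\quad \Psi_k(x,y,t):=G_0\!\left(x,y,\frac t\epsilon\right)+\hat H_k(x,y,t),\] $z_k(x,t):=\int_\Omega\Psi_k(x,y,t)\phi(y)\,dy$, and $z^N(x,t):=\int_\Omega G_N(x,y,t/\epsilon)\phi(y)\,dy$. For $\delta>0$ let $u^\delta_k$, $u^\delta_0$ be the solutions (context) with parameters $(\epsilon,\delta,k)$ and $(\epsilon,\delta,0)$. Then, for any fixed $\epsilon>0$, $k>0$ and any $R>0$, \[\sup_{(x,t)\in Q(R)}|u^\delta_k(x,t)-z_k(x,t)|=O(\delta),\qquad\sup_{(x,t)\in Q(R)}|u^\delta_0(x,t)-z^N(x,t)|=O(\delta)\quad\text{as }\delta\to0^+.\] If $\phi\in BC(\Omega)$, then $z_k$ is a bounded classical solution of problem (HDN). Moreover: (1) for fixed $\epsilon>0$ and any $R>0$, $\sup_{(x,t)\in Q(R)}|z_k(x,t)-z^N(x,t)|=O(k)$ as $k\to0^+$; (2) for fixed $k>0$, if $\phi\in BC(\Omega)$, then for any $T>0$ and compact $K\subset\Omega$,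 $\lim_{\epsilon\to\infty}\sup_{(x,t)\in K\times(0,T)}|z_k(x,t)-\phi(x)|=0$ and $\lim_{\epsilon\to\infty}\sup_{(x,t)\in K\times(0,T)}|z^N(x,t)-\phi(x)|=0$ (here $z_k,z^N$ depend on $\epsilon$).
   Context: $x=(x',x_N)$, $\partial\Omega\cong\mathbb{R}^{N-1}$ with surface measure $d\sigma$, $\Delta'$ the Laplacian in $x'$. $\Gamma_d(x,t)=(4\pi t)^{-d/2}e^{-|x|^2/(4t)}$, $\partial_\xi\Gamma_1$ the spatial derivative of $\Gamma_1$, $y^*=(y',-y_N)$, $G_0(x,y,s)=\Gamma_N(x-y,s)-\Gamma_N(x-y^*,s)$, $G_N(x,y,s)=\Gamma_N(x-y,s)+\Gamma_N(x-y^*,s)$. $Q(R):=\{(x,t)\in\overline\Omega\times(0,\infty):x_N+t>R\}$. For $\kappa\ge0$, $\delta>0$: $H(x,y,t)=-2\int_0^t\Gamma_{N-1}(x'-y',\frac{t-\tau}\epsilon+\frac\kappa\delta\tau)\partial_\xi\Gamma_1(x_N+y_N+\frac\tau\delta,\frac{t-\tau}\epsilon)d\tau$, $G=G_0(x,y,t/\epsilon)+\delta^{-1}H$, and the solution with parameters $(\epsilon,\delta,\kappa)$ is $u(x,t)=\int_\Omega G(x,y,t)\phi(y)dy+\frac\delta\epsilon\int_{\partial\Omega}G(x,y,t)\psi(y)d\sigma(y)$ (solving $\epsilon\partial_tu=\Delta u$ in $\Omega$, $\delta\partial_tu-\kappa\Delta'u-\partial_{x_N}u=0$ on $\partial\Omega$,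 initial data $(\phi,\psi)$). Problem (HDN): $\epsilon\partial_tu-\Delta u=0$ in $\Omega\times(0,\infty)$, $-k\Delta'u-\partial_{x_N}u=0$ on $\partial\Omega\times(0,\infty)$, $u=\phi$ in $\Omega\times\{0\}$. A classical solution of (HDN) is $u$ on $(\overline\Omega\times[0,\infty))\setminus(\partial\Omega\times\{0\})$ with $u\in C^{2;1}(\Omega\times(0,\infty))\cap C^{2;0}(\overline\Omega\times(0,\infty))\cap C(\Omega\times[0,\infty))$ satisfying the equations pointwise. *)

theory Defs
  imports "HOL-Analysis.Analysis"
begin

text \<open>Points of the closed half space are pairs (x', x_N) with x' in R^(N-1) = real^'n,
  so N - 1 = CARD('n) >= 1, i.e. N >= 2.\<close>

type_synonym 'n pt = "(real^'n) \<times> real"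

definition Omega :: "('n::finite) pt set" where
  "Omega = {x. snd x > 0}"

definition Gamma :: "'a::euclidean_space \<Rightarrow> real \<Rightarrow> real" where
  "Gamma x t = (4 * pi * t) powr (- real DIM('a) / 2) * exp (- (norm x)\<^sup>2 / (4 * t))"

definition dGamma1 :: "real \<Rightarrow> real \<Rightarrow> real" where
  "dGamma1 \<xi> s = deriv (\<lambda>\<eta>::real. Gamma \<eta> s) \<xi>"

definition refl :: "('n::finite) pt \<Rightarrow> 'n pt" where
  "refl y = (fst y, - snd y)"

definition G0 :: "('n::finite) pt \<Rightarrow> 'n pt \<Rightarrow> real \<Rightarrow> real" where
  "G0 x y s = Gamma (x - y) s - Gamma (x - refl y) s"

definition GN :: "('n::finite) pt \<Rightarrow> 'n pt \<Rightarrow> real \<Rightarrow> real" where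
  "GN x y s = Gamma (x - y) s + Gamma (x - refl y) s"

definition H :: "real \<Rightarrow> real \<Rightarrow> real \<Rightarrow> ('n::finite) pt \<Rightarrow> 'n pt \<Rightarrow> real \<Rightarrow> real" where
  "H \<epsilon> \<delta> \<kappa> x y t = - 2 * (LINT \<tau>:{0<..<t}|lborel.
      Gamma (fst x - fst y) ((t - \<tau>) / \<epsilon> + \<kappa> / \<delta> * \<tau>) *
      dGamma1 (snd x + snd y + \<tau> / \<delta>) ((t - \<tau>) / \<epsilon>))"

definition G :: "real \<Rightarrow> real \<Rightarrow> real \<Rightarrow> ('n::finite) pt \<Rightarrow> 'n pt \<Rightarrow> real \<Rightarrow> real" where
  "G \<epsilon> \<delta> \<kappa> x y t = G0 x y (t / \<epsilon>) + H \<epsilon> \<delta> \<kappa> x y t / \<delta>"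

text \<open>Solution with parameters (eps, delta, kappa) and initial data (phi, psi);
  the boundary of Omega is identified with R^(N-1) via y' |-> (y', 0).\<close>
definition usol :: "real \<Rightarrow> real \<Rightarrow> real \<Rightarrow> (('n::finite) pt \<Rightarrow> real) \<Rightarrow> (real^'n \<Rightarrow> real)
    \<Rightarrow> 'n pt \<Rightarrow> real \<Rightarrow> real" where
  "usol \<epsilon> \<delta> \<kappa> \<phi> \<psi> x t =
     (LINT y:Omega|lborel. G \<epsilon> \<delta> \<kappa> x y t * \<phi> y)
     + \<delta> / \<epsilon> * (LINT y'|lborel. G \<epsilon> \<delta> \<kappa> x (y', 0) t * \<psi> y')"

definition Hhat :: "real \<Rightarrow> real \<Rightarrow> ('n::finite) pt \<Rightarrow> 'n pt \<Rightarrow> real \<Rightarrow> real" where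
  "Hhat \<epsilon> k x y t = - 2 * (LINT \<tau>:{0<..}|lborel.
      Gamma (fst x - fst y) (t / \<epsilon> + k * \<tau>) * dGamma1 (snd x + snd y + \<tau>) (t / \<epsilon>))"

definition Psi :: "real \<Rightarrow> real \<Rightarrow> ('n::finite) pt \<Rightarrow> 'n pt \<Rightarrow> real \<Rightarrow> real" where
  "Psi \<epsilon> k x y t = G0 x y (t / \<epsilon>) + Hhat \<epsilon> k x y t"

definition zk :: "real \<Rightarrow> real \<Rightarrow> (('n::finite) pt \<Rightarrow> real) \<Rightarrow> 'n pt \<Rightarrow> real \<Rightarrow> real" where
  "zk \<epsilon> k \<phi> x t = (LINT y:Omega|lborel. Psi \<epsilon> k x y t * \<phi> y)"

definition zN :: "real \<Rightarrow> (('n::finite) pt \<Rightarrow> real) \<Rightarrow> 'n pt \<Rightarrow> real \<Rightarrow> real" where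
  "zN \<epsilon> \<phi> x t = (LINT y:Omega|lborel. GN x y (t / \<epsilon>) * \<phi> y)"

definition Q :: "real \<Rightarrow> (('n::finite) pt \<times> real) set" where
  "Q R = {(x, t). x \<in> closure Omega \<and> t > 0 \<and> snd x + t > R}"

text \<open>Partial derivative of f at x in direction v, taken within the set S
  (one-sided where S forces it, e.g. the normal direction at the boundary).\<close>
definition has_pd :: "('a::real_normed_vector \<Rightarrow> real) \<Rightarrow> 'a set \<Rightarrow> 'a \<Rightarrow> 'a \<Rightarrow> real \<Rightarrow> bool" where
  "has_pd f S v x D \<longleftrightarrow>
     ((\<lambda>s. f (x + s *\<^sub>R v)) has_real_derivative D) (at 0 within {s. x + s *\<^sub>R v \<in> S})"

text \<open>Classical solution of (HDN): u defined on (closure Omega x [0,oo)) minus (boundary x {0}),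
  u in C^{2;1}(Omega x (0,oo)) and C^{2;0}(closure Omega x (0,oo)) and C(Omega x [0,oo)),
  satisfying the equations pointwise.  D1 b, D2 b c are the first/second spatial partial
  derivatives along basis vectors b, c (up to the boundary), Dt the time derivative.\<close>
definition classical_sol_HDN ::
  "real \<Rightarrow> real \<Rightarrow> (('n::finite) pt \<Rightarrow> real) \<Rightarrow> ('n pt \<Rightarrow> real \<Rightarrow> real) \<Rightarrow> bool" where
  "classical_sol_HDN \<epsilon> k \<phi> u \<longleftrightarrow>
    (\<exists>D1 D2 Dt.
      (\<forall>b\<in>Basis. \<forall>x\<in>closure Omega. \<forall>t>0. has_pd (\<lambda>y. u y t) (closure Omega) b x (D1 b x t)) \<and>
      (\<forall>b\<in>Basis. \<forall>c\<in>Basis. \<forall>x\<in>closure Omega. \<forall>t>0.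
          has_pd (\<lambda>y. D1 b y t) (closure Omega) c x (D2 b c x t)) \<and>
      continuous_on (closure Omega \<times> {0<..}) (\<lambda>(x, t). u x t) \<and>
      (\<forall>b\<in>Basis. continuous_on (closure Omega \<times> {0<..}) (\<lambda>(x, t). D1 b x t)) \<and>
      (\<forall>b\<in>Basis. \<forall>c\<in>Basis. continuous_on (closure Omega \<times> {0<..}) (\<lambda>(x, t). D2 b c x t)) \<and>
      (\<forall>x\<in>Omega. \<forall>t>0. ((\<lambda>s. u x s) has_real_derivative Dt x t) (at t)) \<and>
      continuous_on (Omega \<times> {0<..}) (\<lambda>(x, t). Dt x t) \<and>
      continuous_on (Omega \<times> {0..}) (\<lambda>(x, t). u x t) \<and>
      (\<forall>x\<in>Omega. \<forall>t>0. \<epsilon> * Dt x t - (\<Sum>b\<in>Basis. D2 b b x t) = 0) \<and>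
      (\<forall>x\<in>frontier Omega. \<forall>t>0.
          - k * (\<Sum>i\<in>(Basis :: (real^'n) set). D2 (i, 0) (i, 0) x t) - D1 (0, 1) x t = 0) \<and>
      (\<forall>x\<in>Omega. u x 0 = \<phi> x))"

definition bounded_sol :: "(('n::finite) pt \<Rightarrow> real \<Rightarrow> real) \<Rightarrow> bool" where
  "bounded_sol u \<longleftrightarrow> (\<exists>M. \<forall>x\<in>closure Omega. \<forall>t\<ge>0. (t = 0 \<longrightarrow> x \<in> Omega) \<longrightarrow> \<bar>u x t\<bar> \<le> M)"

end

(* Everything depends on t only through b = t/epsilon. Write flux(xi, s) = -2 d/dxi Gamma_1(xi, s) and
   d = delta/epsilon. After the substitution tau -> delta tau, the kernels H/delta and Hhat are integrals over
   tau of Gamma_(N-1)(x'-y', a) flux(x_N+y_N+tau, s), with (a, s) = (b - d tau + kappa tau, b - d tau) for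
   H/delta and (a, s) = (b + kappa tau, b) for Hhat. Let A be such a kernel at the earlier and B at the later
   pair of times. Then theta A <= B, where theta <= 1 is a power of a quotient of times, so that
   |A - B| <= B - A + 2 (1 - theta) A. The right-hand side has an explicit integral in y, of order
   d tau/b (or k tau/b when two values of k are compared) times a Gaussian in x_N + tau; integrating in tau
   gives both rates. The Neumann solution z^N is the case k = 0.

   By the semigroup property, z_k is an average of translates of Gamma_N and of its normal derivative,
   against a weight that depends neither on x nor on t. Hence dominated convergence gives smoothness on all of
   R^N x (0,oo), and the heat equation is inherited from the kernels. Applying the boundary operator to Hhat
   turns the integrand into a total derivative in tau, whose boundary value at tau = 0 cancels the normal
   derivative of the Dirichlet part.

   At an interior point the reflected and the boundary kernels have mass O(b/x_N^2), so that z_k differs from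
   the whole-space heat average of phi by a term which is small for small b, that is, for small t or for
   large epsilon. *)

theory Submission
  imports Defs "HOL-Probability.Distributions" "HOL-Real_Asymp.Real_Asymp"
begin

section \<open>Gaussian kernels\<close>

text \<open>The comparison by a power \<theta> of a quotient of times is sharp for small lags but
  degenerates when the earlier time b - d \<tau> tends to 0. Past \<tau> = b/(2 d) monotonicity
  takes over: with \<xi> = x_N + \<tau>, Gamma_1 and flux increase in the time s as long as 2 s <=
  \<xi>^2 and 6 s <= \<xi>^2. The set Q(R) makes this available for small \<delta>: if t < R/2, then
  x_N > R/2; if t >= R/2, the \<tau> concerned are at least R/(4 \<delta>). Q(R) also bounds the
  Gaussian in x_N that the \<tau>-integration leaves behind.

  The estimate keeps B - A with its sign because the masses of A and B are known exactly and do not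
  depend on the tangential time. Hence tangential diffusion enters only through \<theta>, and no
  derivative of a kernel has to be integrated in absolute value.

  The weight in the average that represents z_k is not integrable; it is only integrable against
  Gaussians, and this is all that differentiation under the integral requires. Smoothness beyond the
  boundary turns the one-sided derivatives of the definition into ordinary ones.\<close>

lemma measurable_fst_borel [measurable (raw)]:
  fixes f :: "'c \<Rightarrow> 'a::second_countable_topology \<times> 'b::second_countable_topology"
  assumes "f \<in> borel_measurable M"
  shows "(\<lambda>w. fst (f w)) \<in> borel_measurable M"
  using assms by (rule borel_measurable_continuous_on[OF continuous_on_fst[OF continuous_on_id]])

lemma measurable_snd_borel [measurable (raw)]:
  fixes f :: "'c \<Rightarrow> 'a::second_countable_topology \<times> 'b::second_countable_topology"
  assumes "f \<in> borel_measurable M"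
  shows "(\<lambda>w. snd (f w)) \<in> borel_measurable M"
  using assms by (rule borel_measurable_continuous_on[OF continuous_on_snd[OF continuous_on_id]])

lemma Gamma_real:
  assumes "t > 0"
  shows "Gamma (x::real) t = exp (- x\<^sup>2 / (4 * t)) / sqrt (4 * pi * t)"
proof -
  have "(4 * pi * t) powr (- (1 / 2)) = 1 / sqrt (4 * pi * t)"
    using assms by (subst powr_minus_divide) (simp only: powr_half_sqrt[of "4 * pi * t"] mult_nonneg_nonneg pi_ge_zero less_imp_le zero_le_numeral)
  then show ?thesis by (simp add: Gamma_def)
qed

lemma Gamma_nonneg [simp]: "0 \<le> Gamma x t"
  by (simp add: Gamma_def)

lemma Gamma_minus [simp]: "Gamma (- x) t = Gamma x t"
  by (simp add: Gamma_def)

lemma Gamma_prod: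
  assumes "t > 0"
  shows "Gamma (x :: 'a::euclidean_space \<times> 'b::euclidean_space) t = Gamma (fst x) t * Gamma (snd x) t"
proof -
  have n: "(norm x)\<^sup>2 = (norm (fst x))\<^sup>2 + (norm (snd x))\<^sup>2"
    by (cases x) (simp add: norm_Pair)
  have e: "- real DIM('a \<times> 'b) / 2 = - real DIM('a) / 2 + - real DIM('b) / 2" by simp
  show ?thesis unfolding Gamma_def n e powr_add minus_add_distrib add_divide_distrib exp_add by simp
qed

lemma borel_measurable_Gamma [measurable]:
  assumes [measurable]: "f \<in> M \<rightarrow>\<^sub>M borel" "g \<in> borel_measurable M"
  shows "(\<lambda>w. Gamma (f w :: 'a::euclidean_space) (g w)) \<in> borel_measurable M"
  unfolding Gamma_def by measurable

text \<open>Reduces the total mass to dimension one, where the kernel is the normal density of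
  variance 2t.\<close>

lemma Gamma_eq_prod:
  assumes "t > 0"
  shows "Gamma (x::'a::euclidean_space) t = (\<Prod>b\<in>Basis. Gamma (x \<bullet> b) t)"
proof -
  have "(\<Prod>b\<in>(Basis::'a set). (4 * pi * t) powr (- 1 / 2)) = (4 * pi * t) powr (- real DIM('a) / 2)"
    using assms by (simp add: powr_realpow[symmetric] powr_powr)
  moreover have "(\<Prod>b\<in>(Basis::'a set). exp (- (norm (x \<bullet> b))\<^sup>2 / (4 * t))) = exp (- (norm x)\<^sup>2 / (4 * t))"
    unfolding exp_sum[OF finite_Basis, symmetric] sum_divide_distrib[symmetric]
    by (simp add: sum_negf power2_norm_eq_inner euclidean_inner[of x x]) (simp add: power2_eq_square)
  ultimately show ?thesis unfolding Gamma_def by (simp add: prod.distrib)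
qed

lemma Gamma_real_normal_density: "t > 0 \<Longrightarrow> Gamma (x::real) t = normal_density 0 (sqrt (2 * t)) x"
  by (simp add: Gamma_real normal_density_def)

lemma nn_integral_Gamma:
  assumes t: "t > 0"
  shows "(\<integral>\<^sup>+x. ennreal (Gamma (x::'a::euclidean_space) t) \<partial>lborel) = 1"
proof -
  have 1: "(\<integral>\<^sup>+x. ennreal (Gamma (x::real) t) \<partial>lborel) = 1"
    using t by (simp add: Gamma_real_normal_density nn_integral_eq_integral)
  have "(\<integral>\<^sup>+x. ennreal (Gamma (x::'a) t) \<partial>lborel)
      = (\<integral>\<^sup>+x. (\<Prod>b\<in>Basis. ennreal (Gamma ((x::'a) \<bullet> b) t)) \<partial>lborel)"
    by (subst Gamma_eq_prod[OF t]) (simp add: prod_ennreal)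
  also have "\<dots> = (\<Prod>b\<in>(Basis::'a set). (\<integral>\<^sup>+x. ennreal (Gamma (x::real) t) \<partial>lborel))"
    by (rule nn_integral_lborel_prod) auto
  finally show ?thesis by (simp add: 1)
qed

lemma nn_integral_lborel_translate:
  fixes c :: "'a::euclidean_space"
  assumes [measurable]: "f \<in> borel_measurable borel"
  shows "(\<integral>\<^sup>+x. f (c + x) \<partial>lborel) = (\<integral>\<^sup>+x. f x \<partial>lborel)"
  by (subst lborel_distr_plus[symmetric, of c]) (simp add: nn_integral_distr)

lemma nn_integral_lborel_reflect:
  fixes c :: "'a::euclidean_space"
  assumes [measurable]: "f \<in> borel_measurable borel"
  shows "(\<integral>\<^sup>+x. f (c - x) \<partial>lborel) = (\<integral>\<^sup>+x. f x \<partial>lborel)"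
proof -
  have "(\<integral>\<^sup>+x. f x \<partial>lborel) = (\<integral>\<^sup>+x. f (c + x) \<partial>lborel)"
    by (simp add: nn_integral_lborel_translate)
  also have "\<dots> = (\<integral>\<^sup>+x. f (c + (- 1) *\<^sub>R x) \<partial>lborel)"
    by (subst lborel_affine[of "-1" 0]) (simp_all add: nn_integral_density nn_integral_distr)
  finally show ?thesis by simp
qed

lemma has_bochner_integral_Gamma:
  assumes "t > 0"
  shows "has_bochner_integral lborel (\<lambda>y. Gamma ((x::'a::euclidean_space) - y) t) 1"
  by (rule has_bochner_integral_nn_integral)
     (use assms nn_integral_lborel_reflect[of "\<lambda>y. ennreal (Gamma y t)" x] in \<open>simp_all add: nn_integral_Gamma\<close>)

text \<open>Completing the square in \<open>z\<close>: as a function of \<open>z\<close> the product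
  is again a Gaussian, with time ab/(a+b), and the remaining factor is free of \<open>z\<close>.
  Integration then gives the semigroup law.\<close>

lemma Gamma_mult_Gamma:
  fixes x z :: "'a::euclidean_space"
  assumes a: "a > 0" and b: "b > 0"
  shows "Gamma (x - z) a * Gamma z b = Gamma x (a + b) * Gamma ((b / (a + b)) *\<^sub>R x - z) (a * b / (a + b))"
proof -
  have ab: "a + b > 0" using a b by simp
  have e: "(norm (x - z))\<^sup>2 / (4 * a) + (norm z)\<^sup>2 / (4 * b)
     = (norm x)\<^sup>2 / (4 * (a + b)) + (norm ((b / (a + b)) *\<^sub>R x - z))\<^sup>2 / (4 * (a * b / (a + b)))"
  proof -
    define X Y Z where "X = x \<bullet> x" and "Y = z \<bullet> z" and "Z = x \<bullet> z"
    define c where "c = a + b"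
    have c: "c > 0" "b = c - a" using ab by (auto simp: c_def)
    have 1: "(norm (x - z))\<^sup>2 = X + Y - 2 * Z" "(norm z)\<^sup>2 = Y" "(norm x)\<^sup>2 = X"
      "(norm ((b / c) *\<^sub>R x - z))\<^sup>2 = (b/c)^2 * X + Y - 2 * (b / c) * Z"
      unfolding power2_norm_eq_inner
      by (simp_all add: X_def Y_def Z_def inner_diff inner_commute power2_eq_square)
    show ?thesis unfolding c_def[symmetric] 1 using a b c(1)
      by (simp add: field_simps power2_eq_square) (simp add: c_def algebra_simps)
  qed
  have p: "(4 * pi * a) powr q * (4 * pi * b) powr q = (4 * pi * (a + b)) powr q * (4 * pi * (a * b / (a + b))) powr q" for q
  proof -
    have "(4 * pi * a) * (4 * pi * b) = (4 * pi * (a + b)) * (4 * pi * (a * b / (a + b)))"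
      using ab by (simp add: field_simps)
    then show ?thesis using a b by (simp only: powr_mult[symmetric])
  qed
  have "Gamma (x - z) a * Gamma z b = ((4 * pi * a) powr (- real DIM('a) / 2) * (4 * pi * b) powr (- real DIM('a) / 2))
      * exp (- ((norm (x - z))\<^sup>2 / (4 * a) + (norm z)\<^sup>2 / (4 * b)))"
    unfolding Gamma_def minus_add_distrib exp_add by simp
  also have "\<dots> = Gamma x (a + b) * Gamma ((b / (a + b)) *\<^sub>R x - z) (a * b / (a + b))"
    unfolding e p Gamma_def minus_add_distrib exp_add by simp
  finally show ?thesis .
qed

lemma Gamma_semigroup:
  fixes x y :: "'a::euclidean_space"
  assumes a: "a > 0" and b: "b > 0"
  shows "has_bochner_integral lborel (\<lambda>z. Gamma (x - z) a * Gamma (z - y) b) (Gamma (x - y) (a + b))"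
proof -
  let ?c = "a * b / (a + b)"
  have eq: "Gamma (x - z) a * Gamma (z - y) b
     = Gamma (x - y) (a + b) * Gamma (((b / (a + b)) *\<^sub>R (x - y) + y) - z) ?c" for z
    using Gamma_mult_Gamma[OF a b, of "x - y" "z - y"] by (simp add: algebra_simps)
  have "has_bochner_integral lborel (\<lambda>z. Gamma (((b / (a + b)) *\<^sub>R (x - y) + y) - z) ?c) 1"
    using a b by (intro has_bochner_integral_Gamma) simp
  from has_bochner_integral_mult_right[OF this, of "Gamma (x - y) (a + b)"]
  show ?thesis by (simp add: eq)
qed

lemma DERIV_Gamma_real:
  assumes "s > 0"
  shows "((\<lambda>\<xi>. Gamma \<xi> s) has_real_derivative - (\<xi> / (2 * s)) * Gamma \<xi> s) (at (\<xi>::real))"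
proof -
  have "((\<lambda>\<xi>. exp (- \<xi>\<^sup>2 / (4 * s)) / c) has_real_derivative exp (- \<xi>\<^sup>2 / (4 * s)) * (- (2 * \<xi>) / (4 * s)) / c) (at \<xi>)" for c
    by (intro DERIV_cdivide DERIV_chain2[OF DERIV_exp] DERIV_minus) (auto intro!: derivative_eq_intros)
  from this[of "sqrt (4 * pi * s)"] show ?thesis unfolding Gamma_real[OF assms] by (simp add: mult_ac)
qed

lemma dGamma1_eq: "s > 0 \<Longrightarrow> dGamma1 \<xi> s = - (\<xi> / (2 * s)) * Gamma \<xi> s"
  unfolding dGamma1_def by (rule DERIV_imp_deriv[OF DERIV_Gamma_real])

text \<open>As a function of \<open>s\<close> this is the density of the time at which the diffusion
  with generator d^2/d\<xi>^2, started at \<xi> > 0, first hits 0. Its positivity for \<xi> > 0 is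
  what the comparison arguments rest on.\<close>

definition flux :: "real \<Rightarrow> real \<Rightarrow> real" where
  "flux \<xi> s = \<xi> / s * Gamma \<xi> s"

lemma dGamma1_flux: "s > 0 \<Longrightarrow> - 2 * dGamma1 \<xi> s = flux \<xi> s"
  by (simp add: dGamma1_eq flux_def)

lemma flux_nonneg: "0 \<le> \<xi> \<Longrightarrow> 0 \<le> s \<Longrightarrow> 0 \<le> flux \<xi> s"
  by (simp add: flux_def)

lemma borel_measurable_flux [measurable]:
  assumes [measurable]: "f \<in> borel_measurable M" "g \<in> borel_measurable M"
  shows "(\<lambda>w. flux (f w) (g w)) \<in> borel_measurable M"
  unfolding flux_def by measurable

lemma Gamma_tendsto_0: assumes "s > 0" shows "((\<lambda>\<xi>. Gamma (\<xi>::real) s) \<longlongrightarrow> 0) at_top"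
  unfolding Gamma_real[OF assms] using assms by real_asymp

lemma nn_integral_atLeast_DERIV:
  fixes f F :: "real \<Rightarrow> real"
  assumes "f \<in> borel_measurable borel" "\<And>x. a \<le> x \<Longrightarrow> (F has_real_derivative f x) (at x)"
    and "\<And>x. a \<le> x \<Longrightarrow> 0 \<le> f x" "(F \<longlongrightarrow> T) at_top"
  shows "(\<integral>\<^sup>+x. ennreal (f x) * indicator {a<..} x \<partial>lborel) = ennreal (T - F a)"
proof -
  have "(\<integral>\<^sup>+x. ennreal (f x) * indicator {a<..} x \<partial>lborel) = (\<integral>\<^sup>+x. ennreal (f x) * indicator {a..} x \<partial>lborel)"
    by (rule nn_integral_cong_AE) (use AE_lborel_singleton[of a] in eventually_elim, auto simp: indicator_def)
  then show ?thesis using nn_integral_FTC_atLeast[OF assms] by simp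
qed

lemma nn_integral_flux:
  assumes s: "s > 0" and x: "x \<ge> 0"
  shows "(\<integral>\<^sup>+\<tau>. ennreal (flux (x + \<tau>) s) * indicator {0<..} \<tau> \<partial>lborel) = ennreal (2 * Gamma x s)"
proof -
  have lim: "((\<lambda>\<tau>. - 2 * Gamma (x + \<tau>) s) \<longlongrightarrow> - 2 * 0) at_top"
    by (intro tendsto_mult tendsto_const filterlim_compose[OF Gamma_tendsto_0[OF s]]
        filterlim_tendsto_add_at_top[OF tendsto_const filterlim_ident])
  have D: "((\<lambda>\<tau>. - 2 * Gamma (x + \<tau>) s) has_real_derivative flux (x + \<tau>) s) (at \<tau>)" for \<tau>
    using DERIV_cmult[OF DERIV_chain2[OF DERIV_Gamma_real[OF s, of "x + \<tau>"] DERIV_add[OF DERIV_const DERIV_ident]], of "-2"]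
    by (simp add: flux_def)
  show ?thesis
    using nn_integral_atLeast_DERIV[OF _ D _ lim, of 0] s x by (simp add: flux_nonneg)
qed

lemma has_bochner_integral_flux:
  assumes s: "s > 0" and x: "x \<ge> 0"
  shows "has_bochner_integral lborel (\<lambda>\<tau>. flux (x + \<tau>) s * indicator {0<..} \<tau>) (2 * Gamma x s)"
proof (rule has_bochner_integral_nn_integral)
  show "(\<integral>\<^sup>+ \<tau>. ennreal (flux (x + \<tau>) s * indicator {0<..} \<tau>) \<partial>lborel) = ennreal (2 * Gamma x s)"
    unfolding nn_integral_flux[OF s x, symmetric]
    by (rule nn_integral_cong) (auto simp: indicator_def)
qed (use s x in \<open>auto simp: indicator_def flux_nonneg\<close>)

lemma Omega_measurable [measurable]: "Omega \<in> sets borel"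
  unfolding Omega_def by (intro borel_open open_Collect_less continuous_intros)

lemma mem_Omega [simp]: "y \<in> Omega \<longleftrightarrow> 0 < snd y"
  by (simp add: Omega_def)

lemma nn_integral_pt_product:
  fixes f :: "real^'n \<Rightarrow> ennreal" and g :: "real \<Rightarrow> ennreal"
  assumes [measurable]: "f \<in> borel_measurable borel" "g \<in> borel_measurable borel"
  shows "(\<integral>\<^sup>+y. f (fst y) * g (snd y) \<partial>lborel) = (\<integral>\<^sup>+y. f y \<partial>lborel) * (\<integral>\<^sup>+y. g y \<partial>lborel)"
proof -
  have "(\<integral>\<^sup>+y. f (fst y) * g (snd y) \<partial>(lborel \<Otimes>\<^sub>M lborel)) = (\<integral>\<^sup>+x. \<integral>\<^sup>+y. f x * g y \<partial>lborel \<partial>lborel)"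
    by (subst lborel.nn_integral_fst[symmetric]) simp_all
  also have "\<dots> = (\<integral>\<^sup>+x. f x * (\<integral>\<^sup>+y. g y \<partial>lborel) \<partial>lborel)"
    by (intro nn_integral_cong nn_integral_cmult) simp
  also have "\<dots> = (\<integral>\<^sup>+y. f y \<partial>lborel) * (\<integral>\<^sup>+y. g y \<partial>lborel)"
    by (intro nn_integral_multc) simp
  finally show ?thesis by (simp only: lborel_prod)
qed

text \<open>The tangential factor has mass one whatever its time \<open>a\<close>, and the normal
  factor telescopes. That the result is independent of \<open>a\<close> is what keeps the tangential
  diffusion out of the mass balance in later comparisons.\<close>

lemma has_bochner_integral_halfspace_flux:
  fixes x :: "real^'n"
  assumes a: "a > 0" and s: "s > 0" and x: "\<xi> \<ge> 0"
  shows "has_bochner_integral lborel (\<lambda>y::'n pt. Gamma (x - fst y) a * flux (\<xi> + snd y) s * indicator Omega y) (2 * Gamma \<xi> s)"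
proof (rule has_bochner_integral_nn_integral)
  show "(\<lambda>y::'n pt. Gamma (x - fst y) a * flux (\<xi> + snd y) s * indicator Omega y) \<in> borel_measurable lborel"
    by measurable
  have "(\<integral>\<^sup>+ y. ennreal (Gamma (x - fst y) a * flux (\<xi> + snd y) s * indicator Omega y) \<partial>(lborel :: 'n pt measure))
    = (\<integral>\<^sup>+ y. ennreal (Gamma (x - fst y) a) * (ennreal (flux (\<xi> + snd y) s) * indicator {0<..} (snd y)) \<partial>(lborel :: 'n pt measure))"
    by (rule nn_integral_cong) (use s x in \<open>auto simp: indicator_def ennreal_mult flux_nonneg\<close>)
  also have "\<dots> = (\<integral>\<^sup>+ y. ennreal (Gamma (x - y) a) \<partial>lborel) * (\<integral>\<^sup>+ y. ennreal (flux (\<xi> + y) s) * indicator {0<..} y \<partial>lborel)"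
    by (rule nn_integral_pt_product) measurable
  also have "\<dots> = ennreal (2 * Gamma \<xi> s)"
    using nn_integral_flux[OF s x] nn_integral_lborel_reflect[of "\<lambda>y. ennreal (Gamma y a)" x] a
    by (simp add: nn_integral_Gamma)
  finally show "(\<integral>\<^sup>+ y. ennreal (Gamma (x - fst y) a * flux (\<xi> + snd y) s * indicator Omega y) \<partial>(lborel :: 'n pt measure))
    = ennreal (2 * Gamma \<xi> s)" .
qed (use s x in \<open>auto simp: indicator_def flux_nonneg\<close>)

section \<open>Comparison of kernels at different times\<close>

text \<open>The exponential grows with time, so only the prefactor can decrease, and the power of
  a/b compensates exactly for it. For \<open>flux\<close> the additional factor 1/s raises the
  one-dimensional exponent from 1/2 to 3/2.\<close>

lemma Gamma_time_scale:
  fixes z :: "'a::euclidean_space"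
  assumes a: "0 < a" and ab: "a \<le> b"
  shows "(a / b) powr (real DIM('a) / 2) * Gamma z a \<le> Gamma z b"
proof -
  have b: "b > 0" using a ab by simp
  have "(a / b) powr q * (4 * pi * a) powr (- q) = (4 * pi * b) powr (- q)" for q
  proof -
    have "(4 * pi * a) powr (- q) = (4 * pi * b) powr (- q) * (a / b) powr (- q)"
    proof -
      have "4 * pi * a = (4 * pi * b) * (a / b)" using b by simp
      then show ?thesis using a b by (simp only: powr_mult[symmetric])
    qed
    then show ?thesis using a b by (simp add: powr_minus)
  qed
  from this[of "real DIM('a) / 2"]
  have "(a / b) powr (real DIM('a) / 2) * Gamma z a = (4 * pi * b) powr (- real DIM('a) / 2) * exp (- (norm z)\<^sup>2 / (4 * a))"
    by (simp add: Gamma_def)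
  also have "\<dots> \<le> Gamma z b"
    unfolding Gamma_def using a ab by (intro mult_left_mono) (simp_all add: frac_le)
  finally show ?thesis .
qed

lemma flux_time_scale:
  assumes a: "0 < a" and ab: "a \<le> b" and x: "0 \<le> \<xi>"
  shows "(a / b) powr (3 / 2) * flux \<xi> a \<le> flux \<xi> b"
proof -
  have "(a / b) powr (3 / 2) = (a / b) * (a / b) powr (1 / 2)"
    using a ab powr_add[of "a / b" 1 "1 / 2"] by simp
  then have "(a / b) powr (3 / 2) * flux \<xi> a = \<xi> / b * ((a / b) powr (real DIM(real) / 2) * Gamma \<xi> a)"
    using a by (simp add: flux_def)
  also have "\<dots> \<le> flux \<xi> b"
    unfolding flux_def using Gamma_time_scale[OF a ab, of \<xi>] x a ab by (intro mult_left_mono) simp_all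
  finally show ?thesis .
qed

text \<open>With r = a/b: 1 - r^p <= - p ln r = p ln (b/a) <= p (b/a - 1).\<close>

lemma one_minus_powr_le:
  fixes a b p :: real
  assumes a: "0 < a" and ab: "a \<le> b" and p: "0 \<le> p"
  shows "1 - (a / b) powr p \<le> p * (b - a) / a"
proof -
  have "ln (b / a) \<le> b / a - 1" using a ab by (intro ln_le_minus_one) simp
  then have "p * ln (b / a) \<le> p * ((b - a) / a)" using p a by (intro mult_left_mono) (simp_all add: field_simps)
  moreover have "1 + p * ln (a / b) \<le> (a / b) powr p"
    using a ab exp_ge_add_one_self[of "p * ln (a / b)"] by (simp add: powr_def)
  ultimately show ?thesis using a ab by (simp add: ln_div algebra_simps)
qed

lemma exp_time_diff:
  fixes a b \<xi> :: real
  assumes a: "0 < a" and ab: "a \<le> b"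
  shows "exp (- \<xi>\<^sup>2 / (4 * a)) = exp (- \<xi>\<^sup>2 / (4 * b)) * exp (- (\<xi>\<^sup>2 * (b - a) / (4 * a * b)))"
  unfolding exp_add[symmetric] using a ab by (simp add: field_simps)

text \<open>One-sided on purpose: the prefactor only falls from \<open>a\<close> to
  \<open>b\<close>, so the increase is at most that of the exponential, which exp (-u) >= 1 - u
  controls.\<close>

lemma Gamma_time_diff:
  fixes \<xi> :: real
  assumes a: "0 < a" and ab: "a \<le> b"
  shows "Gamma \<xi> b - Gamma \<xi> a \<le> Gamma \<xi> b * (\<xi>\<^sup>2 * (b - a) / (4 * a * b))"
proof -
  have b: "b > 0" using a ab by simp
  define u where "u = \<xi>\<^sup>2 * (b - a) / (4 * a * b)"
  have "Gamma \<xi> b * exp (- u) = exp (- \<xi>\<^sup>2 / (4 * a)) / sqrt (4 * pi * b)"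
    unfolding Gamma_real[OF b] exp_time_diff[OF a ab] u_def by simp
  also have "\<dots> \<le> Gamma \<xi> a"
    unfolding Gamma_real[OF a] using a ab by (intro divide_left_mono) simp_all
  finally have "Gamma \<xi> b * (1 - u) \<le> Gamma \<xi> a"
    using exp_ge_add_one_self[of "- u"] mult_left_mono[of "1 - u" "exp (- u)" "Gamma \<xi> b"] by simp
  then show ?thesis unfolding u_def[symmetric] by (simp add: algebra_simps)
qed

text \<open>The function s^(-p) exp (- \<xi>^2 / (4 s)) of s increases up to s = \<xi>^2 / (4 p),
  and the last hypothesis puts [a, b] below this maximum. For Gamma_1 (p = 1/2) the condition reads
  2 b <= \<xi>^2, for flux (p = 3/2) it reads 6 b <= \<xi>^2.\<close>

lemma exp_time_mono:
  fixes a b p \<xi> :: real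
  assumes a: "0 < a" and ab: "a \<le> b" and p: "0 \<le> p" and x: "4 * p * b \<le> \<xi>\<^sup>2"
  shows "(b / a) powr p * exp (- \<xi>\<^sup>2 / (4 * a)) \<le> exp (- \<xi>\<^sup>2 / (4 * b))"
proof -
  have b: "b > 0" using a ab by simp
  define u where "u = \<xi>\<^sup>2 * (b - a) / (4 * a * b)"
  have "p * ((b - a) / a) = (4 * p * b) * ((b - a) / (4 * a * b))"
    using a b by (simp add: field_simps)
  also have "\<dots> \<le> \<xi>\<^sup>2 * ((b - a) / (4 * a * b))"
    using x a ab by (intro mult_right_mono) simp_all
  finally have pu: "p * ((b - a) / a) \<le> u" by (simp add: u_def)
  have "ln (b / a) \<le> b / a - 1" using a ab by (intro ln_le_minus_one) simp
  then have "p * ln (b / a) \<le> p * ((b - a) / a)" using p a by (intro mult_left_mono) (simp_all add: field_simps)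
  with pu have "(b / a) powr p \<le> exp u" using a b by (simp add: powr_def)
  then have "(b / a) powr p * exp (- u) \<le> 1"
    by (simp add: exp_minus field_simps)
  then have "((b / a) powr p * exp (- u)) * exp (- \<xi>\<^sup>2 / (4 * b)) \<le> 1 * exp (- \<xi>\<^sup>2 / (4 * b))"
    by (intro mult_right_mono) simp_all
  then show ?thesis unfolding exp_time_diff[OF a ab] u_def by (simp add: mult_ac)
qed

lemma Gamma_real_powr: "0 < a \<Longrightarrow> Gamma (\<xi>::real) a = (4 * pi) powr (- (1/2)) * (a powr (- (1/2)) * exp (- \<xi>\<^sup>2 / (4 * a)))"
  by (simp add: Gamma_def powr_mult)

lemma flux_powr: "0 < a \<Longrightarrow> flux \<xi> a = (4 * pi) powr (- (1/2)) * (\<xi> * (a powr (- (3/2)) * exp (- \<xi>\<^sup>2 / (4 * a))))"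
proof -
  assume a: "0 < a"
  have "a powr (- (3/2)) = a powr (- (1/2)) / a"
    using a powr_add[of a "- (1/2)" "-1"] by (simp add: powr_minus_divide)
  then show ?thesis unfolding flux_def Gamma_real_powr[OF a] by simp
qed

lemma powr_exp_time_mono:
  fixes a b p \<xi> :: real
  assumes a: "0 < a" and ab: "a \<le> b" and p: "0 \<le> p" and x: "4 * p * b \<le> \<xi>\<^sup>2"
  shows "a powr (- p) * exp (- \<xi>\<^sup>2 / (4 * a)) \<le> b powr (- p) * exp (- \<xi>\<^sup>2 / (4 * b))"
proof -
  have "a powr (- p) = b powr (- p) * (b / a) powr p"
    unfolding powr_divide powr_minus_divide using a ab by simp
  then show ?thesis using mult_left_mono[OF exp_time_mono[OF assms], of "b powr (- p)"] by (simp add: mult_ac)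
qed

lemma Gamma_time_mono:
  assumes "0 < a" "a \<le> b" "2 * b \<le> \<xi>\<^sup>2"
  shows "Gamma (\<xi>::real) a \<le> Gamma \<xi> b"
  using powr_exp_time_mono[of a b "1/2" \<xi>] assms
  by (subst (1 2) Gamma_real_powr) (auto intro!: mult_left_mono)

lemma flux_time_mono:
  assumes "0 < a" "a \<le> b" "6 * b \<le> \<xi>\<^sup>2" "0 \<le> \<xi>"
  shows "flux \<xi> a \<le> flux \<xi> b"
  using powr_exp_time_mono[of a b "3/2" \<xi>] assms
  by (subst (1 2) flux_powr) (auto intro!: mult_left_mono)

text \<open>Rounded values of (1/2)^(3/2) and (1/2)^(1/2); they are the source of the factors 3 and
  2 lost when the time at most doubles.\<close>

lemma half_powr_le: "1 / 2 \<le> (r::real) \<Longrightarrow> r \<le> 1 \<Longrightarrow> 1 / 3 \<le> r powr (3 / 2)"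
  and half_powr_le': "1 / 2 \<le> (r::real) \<Longrightarrow> r \<le> 1 \<Longrightarrow> 1 / 2 \<le> r powr (1 / 2)"
proof -
  assume r: "1 / 2 \<le> r" "r \<le> 1"
  have 1: "sqrt r \<ge> 2/3" using r by (intro real_le_rsqrt) (simp add: power2_eq_square)
  have "r powr (3/2) = r * sqrt r"
    using r powr_add[of r 1 "1/2"] by (simp add: powr_half_sqrt)
  moreover have "1/2 * (2/3) \<le> r * sqrt r" using r 1 by (intro mult_mono) simp_all
  ultimately show "1 / 3 \<le> r powr (3 / 2)" by simp
  show "1 / 2 \<le> r powr (1 / 2)" using 1 r by (simp add: powr_half_sqrt)
qed

lemma Gamma_half_time:
  assumes "0 < a" "a \<le> b" "b \<le> 2 * a"
  shows "Gamma (\<xi>::real) a \<le> 2 * Gamma \<xi> b"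
proof -
  have "1/2 * Gamma \<xi> a \<le> (a/b) powr (1/2) * Gamma \<xi> a"
    using assms by (intro mult_right_mono half_powr_le') (simp_all add: field_simps)
  then show ?thesis using Gamma_time_scale[of a b \<xi>] assms by simp
qed

lemma flux_half_time:
  assumes "0 < a" "a \<le> b" "b \<le> 2 * a" "0 \<le> \<xi>"
  shows "flux \<xi> a \<le> 3 * flux \<xi> b"
proof -
  have "1/3 * flux \<xi> a \<le> (a/b) powr (3/2) * flux \<xi> a"
    using assms by (intro mult_right_mono half_powr_le) (simp_all add: field_simps flux_nonneg)
  then show ?thesis using flux_time_scale[of a b \<xi>] assms by simp
qed

text \<open>Uniform in time, for points far from the boundary at arbitrarily small times. With v =
  \<xi> / (2 sqrt a) it comes from 2 v <= 1 + v^2 <= exp (v^2).\<close>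

lemma Gamma_le_inverse:
  assumes x: "0 < \<xi>" and a: "0 < a"
  shows "Gamma (\<xi>::real) a \<le> 1 / \<xi>"
proof -
  define r where "r = sqrt a"
  have r: "r > 0" "a = r\<^sup>2" using a by (auto simp: r_def)
  define v where "v = \<xi> / (2 * r)"
  have u: "\<xi>\<^sup>2 / (4 * a) = v\<^sup>2" by (simp add: v_def r(2) power2_eq_square)
  have "2 * v \<le> 1 + v\<^sup>2" using sum_squares_bound[of v 1] by simp
  also have "\<dots> \<le> exp (v\<^sup>2)" by (rule exp_ge_add_one_self)
  finally have v: "\<xi> \<le> r * exp (v\<^sup>2)" using r by (simp add: v_def field_simps)
  have "1 \<le> 4 * pi" using pi_ge_two by linarith
  then have "r \<le> sqrt (4 * pi * a)" unfolding r_def using a by simp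
  then have "r * exp (v\<^sup>2) \<le> sqrt (4 * pi * a) * exp (v\<^sup>2)" by (rule mult_right_mono) simp
  with v have "\<xi> \<le> sqrt (4 * pi * a) * exp (v\<^sup>2)" by (rule order_trans)
  then show ?thesis using x a u unfolding Gamma_real[OF a]
    by (simp add: exp_minus field_simps)
qed

lemma Gamma_le_sqrt:
  assumes "0 < a" "a \<le> b"
  shows "Gamma (\<xi>::real) b \<le> 1 / sqrt (4 * pi * a)"
proof -
  have "Gamma \<xi> b \<le> 1 / sqrt (4 * pi * b)" using assms by (simp add: Gamma_real divide_right_mono)
  also have "\<dots> \<le> 1 / sqrt (4 * pi * a)" using assms by (intro divide_left_mono) simp_all
  finally show ?thesis .
qed

text \<open>A quadratic factor is absorbed by doubling the time. With u = \<xi>^2 / (8 b) the left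
  side contains 8 u exp (-2u) <= 8 exp (-u), and the change of prefactor costs at most another 2.
  This is why the rates contain a Gaussian at time 2 b.\<close>

lemma square_Gamma_le:
  assumes b: "0 < b"
  shows "\<xi>\<^sup>2 / b * Gamma \<xi> b \<le> 16 * Gamma (\<xi>::real) (2 * b)"
proof -
  define u where "u = \<xi>\<^sup>2 / (8 * b)"
  have u0: "u \<ge> 0" using b by (simp add: u_def)
  have "u \<le> exp u" using exp_ge_add_one_self[of u] by linarith
  then have "u * exp (- u) \<le> 1" by (simp add: exp_minus field_simps)
  then have "8 * (u * exp (- u)) * exp (- u) \<le> 8 * exp (- u)"
    by (simp add: mult_right_mono)
  then have 1: "\<xi>\<^sup>2 / b * exp (- \<xi>\<^sup>2 / (4 * b)) \<le> 8 * exp (- \<xi>\<^sup>2 / (4 * (2 * b)))"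
  proof -
    have "exp (- \<xi>\<^sup>2 / (4 * b)) = exp (- u) * exp (- u)" unfolding exp_add[symmetric] u_def by simp
    moreover have "\<xi>\<^sup>2 / b = 8 * u" by (simp add: u_def)
    moreover have "exp (- \<xi>\<^sup>2 / (4 * (2 * b))) = exp (- u)" by (simp add: u_def)
    ultimately show ?thesis using \<open>8 * (u * exp (- u)) * exp (- u) \<le> 8 * exp (- u)\<close>
      by (simp only: mult_ac)
  qed
  have s: "sqrt (4 * pi * (2 * b)) \<le> 2 * sqrt (4 * pi * b)"
    using b by (intro real_le_lsqrt) (simp_all add: power_mult_distrib)
  have "\<xi>\<^sup>2 / b * Gamma \<xi> b \<le> 8 * exp (- \<xi>\<^sup>2 / (4 * (2 * b))) / sqrt (4 * pi * b)"
    unfolding Gamma_real[OF b] times_divide_eq_right using b by (intro divide_right_mono[OF 1]) simp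
  also have "\<dots> \<le> 8 * exp (- \<xi>\<^sup>2 / (4 * (2 * b))) / (sqrt (4 * pi * (2 * b)) / 2)"
    using s b by (intro divide_left_mono) simp_all
  finally show ?thesis using b by (simp add: Gamma_real)
qed

text \<open>The integrand is the shape of all error densities in \<tau>: a lag proportional to
  \<tau> <= x + \<tau>, times 1/b from the prefactors or (x + \<tau>)^2 / b^2 from the exponent. It
  has the explicit primitive \<open>F\<close>.\<close>

lemma nn_integral_flux_cubic:
  assumes b: "0 < b" and x: "0 \<le> x" and c: "0 \<le> c"
  shows "(\<integral>\<^sup>+\<tau>. ennreal ((c * ((x + \<tau>) / b) + (x + \<tau>)^3 / b\<^sup>2) * Gamma (x + \<tau>) b) * indicator {0<..} \<tau> \<partial>lborel)
    = ennreal ((2 * c + 8 + 2 * x\<^sup>2 / b) * Gamma x b)"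
proof -
  define F where "F = (\<lambda>\<xi>. - (2 * c + 8 + 2 * \<xi>\<^sup>2 / b) * Gamma \<xi> b)"
  have D0: "(F has_real_derivative (c * (\<xi> / b) + \<xi>^3 / b\<^sup>2) * Gamma \<xi> b) (at \<xi>)" for \<xi>
  proof -
    have 1: "((\<lambda>\<xi>. - (2 * c + 8 + 2 * \<xi>\<^sup>2 / b)) has_real_derivative - (4 * \<xi> / b)) (at \<xi>)"
      using b by (auto intro!: derivative_eq_intros)
    have "(F has_real_derivative - (4 * \<xi> / b) * Gamma \<xi> b + - (\<xi> / (2 * b)) * Gamma \<xi> b * - (2 * c + 8 + 2 * \<xi>\<^sup>2 / b)) (at \<xi>)"
      unfolding F_def by (rule DERIV_mult[OF 1 DERIV_Gamma_real[OF b]])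
    moreover have "- (4 * \<xi> / b) * g + - (\<xi> / (2 * b)) * g * - (2 * c + 8 + 2 * \<xi>\<^sup>2 / b) = (c * (\<xi> / b) + \<xi>^3 / b\<^sup>2) * g" for g
      using b by (simp add: field_simps power2_eq_square power3_eq_cube)
    ultimately show ?thesis by simp
  qed
  have D: "((\<lambda>\<tau>. F (x + \<tau>)) has_real_derivative (c * ((x + \<tau>) / b) + (x + \<tau>)^3 / b\<^sup>2) * Gamma (x + \<tau>) b) (at \<tau>)" for \<tau>
    using DERIV_chain2[OF D0[of "x + \<tau>"] DERIV_add[OF DERIV_const DERIV_ident]] by simp
  have "(F \<longlongrightarrow> 0) at_top"
    unfolding F_def Gamma_real[OF b] using b by real_asymp
  then have lim: "((\<lambda>\<tau>. F (x + \<tau>)) \<longlongrightarrow> 0) at_top"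
    by (rule filterlim_compose[OF _ filterlim_tendsto_add_at_top[OF tendsto_const filterlim_ident]])
  have "0 - F (x + 0) = (2 * c + 8 + 2 * x\<^sup>2 / b) * Gamma x b"
    by (simp add: F_def algebra_simps)
  then show ?thesis
    using nn_integral_atLeast_DERIV[OF _ D _ lim, of 0] b x c by simp
qed

section \<open>The boundary kernels and their L^1 comparison\<close>

definition flux_kernel :: "('n::finite) pt \<Rightarrow> 'n pt \<Rightarrow> real \<Rightarrow> real \<Rightarrow> real \<Rightarrow> real" where
  "flux_kernel x y a s \<tau> = Gamma (fst x - fst y) a * flux (snd x + snd y + \<tau>) s"

lemma borel_measurable_flux_kernel [measurable]:
  fixes y :: "'c \<Rightarrow> ('n::finite) pt"
  assumes [measurable]: "y \<in> borel_measurable M" "a \<in> borel_measurable M" "s \<in> borel_measurable M" "u \<in> borel_measurable M"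
  shows "(\<lambda>w. flux_kernel x (y w) (a w) (s w) (u w)) \<in> borel_measurable M"
  unfolding flux_kernel_def by measurable

lemma flux_kernel_nonneg:
  "\<lbrakk>0 \<le> s; 0 \<le> \<tau>; 0 \<le> snd x; y \<in> Omega\<rbrakk> \<Longrightarrow> 0 \<le> flux_kernel x y a s \<tau>"
  by (simp add: flux_kernel_def flux_nonneg)

lemma has_bochner_integral_flux_kernel:
  fixes x :: "('n::finite) pt"
  assumes "a > 0" "s > 0" "0 \<le> snd x" "0 \<le> \<tau>"
  shows "has_bochner_integral lborel (\<lambda>y. flux_kernel x y a s \<tau> * indicator Omega y) (2 * Gamma (snd x + \<tau>) s)"
  using has_bochner_integral_halfspace_flux[of a s "snd x + \<tau>" "fst x"] assms
  unfolding flux_kernel_def by (simp add: ac_simps)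

text \<open>By \<open>r\<close> the quotient of the normal times is the smaller one, so its power
  n/2 may stand in for that of the tangential times. Together with the 3/2 of \<open>flux\<close>
  this makes the exponent (n + 3)/2.\<close>

lemma flux_kernel_scale:
  fixes x y :: "('n::finite) pt"
  assumes a: "0 < a" "a \<le> b" and a': "0 < a'" "a' \<le> b'" and r: "a / b \<le> a' / b'"
    and "0 \<le> snd x" "0 \<le> \<tau>" "y \<in> Omega"
  shows "(a / b) powr ((real CARD('n) + 3) / 2) * flux_kernel x y a' a \<tau> \<le> flux_kernel x y b' b \<tau>"
proof -
  let ?\<xi> = "snd x + snd y + \<tau>"
  have \<xi>: "0 \<le> ?\<xi>" using assms by simp
  have "(a / b) powr ((real CARD('n) + 3) / 2) = (a / b) powr (real CARD('n) / 2) * (a / b) powr (3 / 2)"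
    unfolding powr_add[symmetric] by (simp add: add_divide_distrib)
  also have "\<dots> \<le> (a' / b') powr (real CARD('n) / 2) * (a / b) powr (3 / 2)"
    using r a by (intro mult_right_mono powr_mono2) simp_all
  finally have "(a / b) powr ((real CARD('n) + 3) / 2) * flux_kernel x y a' a \<tau>
      \<le> ((a' / b') powr (real CARD('n) / 2) * (a / b) powr (3 / 2)) * flux_kernel x y a' a \<tau>"
    using assms by (intro mult_right_mono flux_kernel_nonneg) simp_all
  also have "\<dots> = ((a' / b') powr (real DIM(real^'n) / 2) * Gamma (fst x - fst y) a') * ((a / b) powr (3 / 2) * flux ?\<xi> a)"
    by (simp add: flux_kernel_def)
  also have "\<dots> \<le> Gamma (fst x - fst y) b' * flux ?\<xi> b"
    using \<xi> a by (intro mult_mono Gamma_time_scale flux_time_scale a a' mult_nonneg_nonneg flux_nonneg) simp_all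
  finally show ?thesis by (simp add: flux_kernel_def)
qed

text \<open>|A - B| = (B - A) + 2 max (A - B) 0, and the positive part of A - B is at most (1 -
  \<theta>) A.\<close>

lemma nn_integral_abs_diff_le:
  assumes A: "has_bochner_integral M A \<alpha>" and B: "has_bochner_integral M B \<beta>"
    and nn: "\<And>y. 0 \<le> A y" and \<theta>: "\<And>y. \<theta> * A y \<le> B y" "0 \<le> \<theta>" "\<theta> \<le> 1"
  shows "(\<integral>\<^sup>+y. ennreal \<bar>A y - B y\<bar> \<partial>M) \<le> ennreal (\<beta> - \<alpha> + 2 * (1 - \<theta>) * \<alpha>)"
proof -
  have "(\<integral>\<^sup>+y. ennreal \<bar>A y - B y\<bar> \<partial>M) \<le> (\<integral>\<^sup>+y. ennreal (B y - A y + 2 * (1 - \<theta>) * A y) \<partial>M)"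
  proof (intro nn_integral_mono ennreal_leI)
    fix y
    have "0 \<le> (1 - \<theta>) * A y" using nn[of y] \<theta> by (intro mult_nonneg_nonneg) simp_all
    then show "\<bar>A y - B y\<bar> \<le> B y - A y + 2 * (1 - \<theta>) * A y" using \<theta>(1)[of y] by (auto simp: abs_if algebra_simps)
  qed
  also have "\<dots> = ennreal (\<beta> - \<alpha> + 2 * (1 - \<theta>) * \<alpha>)"
  proof (subst nn_integral_eq_integral)
    have "has_bochner_integral M (\<lambda>y. B y - A y + 2 * (1 - \<theta>) * A y) (\<beta> - \<alpha> + 2 * (1 - \<theta>) * \<alpha>)"
      by (intro has_bochner_integral_add has_bochner_integral_diff has_bochner_integral_mult_right A B)
    then show "integrable M (\<lambda>y. B y - A y + 2 * (1 - \<theta>) * A y)"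
      and "ennreal (integral\<^sup>L M (\<lambda>y. B y - A y + 2 * (1 - \<theta>) * A y)) = ennreal (\<beta> - \<alpha> + 2 * (1 - \<theta>) * \<alpha>)"
      by (auto simp: has_bochner_integral_iff)
    show "AE y in M. 0 \<le> B y - A y + 2 * (1 - \<theta>) * A y"
    proof (rule AE_I2)
      fix y
      have "0 \<le> (1 - \<theta>) * A y" using nn[of y] \<theta> by (intro mult_nonneg_nonneg) simp_all
      then show "0 \<le> B y - A y + 2 * (1 - \<theta>) * A y" using \<theta>(1)[of y] by (simp add: algebra_simps)
    qed
  qed
  finally show ?thesis .
qed

text \<open>After rescaling time by \<open>1/\<epsilon>\<close> and \<open>\<tau>\<close> by \<open>\<delta>\<close>, the function \<open>H/\<delta>\<close> is the integral of this kernel over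
  \<open>\<tau>\<close> with \<open>d = \<delta>/\<epsilon>\<close> and \<open>b = t/\<epsilon>\<close>; the choice \<open>d = 0\<close> gives the limit \<open>Hhat\<close>.\<close>

definition dyn_kernel :: "real \<Rightarrow> real \<Rightarrow> real \<Rightarrow> ('n::finite) pt \<Rightarrow> 'n pt \<Rightarrow> real \<Rightarrow> real" where
  "dyn_kernel d \<kappa> b x y \<tau> = (if 0 < \<tau> \<and> d * \<tau> < b then flux_kernel x y (b - d * \<tau> + \<kappa> * \<tau>) (b - d * \<tau>) \<tau> else 0)"

lemma borel_measurable_dyn_kernel [measurable]:
  fixes y :: "'c \<Rightarrow> ('n::finite) pt"
  assumes [measurable]: "y \<in> borel_measurable M" "u \<in> borel_measurable M"
  shows "(\<lambda>w. dyn_kernel d \<kappa> b x (y w) (u w)) \<in> borel_measurable M"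
  unfolding dyn_kernel_def by measurable

abbreviation dyn_integral :: "real \<Rightarrow> real \<Rightarrow> real \<Rightarrow> ('n::finite) pt \<Rightarrow> 'n pt \<Rightarrow> real" where
  "dyn_integral d \<kappa> b x y \<equiv> (\<integral>\<tau>. dyn_kernel d \<kappa> b x y \<tau> \<partial>lborel)"

abbreviation L1_on :: "'a::euclidean_space set \<Rightarrow> ('a \<Rightarrow> real) \<Rightarrow> ennreal" where
  "L1_on S A \<equiv> (\<integral>\<^sup>+y. ennreal (\<bar>A y\<bar> * indicator S y) \<partial>lborel)"

text \<open>The \<tau>-integral is outermost because the mass in \<open>y\<close> at fixed \<tau> is
  explicit; Tonelli reverses the order when the kernel is paired with data.\<close>

abbreviation L1_total :: "'a::euclidean_space set \<Rightarrow> ('a \<Rightarrow> real \<Rightarrow> real) \<Rightarrow> ennreal" where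
  "L1_total S A \<equiv> (\<integral>\<^sup>+\<tau>. L1_on S (\<lambda>y. A y \<tau>) \<partial>lborel)"

text \<open>The term x^2/b left over by the \<tau>-integration is absorbed at time 2 b, with
  coefficient 2 * 16 = 32. The common coefficient 2 c + 40 dominates both this and the 2 c + 8 of
  the Gaussian at time b.\<close>

lemma L1_total_le_cubic:
  assumes b: "0 < b" and x: "0 \<le> x" and c: "0 \<le> c" and m: "0 \<le> m"
    and slice: "\<And>\<tau>. 0 < \<tau> \<Longrightarrow> L1_on S (\<lambda>y. A y \<tau>) \<le> ennreal (m * ((c * ((x + \<tau>) / b) + (x + \<tau>) ^ 3 / b\<^sup>2) * Gamma (x + \<tau>) b))"
    and zero: "\<And>y \<tau>. \<tau> \<le> 0 \<Longrightarrow> A y \<tau> = 0"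
  shows "L1_total S A \<le> ennreal (m * ((2 * c + 40) * (Gamma x b + Gamma x (2 * b))))"
proof -
  have "L1_total S A \<le> (\<integral>\<^sup>+\<tau>. ennreal m * (ennreal ((c * ((x + \<tau>) / b) + (x + \<tau>) ^ 3 / b\<^sup>2) * Gamma (x + \<tau>) b) * indicator {0<..} \<tau>) \<partial>lborel)"
  proof (rule nn_integral_mono)
    fix \<tau> :: real
    show "L1_on S (\<lambda>y. A y \<tau>) \<le> ennreal m * (ennreal ((c * ((x + \<tau>) / b) + (x + \<tau>) ^ 3 / b\<^sup>2) * Gamma (x + \<tau>) b) * indicator {0<..} \<tau>)"
    proof (cases "0 < \<tau>")
      case True
      then show ?thesis using slice[OF True] m c x b by (simp add: ennreal_mult)
    qed (simp add: zero)
  qed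
  also have "\<dots> = ennreal m * ennreal ((2 * c + 8 + 2 * x\<^sup>2 / b) * Gamma x b)"
    by (subst nn_integral_cmult, simp, subst nn_integral_flux_cubic[OF b x c]) simp
  also have "\<dots> = ennreal (m * ((2 * c + 8) * Gamma x b + 2 * (x\<^sup>2 / b * Gamma x b)))"
    using m b c by (subst ennreal_mult[symmetric]) (simp_all add: algebra_simps)
  also have "\<dots> \<le> ennreal (m * ((2 * c + 40) * (Gamma x b + Gamma x (2 * b))))"
  proof (intro ennreal_leI mult_left_mono m)
    have "2 * (x\<^sup>2 / b * Gamma x b) \<le> 32 * Gamma x (2 * b)"
      using square_Gamma_le[OF b, of x] by simp
    also have "\<dots> \<le> (2 * c + 40) * Gamma x (2 * b)" using c by (intro mult_right_mono) simp_all
    finally have 1: "2 * (x\<^sup>2 / b * Gamma x b) \<le> (2 * c + 40) * Gamma x (2 * b)" .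
    have "(2 * c + 8) * Gamma x b \<le> (2 * c + 40) * Gamma x b" by (intro mult_right_mono) simp_all
    with 1 show "(2 * c + 8) * Gamma x b + 2 * (x\<^sup>2 / b * Gamma x b) \<le> (2 * c + 40) * (Gamma x b + Gamma x (2 * b))"
      by (simp add: distrib_left)
  qed
  finally show ?thesis .
qed

text \<open>Under the hypothesis \<open>good\<close> below, the kernel at the times \<open>b - d \<tau> < b/2\<close> is in the range where
  \<open>\<sigma> \<mapsto> Gamma \<xi> \<sigma>\<close> and \<open>\<sigma> \<mapsto> flux \<xi> \<sigma>\<close> increase, so no separate tail estimate is needed.\<close>

locale time_lag =
  fixes d \<kappa> b :: real and x :: "('n::finite) pt"
  assumes d: "0 \<le> d" and \<kappa>: "0 \<le> \<kappa>" and b: "0 < b" and x: "0 \<le> snd x"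
    and good: "\<And>\<tau>. 0 < \<tau> \<Longrightarrow> b \<le> 2 * (d * \<tau>) \<Longrightarrow> 6 * b \<le> (snd x + \<tau>)\<^sup>2"
begin

lemma Gamma_lag:
  assumes "0 < \<tau>" "d * \<tau> < b"
  shows "Gamma (snd x + \<tau>) (b - d * \<tau>) \<le> 2 * Gamma (snd x + \<tau>) b"
proof (cases "b \<le> 2 * (d * \<tau>)")
  case True
  have "Gamma (snd x + \<tau>) (b - d * \<tau>) \<le> Gamma (snd x + \<tau>) b"
    using good[OF assms(1) True] assms d b by (intro Gamma_time_mono) (simp_all)
  then show ?thesis using Gamma_nonneg[of "snd x + \<tau>" b] by linarith
next
  case False
  then show ?thesis using assms d by (intro Gamma_half_time) simp_all
qed

lemma flux_lag:
  assumes "0 < \<tau>" "d * \<tau> < b"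
  shows "flux (snd x + \<tau>) (b - d * \<tau>) \<le> 3 * flux (snd x + \<tau>) b"
proof (cases "b \<le> 2 * (d * \<tau>)")
  case True
  have "flux (snd x + \<tau>) (b - d * \<tau>) \<le> flux (snd x + \<tau>) b"
    using good[OF assms(1) True] assms d x by (intro flux_time_mono) (simp_all)
  then show ?thesis using flux_nonneg[of "snd x + \<tau>" b] x b assms by linarith
next
  case False
  then show ?thesis using assms d x by (intro flux_half_time) simp_all
qed

text \<open>The right-hand side of \<open>nn_integral_abs_diff_le\<close> for the masses 2 Gamma
  \<xi> (b - d \<tau>) and 2 Gamma \<xi> b, reduced to a multiple of d and a Gaussian at the single
  time b.\<close>

lemma diff_bound_real:
  assumes \<tau>: "0 < \<tau>" "d * \<tau> < b"
  defines "\<theta> \<equiv> ((b - d * \<tau>) / b) powr ((real CARD('n) + 3) / 2)" and "\<xi> \<equiv> snd x + \<tau>"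
  shows "2 * Gamma \<xi> b - 2 * Gamma \<xi> (b - d * \<tau>) + 2 * (1 - \<theta>) * (2 * Gamma \<xi> (b - d * \<tau>))
     \<le> d * ((8 * (real CARD('n) + 3) * (\<xi> / b) + \<xi> ^ 3 / b\<^sup>2) * Gamma \<xi> b)"
proof -
  define a where "a = b - d * \<tau>"
  define N where "N = real CARD('n) + 3"
  have N: "N \<ge> 1" by (simp add: N_def)
  have a: "0 < a" "a \<le> b" and da: "b - a = d * \<tau>" using \<tau> d by (simp_all add: a_def)
  have \<theta>: "0 \<le> \<theta>" "1 - \<theta> \<le> N / 2 * (d * \<tau>) / a"
    using one_minus_powr_le[OF a, of "N / 2"] N by (simp_all add: \<theta>_def N_def a_def)
  have gb: "0 \<le> Gamma \<xi> b" and ga: "0 \<le> Gamma \<xi> a" by simp_all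
  have g2: "Gamma \<xi> a \<le> 2 * Gamma \<xi> b" using Gamma_lag[OF \<tau>] by (simp add: a_def \<xi>_def)
  have \<xi>: "\<tau> \<le> \<xi>" "0 < \<xi>" using x \<tau> by (simp_all add: \<xi>_def)
  have dt: "0 \<le> d * \<tau>" using d \<tau> by simp
  have "2 * Gamma \<xi> b - 2 * Gamma \<xi> a + 2 * (1 - \<theta>) * (2 * Gamma \<xi> a)
     \<le> (d * \<tau>) * ((8 * N / b + \<xi>\<^sup>2 / b\<^sup>2) * Gamma \<xi> b)"
  proof (cases "b \<le> 2 * (d * \<tau>)")
    \<comment> \<open>Late half: nothing is used of \<theta> but \<theta> >= 0. The crude bound 4
      Gamma \<xi> b is already of the right order, since d \<tau> >= b/2 gives 8 d \<tau> / b >=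
      4.\<close>
    case True
    have "Gamma \<xi> a \<le> Gamma \<xi> b"
      using good[OF \<tau>(1) True] a b by (intro Gamma_time_mono) (simp_all add: \<xi>_def)
    moreover have "0 \<le> \<theta> * Gamma \<xi> a" using \<theta> by simp
    ultimately have "2 * Gamma \<xi> b - 2 * Gamma \<xi> a + 2 * (1 - \<theta>) * (2 * Gamma \<xi> a) \<le> 4 * Gamma \<xi> b"
      by (simp add: algebra_simps)
    also have "\<dots> \<le> (d * \<tau>) * ((8 * N / b + \<xi>\<^sup>2 / b\<^sup>2)) * Gamma \<xi> b"
    proof (intro mult_right_mono gb)
      have "4 \<le> (d * \<tau>) * (8 * 1 / b)" using True b by (simp add: field_simps)
      also have "\<dots> \<le> (d * \<tau>) * ((8 * N / b + \<xi>\<^sup>2 / b\<^sup>2))"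
      proof (intro mult_left_mono dt)
        have "8 * 1 / b \<le> 8 * N / b" using N b by (intro divide_right_mono) simp_all
        then show "8 * 1 / b \<le> 8 * N / b + \<xi>\<^sup>2 / b\<^sup>2" by (smt (verit) divide_nonneg_nonneg zero_le_power2)
      qed
      finally show "4 \<le> (d * \<tau>) * ((8 * N / b + \<xi>\<^sup>2 / b\<^sup>2))" .
    qed
    finally show ?thesis by (simp add: mult_ac)
  next
    \<comment> \<open>Early half: here 1/a <= 2/b. The factor 8 N is 4 from the expression itself, N
      from 1 - \<theta> <= N d \<tau> / b, and 2 from replacing Gamma \<xi> a by Gamma \<xi>
      b.\<close>
    case False
    then have ab: "b \<le> 2 * a" by (simp add: a_def)
    have ia: "1 / a \<le> 2 / b" using ab a b by (simp add: field_simps)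
    have "Gamma \<xi> b - Gamma \<xi> a \<le> Gamma \<xi> b * (\<xi>\<^sup>2 * (d * \<tau>) / (4 * a * b))"
      using Gamma_time_diff[OF a, of \<xi>] by (simp add: da)
    also have "\<dots> = (Gamma \<xi> b * (\<xi>\<^sup>2 * (d * \<tau>) / (4 * b))) * (1 / a)" using a by simp
    also have "\<dots> \<le> (Gamma \<xi> b * (\<xi>\<^sup>2 * (d * \<tau>) / (4 * b))) * (2 / b)"
      using b by (intro mult_left_mono ia mult_nonneg_nonneg[OF gb] divide_nonneg_nonneg mult_nonneg_nonneg[OF zero_le_power2 dt]) simp_all
    finally have 1: "2 * (Gamma \<xi> b - Gamma \<xi> a) \<le> (d * \<tau>) * (\<xi>\<^sup>2 / b\<^sup>2 * Gamma \<xi> b)"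
      using b by (simp add: power2_eq_square field_simps)
    have "1 - \<theta> \<le> N / 2 * (d * \<tau>) * (1 / a)" using \<theta> by simp
    also have "\<dots> \<le> N / 2 * (d * \<tau>) * (2 / b)" using N by (intro mult_left_mono ia mult_nonneg_nonneg[OF _ dt]) simp_all
    finally have "1 - \<theta> \<le> N * (d * \<tau>) / b" by simp
    then have "(1 - \<theta>) * Gamma \<xi> a \<le> (N * (d * \<tau>) / b) * (2 * Gamma \<xi> b)"
      using g2 ga N dt b by (intro mult_mono) simp_all
    then have "4 * ((1 - \<theta>) * Gamma \<xi> a) \<le> 4 * ((N * (d * \<tau>) / b) * (2 * Gamma \<xi> b))"
      by (rule mult_left_mono) simp
    then have 2: "2 * (1 - \<theta>) * (2 * Gamma \<xi> a) \<le> (d * \<tau>) * (8 * N / b * Gamma \<xi> b)"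
      by (simp add: mult_ac)
    from 1 2 show ?thesis by (simp add: algebra_simps)
  qed
  \<comment> \<open>Replacing \<tau> by \<xi> = x_N + \<tau> makes the bound a function of \<xi>
    with an explicit primitive.\<close>
  also have "\<dots> \<le> (d * \<xi>) * ((8 * N / b + \<xi>\<^sup>2 / b\<^sup>2) * Gamma \<xi> b)"
    using \<xi> d b N gb by (intro mult_right_mono mult_left_mono mult_nonneg_nonneg add_nonneg_nonneg) simp_all
  also have "\<dots> = d * ((8 * N * (\<xi> / b) + \<xi> ^ 3 / b\<^sup>2) * Gamma \<xi> b)"
    by (simp add: field_simps power2_eq_square power3_eq_cube)
  finally show ?thesis by (simp add: a_def N_def)
qed

lemma dyn_kernel_diff_slice:
  assumes \<tau>: "0 < \<tau>"
  defines "\<xi> \<equiv> snd x + \<tau>"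
  shows "L1_on Omega (\<lambda>y. dyn_kernel d \<kappa> b x y \<tau> - dyn_kernel 0 \<kappa> b x y \<tau>)
     \<le> ennreal (d * ((8 * (real CARD('n) + 3) * (\<xi> / b) + \<xi> ^ 3 / b\<^sup>2) * Gamma \<xi> b))"
proof -
  have kt: "0 \<le> \<kappa> * \<tau>" using \<kappa> \<tau> by simp
  define B where "B = (\<lambda>y. flux_kernel x y (b + \<kappa> * \<tau>) b \<tau> * indicator Omega y)"
  have B: "has_bochner_integral lborel B (2 * Gamma \<xi> b)"
    unfolding B_def \<xi>_def using b kt x \<tau> by (intro has_bochner_integral_flux_kernel) simp_all
  have KB: "dyn_kernel 0 \<kappa> b x y \<tau> * indicator Omega y = B y" for y
    using \<tau> b by (simp add: B_def dyn_kernel_def)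
  have B0: "0 \<le> B y" for y
    using b \<tau> x by (auto simp: B_def indicator_def flux_kernel_nonneg simp del: mem_Omega)
  show ?thesis
  proof (cases "d * \<tau> < b")
    case True
    define a where "a = b - d * \<tau>"
    have a: "0 < a" "a \<le> b" using True d \<tau> by (simp_all add: a_def)
    define A where "A = (\<lambda>y. flux_kernel x y (a + \<kappa> * \<tau>) a \<tau> * indicator Omega y)"
    have A: "has_bochner_integral lborel A (2 * Gamma \<xi> a)"
      unfolding A_def \<xi>_def using a kt x \<tau> by (intro has_bochner_integral_flux_kernel) simp_all
    have KA: "dyn_kernel d \<kappa> b x y \<tau> * indicator Omega y = A y" for y
      using \<tau> True by (simp add: A_def dyn_kernel_def a_def)
    have A0: "0 \<le> A y" for y
      using a \<tau> x by (auto simp: A_def indicator_def flux_kernel_nonneg simp del: mem_Omega)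
    let ?\<theta> = "(a / b) powr ((real CARD('n) + 3) / 2)"
    \<comment> \<open>Adding the same tangential time \<kappa> \<tau> to both times only moves their
      quotient closer to 1.\<close>
    have r: "a / b \<le> (a + \<kappa> * \<tau>) / (b + \<kappa> * \<tau>)"
    proof -
      have "a * (\<kappa> * \<tau>) \<le> b * (\<kappa> * \<tau>)" using a kt by (intro mult_right_mono) simp_all
      then show ?thesis using b kt by (simp add: divide_le_eq le_divide_eq algebra_simps)
    qed
    have "?\<theta> * A y \<le> B y" for y
      using flux_kernel_scale[OF a _ _ r x, of \<tau> y] a kt \<tau> by (auto simp: A_def B_def indicator_def)
    moreover have "?\<theta> \<le> 1" using a by (intro powr_le1) simp_all
    ultimately have "(\<integral>\<^sup>+y. ennreal \<bar>A y - B y\<bar> \<partial>lborel) \<le> ennreal (2 * Gamma \<xi> b - 2 * Gamma \<xi> a + 2 * (1 - ?\<theta>) * (2 * Gamma \<xi> a))"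
      by (intro nn_integral_abs_diff_le A B A0) simp_all
    also have "\<dots> \<le> ennreal (d * ((8 * (real CARD('n) + 3) * (\<xi> / b) + \<xi> ^ 3 / b\<^sup>2) * Gamma \<xi> b))"
      unfolding a_def \<xi>_def by (intro ennreal_leI diff_bound_real \<tau> True)
    finally show ?thesis unfolding KA[symmetric] KB[symmetric]
      by (simp add: abs_mult left_diff_distrib[symmetric])
  next
    \<comment> \<open>From \<tau> = b/d on, the lagged kernel is switched off, so that the whole
      mass 2 Gamma \<xi> b of the limit kernel counts as error. Since d \<xi> >= d \<tau> >= b, the
      linear term of the bound already covers it.\<close>
    case False
    have "L1_on Omega (\<lambda>y. dyn_kernel d \<kappa> b x y \<tau> - dyn_kernel 0 \<kappa> b x y \<tau>) = (\<integral>\<^sup>+y. ennreal (B y) \<partial>lborel)"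
    proof (intro nn_integral_cong arg_cong[of _ _ ennreal])
      fix y
      have "dyn_kernel d \<kappa> b x y \<tau> = 0" using False by (simp add: dyn_kernel_def)
      then have "\<bar>dyn_kernel d \<kappa> b x y \<tau> - dyn_kernel 0 \<kappa> b x y \<tau>\<bar> * indicator Omega y = \<bar>B y\<bar>"
        unfolding KB[symmetric] by (simp add: abs_mult)
      then show "\<bar>dyn_kernel d \<kappa> b x y \<tau> - dyn_kernel 0 \<kappa> b x y \<tau>\<bar> * indicator Omega y = B y"
        using B0[of y] by simp
    qed
    also have "\<dots> = ennreal (2 * Gamma \<xi> b)"
      using B B0 by (subst nn_integral_eq_integral) (auto simp: has_bochner_integral_iff)
    also have "\<dots> \<le> ennreal (d * ((8 * (real CARD('n) + 3) * (\<xi> / b) + \<xi> ^ 3 / b\<^sup>2) * Gamma \<xi> b))"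
    proof (intro ennreal_leI)
      have \<xi>: "\<tau> \<le> \<xi>" "0 < \<xi>" using x \<tau> by (simp_all add: \<xi>_def)
      have "d * \<tau> \<le> d * \<xi>" using d \<xi> by (intro mult_left_mono) simp_all
      then have "2 * 1 \<le> 8 * (real CARD('n) + 3) * ((d * \<xi>) / b)"
        using False b by (intro mult_mono) (simp_all add: field_simps)
      also have "\<dots> \<le> d * (8 * (real CARD('n) + 3) * (\<xi> / b) + \<xi> ^ 3 / b\<^sup>2)"
        using d \<xi> by (simp add: algebra_simps)
      finally show "2 * Gamma \<xi> b \<le> d * ((8 * (real CARD('n) + 3) * (\<xi> / b) + \<xi> ^ 3 / b\<^sup>2) * Gamma \<xi> b)"
        unfolding mult.assoc[symmetric, of d] by (intro mult_right_mono) simp_all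
    qed
    finally show ?thesis .
  qed
qed

lemma dyn_kernel_slice:
  "L1_on Omega (\<lambda>y. dyn_kernel d \<kappa> b x y \<tau>) \<le> ennreal (4 * Gamma (snd x + \<tau>) b) * indicator {0<..} \<tau>"
proof (cases "0 < \<tau> \<and> d * \<tau> < b")
  case True
  have kt: "0 \<le> \<kappa> * \<tau>" using \<kappa> True by simp
  have A: "has_bochner_integral lborel (\<lambda>y. flux_kernel x y (b - d * \<tau> + \<kappa> * \<tau>) (b - d * \<tau>) \<tau> * indicator Omega y) (2 * Gamma (snd x + \<tau>) (b - d * \<tau>))"
    using True kt x by (intro has_bochner_integral_flux_kernel) simp_all
  have "L1_on Omega (\<lambda>y. dyn_kernel d \<kappa> b x y \<tau>)
    = (\<integral>\<^sup>+y. ennreal (flux_kernel x y (b - d * \<tau> + \<kappa> * \<tau>) (b - d * \<tau>) \<tau> * indicator Omega y) \<partial>lborel)"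
    using True x by (intro nn_integral_cong) (auto simp: dyn_kernel_def indicator_def flux_kernel_nonneg)
  also have "\<dots> = ennreal (2 * Gamma (snd x + \<tau>) (b - d * \<tau>))"
    using A True x by (subst nn_integral_eq_integral) (auto simp: has_bochner_integral_iff indicator_def flux_kernel_nonneg)
  also have "\<dots> \<le> ennreal (4 * Gamma (snd x + \<tau>) b)"
    using Gamma_lag[of \<tau>] True by (intro ennreal_leI) simp
  finally show ?thesis using True by simp
next
  case False
  then have "dyn_kernel d \<kappa> b x y \<tau> = 0" for y by (auto simp: dyn_kernel_def)
  then show ?thesis by simp
qed

text \<open>The constant is 2 c + 40 with c = 8 (n + 3), where n = CARD('n).\<close>

lemma dyn_kernel_diff_total:
  "L1_total Omega (\<lambda>y \<tau>. dyn_kernel d \<kappa> b x y \<tau> - dyn_kernel 0 \<kappa> b x y \<tau>)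
   \<le> ennreal (d * ((16 * real CARD('n) + 88) * (Gamma (snd x) b + Gamma (snd x) (2 * b))))"
  using L1_total_le_cubic[OF b x _ d dyn_kernel_diff_slice] by (simp add: dyn_kernel_def algebra_simps)

lemma dyn_kernel_total:
  "L1_total Omega (dyn_kernel d \<kappa> b x)
    \<le> ennreal 4 * (\<integral>\<^sup>+\<tau>. ennreal (Gamma (snd x + \<tau>) b) * indicator {0<..} \<tau> \<partial>lborel)"
proof -
  have "L1_total Omega (dyn_kernel d \<kappa> b x)
    \<le> (\<integral>\<^sup>+\<tau>. ennreal 4 * (ennreal (Gamma (snd x + \<tau>) b) * indicator {0<..} \<tau>) \<partial>lborel)"
    by (intro nn_integral_mono order_trans[OF dyn_kernel_slice]) (simp add: ennreal_mult mult.assoc)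
  then show ?thesis by (simp add: nn_integral_cmult)
qed

lemma dyn_kernel_boundary_slice:
  "(\<integral>\<^sup>+y'. ennreal \<bar>dyn_kernel d \<kappa> b x (y', 0) \<tau>\<bar> \<partial>lborel) \<le> ennreal (3 * flux (snd x + \<tau>) b) * indicator {0<..} \<tau>"
proof (cases "0 < \<tau> \<and> d * \<tau> < b")
  case True
  have kt: "0 \<le> \<kappa> * \<tau>" using \<kappa> True by simp
  have f: "0 \<le> flux (snd x + \<tau>) (b - d * \<tau>)" using True x by (simp add: flux_nonneg)
  have "(\<integral>\<^sup>+y'. ennreal \<bar>dyn_kernel d \<kappa> b x (y', 0) \<tau>\<bar> \<partial>lborel)
    = (\<integral>\<^sup>+y'. ennreal (flux (snd x + \<tau>) (b - d * \<tau>)) * ennreal (Gamma (fst x - y') (b - d * \<tau> + \<kappa> * \<tau>)) \<partial>lborel)"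
    using True f by (intro nn_integral_cong) (simp add: dyn_kernel_def flux_kernel_def abs_mult ennreal_mult mult.commute)
  also have "\<dots> = ennreal (flux (snd x + \<tau>) (b - d * \<tau>))"
    using True kt nn_integral_lborel_reflect[of "\<lambda>y. ennreal (Gamma y (b - d * \<tau> + \<kappa> * \<tau>))" "fst x"]
    by (subst nn_integral_cmult) (simp_all add: nn_integral_Gamma)
  also have "\<dots> \<le> ennreal (3 * flux (snd x + \<tau>) b)"
    using flux_lag[of \<tau>] True by (intro ennreal_leI) simp
  finally show ?thesis using True by simp
next
  case False
  then have "dyn_kernel d \<kappa> b x y \<tau> = 0" for y by (auto simp: dyn_kernel_def)
  then show ?thesis by simp
qed

text \<open>Boundedness is enough for this part: in \<open>usol\<close> the integral over the
  boundary data carries the prefactor \<delta>/\<epsilon>, so it is itself an error of order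
  \<delta>.\<close>

lemma dyn_kernel_boundary_total:
  "(\<integral>\<^sup>+\<tau>. \<integral>\<^sup>+y'. ennreal \<bar>dyn_kernel d \<kappa> b x (y', 0) \<tau>\<bar> \<partial>lborel \<partial>lborel) \<le> ennreal (6 * Gamma (snd x) b)"
proof -
  have "(\<integral>\<^sup>+\<tau>. \<integral>\<^sup>+y'. ennreal \<bar>dyn_kernel d \<kappa> b x (y', 0) \<tau>\<bar> \<partial>lborel \<partial>lborel)
    \<le> (\<integral>\<^sup>+\<tau>. ennreal 3 * (ennreal (flux (snd x + \<tau>) b) * indicator {0<..} \<tau>) \<partial>lborel)"
  proof (intro nn_integral_mono order_trans[OF dyn_kernel_boundary_slice])
    fix \<tau>
    show "ennreal (3 * flux (snd x + \<tau>) b) * indicator {0<..} \<tau> \<le> ennreal 3 * (ennreal (flux (snd x + \<tau>) b) * indicator {0<..} \<tau>)"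
      using x b by (cases "0 < \<tau>") (simp_all add: ennreal_mult flux_nonneg)
  qed
  also have "\<dots> = ennreal (6 * Gamma (snd x) b)"
    by (subst nn_integral_cmult, simp, subst nn_integral_flux[OF b x], subst ennreal_mult[symmetric]) simp_all
  finally show ?thesis .
qed

end

text \<open>Only the tangential times differ, so both kernels have the same mass and the signed part
  B - A integrates to zero. What remains is 2 (1 - \<theta>) A with exponent n/2, which gives c = 2
  n in the constant 2 c + 40.\<close>

lemma dyn_kernel_diffusion_diff_total:
  fixes x :: "('n::finite) pt"
  assumes k: "0 \<le> k" and b: "0 < b" and x: "0 \<le> snd x"
  shows "L1_total Omega (\<lambda>y \<tau>. dyn_kernel 0 k b x y \<tau> - dyn_kernel 0 0 b x y \<tau>)
   \<le> ennreal (k * ((4 * real CARD('n) + 40) * (Gamma (snd x) b + Gamma (snd x) (2 * b))))"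
proof -
  let ?c = "2 * real CARD('n)"
  have slice: "L1_on Omega (\<lambda>y. dyn_kernel 0 k b x y \<tau> - dyn_kernel 0 0 b x y \<tau>)
      \<le> ennreal (k * (?c * ((snd x + \<tau>) / b) * Gamma (snd x + \<tau>) b))" if \<tau>: "0 < \<tau>" for \<tau>
  proof -
    define \<xi> where "\<xi> = snd x + \<tau>"
    have kt: "0 \<le> k * \<tau>" using k \<tau> by simp
    define A where "A = (\<lambda>y. flux_kernel x y b b \<tau> * indicator Omega y)"
    define B where "B = (\<lambda>y. flux_kernel x y (b + k * \<tau>) b \<tau> * indicator Omega y)"
    have B: "has_bochner_integral lborel B (2 * Gamma \<xi> b)"
      unfolding B_def \<xi>_def using b kt x \<tau> by (intro has_bochner_integral_flux_kernel) simp_all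
    have A: "has_bochner_integral lborel A (2 * Gamma \<xi> b)"
      unfolding A_def \<xi>_def using b kt x \<tau> by (intro has_bochner_integral_flux_kernel) simp_all
    have A0: "0 \<le> A y" for y
      using b \<tau> x by (auto simp: A_def indicator_def flux_kernel_nonneg simp del: mem_Omega)
    let ?\<theta> = "(b / (b + k * \<tau>)) powr (real CARD('n) / 2)"
    have "?\<theta> * A y \<le> B y" for y
    proof (cases "y \<in> Omega")
      case True
      then have "?\<theta> * Gamma (fst x - fst y) b * flux (snd x + snd y + \<tau>) b \<le> Gamma (fst x - fst y) (b + k * \<tau>) * flux (snd x + snd y + \<tau>) b"
        using Gamma_time_scale[of b "b + k * \<tau>" "fst x - fst y"] b kt \<tau> x by (intro mult_right_mono flux_nonneg) simp_all
      then show ?thesis using True by (simp add: A_def B_def flux_kernel_def mult.assoc)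
    qed (simp add: A_def B_def)
    moreover have "?\<theta> \<le> 1" using b kt by (intro powr_le1) simp_all
    ultimately have "(\<integral>\<^sup>+y. ennreal \<bar>A y - B y\<bar> \<partial>lborel) \<le> ennreal (2 * Gamma \<xi> b - 2 * Gamma \<xi> b + 2 * (1 - ?\<theta>) * (2 * Gamma \<xi> b))"
      by (intro nn_integral_abs_diff_le A B A0) simp_all
    also have "\<dots> \<le> ennreal (k * (?c * (\<xi> / b) * Gamma \<xi> b))"
    proof (intro ennreal_leI)
      have "1 - ?\<theta> \<le> real CARD('n) / 2 * (b + k * \<tau> - b) / b"
        using b kt by (intro one_minus_powr_le) simp_all
      also have "\<dots> = real CARD('n) / 2 * (k * \<tau>) / b" by simp
      also have "\<dots> \<le> real CARD('n) / 2 * (k * \<xi>) / b"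
        using b k x by (intro divide_right_mono mult_left_mono) (simp_all add: \<xi>_def)
      finally have "(1 - ?\<theta>) * Gamma \<xi> b \<le> (real CARD('n) / 2 * (k * \<xi>) / b) * Gamma \<xi> b"
        by (rule mult_right_mono) simp
      then have "4 * ((1 - ?\<theta>) * Gamma \<xi> b) \<le> 4 * ((real CARD('n) / 2 * (k * \<xi>) / b) * Gamma \<xi> b)"
        by (rule mult_left_mono) simp
      also have "\<dots> = k * (?c * (\<xi> / b) * Gamma \<xi> b)" by simp
      also have "4 * ((1 - ?\<theta>) * Gamma \<xi> b) = 2 * Gamma \<xi> b - 2 * Gamma \<xi> b + 2 * (1 - ?\<theta>) * (2 * Gamma \<xi> b)" by simp
      finally show "2 * Gamma \<xi> b - 2 * Gamma \<xi> b + 2 * (1 - ?\<theta>) * (2 * Gamma \<xi> b) \<le> k * (?c * (\<xi> / b) * Gamma \<xi> b)" .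
    qed
    finally have "(\<integral>\<^sup>+y. ennreal \<bar>A y - B y\<bar> \<partial>lborel) \<le> ennreal (k * (?c * (\<xi> / b) * Gamma \<xi> b))" .
    moreover have "\<bar>dyn_kernel 0 k b x y \<tau> - dyn_kernel 0 0 b x y \<tau>\<bar> * indicator Omega y = \<bar>A y - B y\<bar>" for y
      using \<tau> b by (auto simp: A_def B_def dyn_kernel_def indicator_def)
    ultimately show ?thesis by (simp add: \<xi>_def)
  qed
  \<comment> \<open>The cubic term is added only to bring the bound into the form that
    \<open>L1_total_le_cubic\<close> integrates.\<close>
  have "L1_on Omega (\<lambda>y. dyn_kernel 0 k b x y \<tau> - dyn_kernel 0 0 b x y \<tau>)
      \<le> ennreal (k * ((?c * ((snd x + \<tau>) / b) + (snd x + \<tau>) ^ 3 / b\<^sup>2) * Gamma (snd x + \<tau>) b))" if \<tau>: "0 < \<tau>" for \<tau>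
    using k b x \<tau> by (intro order_trans[OF slice[OF \<tau>]] ennreal_leI mult_left_mono mult_right_mono) simp_all
  from L1_total_le_cubic[OF b x _ k this] show ?thesis by (simp add: dyn_kernel_def)
qed

section \<open>Bounds that are uniform on Q(R)\<close>

lemma nn_integral_Gamma_ray:
  assumes b: "0 < b"
  shows "(\<integral>\<^sup>+\<tau>. ennreal (Gamma (\<xi> + \<tau> :: real) b) * indicator {0<..} \<tau> \<partial>lborel) \<le> 1"
proof -
  have "(\<integral>\<^sup>+\<tau>. ennreal (Gamma (\<xi> + \<tau> :: real) b) * indicator {0<..} \<tau> \<partial>lborel) \<le> (\<integral>\<^sup>+\<tau>. ennreal (Gamma (\<xi> + \<tau>) b) \<partial>lborel)"
    by (intro nn_integral_mono) (simp add: indicator_def)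
  also have "\<dots> = 1" using nn_integral_lborel_translate[of "\<lambda>\<tau>. ennreal (Gamma \<tau> b)" \<xi>] b by (simp add: nn_integral_Gamma)
  finally show ?thesis .
qed

text \<open>On Q(R) either t >= R/2, and the prefactor is bounded, or x_N > R/2, and the bound
  1/\<xi> holds at all times. Requiring only t/\<epsilon> <= b admits both b = t/\<epsilon> and its
  double.\<close>

lemma Gamma_bound_Q:
  assumes e: "0 < \<epsilon>" and R: "0 < R" and x: "0 \<le> \<xi>" and t: "0 < t" and Q: "R < \<xi> + t" and b: "t / \<epsilon> \<le> b"
  shows "Gamma (\<xi>::real) b \<le> 2 / R + 1 / sqrt (4 * pi * (R / 2 / \<epsilon>))"
proof (cases "R / 2 \<le> t")
  case True
  then have "R / 2 / \<epsilon> \<le> b" using e b divide_right_mono[of "R / 2" t \<epsilon>] by linarith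
  then have "Gamma \<xi> b \<le> 1 / sqrt (4 * pi * (R / 2 / \<epsilon>))" using e R by (intro Gamma_le_sqrt) simp_all
  then show ?thesis using R by (smt (verit) divide_nonneg_nonneg)
next
  case False
  then have \<xi>: "R / 2 \<le> \<xi>" using Q by simp
  have "0 < b" using t e b by (meson divide_pos_pos less_le_trans)
  then have "Gamma \<xi> b \<le> 1 / \<xi>" using \<xi> R by (intro Gamma_le_inverse) simp_all
  also have "\<dots> \<le> 1 / (R / 2)" using \<xi> R by (intro divide_left_mono) simp_all
  finally have "Gamma \<xi> b \<le> 2 / R" by simp
  moreover have "0 \<le> 1 / sqrt (4 * pi * (R / 2 / \<epsilon>))" using e R by simp
  ultimately show ?thesis by linarith
qed

text \<open>Each smallness condition on \<delta> serves one case. If t >= R/2, then t <= 2 \<delta>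
  \<tau> forces \<tau> >= R/(4 \<delta>), and the term \<tau>^2 of the square suffices by 48
  \<delta>^2 <= R \<epsilon>. Otherwise x_N > R/2, and the cross term 2 x_N \<tau> suffices by 12
  \<delta> <= R \<epsilon>.\<close>

lemma time_lag_Q:
  fixes x :: "('n::finite) pt"
  assumes e: "0 < \<epsilon>" and R: "0 < R" and x: "0 \<le> snd x" and t: "0 < t" and Q: "R < snd x + t"
    and dl: "0 < \<delta>" "\<delta> \<le> R * \<epsilon> / 12" "48 * \<delta>\<^sup>2 \<le> R * \<epsilon>" and k: "0 \<le> \<kappa>"
  shows "time_lag (\<delta> / \<epsilon>) \<kappa> (t / \<epsilon>) x"
proof
  show "0 \<le> \<delta> / \<epsilon>" "0 \<le> \<kappa>" "0 < t / \<epsilon>" "0 \<le> snd x" using assms by simp_all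
  fix \<tau> assume \<tau>: "0 < \<tau>" and "t / \<epsilon> \<le> 2 * (\<delta> / \<epsilon> * \<tau>)"
  then have td: "t \<le> 2 * \<delta> * \<tau>" using e by (simp add: field_simps)
  show "6 * (t / \<epsilon>) \<le> (snd x + \<tau>)\<^sup>2"
  proof (cases "R / 2 \<le> t")
    case True
    have 1: "48 * \<delta>\<^sup>2 * \<tau> \<le> R * \<epsilon> * \<tau>" using dl \<tau> by (intro mult_right_mono) simp_all
    have "R \<le> 4 * \<delta> * \<tau>" using True td by simp
    then have "R * \<epsilon> * \<tau> \<le> (4 * \<delta> * \<tau>) * (\<epsilon> * \<tau>)" using e \<tau> by (simp add: mult_right_mono)
    with 1 have "48 * \<delta>\<^sup>2 * \<tau> \<le> 4 * \<delta> * \<tau> * (\<epsilon> * \<tau>)" by linarith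
    then have "12 * \<delta> \<le> \<epsilon> * \<tau>" using dl \<tau> by (simp add: power2_eq_square)
    then have "12 * \<delta> * \<tau> \<le> \<epsilon> * \<tau> * \<tau>" using \<tau> by (intro mult_right_mono) simp_all
    then have "6 * t \<le> \<epsilon> * \<tau>\<^sup>2" using td by (simp add: power2_eq_square mult.assoc)
    also have "\<dots> \<le> \<epsilon> * (snd x + \<tau>)\<^sup>2" using e x \<tau> by (intro mult_left_mono power_mono) simp_all
    finally show ?thesis using e by (simp add: field_simps)
  next
    case False
    then have \<xi>: "R / 2 \<le> snd x" using Q by simp
    have "6 * t \<le> 12 * \<delta> * \<tau>" using td by simp
    also have "\<dots> \<le> (R * \<epsilon>) * \<tau>" using dl \<tau> by (intro mult_right_mono) simp_all
    also have "\<dots> = \<epsilon> * (2 * (R / 2) * \<tau>)" by simp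
    also have "\<dots> \<le> \<epsilon> * (2 * snd x * \<tau>)" using \<xi> e \<tau> by (intro mult_left_mono mult_right_mono) simp_all
    also have "\<dots> \<le> \<epsilon> * (snd x + \<tau>)\<^sup>2" using e by (intro mult_left_mono) (simp_all add: power2_sum)
    finally show ?thesis using e by (simp add: field_simps)
  qed
qed

section \<open>Convergence rates\<close>

text \<open>One Tonelli bound yields integrability on the product space, Fubini and the estimate.
  The set \<open>S\<close> is \<open>Omega\<close> for the interior data and the whole of R^(N-1)
  for the boundary data.\<close>

lemma kernel_pair:
  fixes A :: "'a::euclidean_space \<Rightarrow> real \<Rightarrow> real"
  assumes A [measurable]: "case_prod A \<in> borel_measurable (lborel \<Otimes>\<^sub>M lborel)"
    and f [measurable]: "f \<in> borel_measurable borel" and S [measurable]: "S \<in> sets borel"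
    and fM: "\<And>y. \<bar>f y\<bar> \<le> M * indicator S y" and M: "0 \<le> M" and c: "0 \<le> c"
    and fin: "L1_total S A \<le> ennreal c"
  shows integrable_kernel_pair: "integrable (lborel \<Otimes>\<^sub>M lborel) (\<lambda>(y, \<tau>). A y \<tau> * f y)"
    and integrable_kernel: "integrable lborel (\<lambda>y. (\<integral>\<tau>. A y \<tau> \<partial>lborel) * f y)"
    and integral_kernel: "(\<integral>y. (\<integral>\<tau>. A y \<tau> \<partial>lborel) * f y \<partial>lborel) = (\<integral>z. (case z of (y, \<tau>) \<Rightarrow> A y \<tau> * f y) \<partial>(lborel \<Otimes>\<^sub>M lborel))"
    and abs_integral_kernel_le: "\<bar>\<integral>y. (\<integral>\<tau>. A y \<tau> \<partial>lborel) * f y \<partial>lborel\<bar> \<le> M * c"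
proof -
  have "(\<integral>\<^sup>+z. ennreal (norm (case z of (y, \<tau>) \<Rightarrow> A y \<tau> * f y)) \<partial>(lborel \<Otimes>\<^sub>M lborel))
     = (\<integral>\<^sup>+\<tau>. \<integral>\<^sup>+y. ennreal (\<bar>A y \<tau>\<bar> * \<bar>f y\<bar>) \<partial>lborel \<partial>lborel)"
    by (subst lborel_pair.nn_integral_snd[symmetric]) (simp_all add: abs_mult)
  also have "\<dots> \<le> (\<integral>\<^sup>+\<tau>. \<integral>\<^sup>+y. ennreal M * ennreal (\<bar>A y \<tau>\<bar> * indicator S y) \<partial>lborel \<partial>lborel)"
  proof (intro nn_integral_mono)
    fix \<tau> y
    have "\<bar>A y \<tau>\<bar> * \<bar>f y\<bar> \<le> \<bar>A y \<tau>\<bar> * (M * indicator S y)" by (intro mult_left_mono fM) simp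
    also have "\<dots> = M * (\<bar>A y \<tau>\<bar> * indicator S y)" by simp
    finally show "ennreal (\<bar>A y \<tau>\<bar> * \<bar>f y\<bar>) \<le> ennreal M * ennreal (\<bar>A y \<tau>\<bar> * indicator S y)"
      using M by (subst ennreal_mult[symmetric]) (simp_all add: ennreal_leI)
  qed
  also have "\<dots> = ennreal M * L1_total S A"
  proof -
    have 1: "(\<integral>\<^sup>+y. ennreal M * ennreal (\<bar>A y \<tau>\<bar> * indicator S y) \<partial>lborel)
       = ennreal M * L1_on S (\<lambda>y. A y \<tau>)" for \<tau>
      by (rule nn_integral_cmult) measurable
    show ?thesis unfolding 1 by (rule nn_integral_cmult) measurable
  qed
  also have "\<dots> \<le> ennreal (M * c)"
    using fin M c by (simp add: ennreal_mult mult_left_mono)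
  finally have bd: "(\<integral>\<^sup>+z. ennreal (norm (case z of (y, \<tau>) \<Rightarrow> A y \<tau> * f y)) \<partial>(lborel \<Otimes>\<^sub>M lborel)) \<le> ennreal (M * c)" .
  show int: "integrable (lborel \<Otimes>\<^sub>M lborel) (\<lambda>(y, \<tau>). A y \<tau> * f y)"
    by (rule integrableI_bounded) (use bd in \<open>auto simp: less_top[symmetric] top_unique\<close>)
  show "integrable lborel (\<lambda>y. (\<integral>\<tau>. A y \<tau> \<partial>lborel) * f y)"
    using lborel_pair.integrable_fst[OF int] by simp
  show eq: "(\<integral>y. (\<integral>\<tau>. A y \<tau> \<partial>lborel) * f y \<partial>lborel) = (\<integral>z. (case z of (y, \<tau>) \<Rightarrow> A y \<tau> * f y) \<partial>(lborel \<Otimes>\<^sub>M lborel))"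
    using lborel_pair.integral_fst[OF int] by simp
  have "ennreal (norm (\<integral>z. (case z of (y, \<tau>) \<Rightarrow> A y \<tau> * f y) \<partial>(lborel \<Otimes>\<^sub>M lborel))) \<le> ennreal (M * c)"
    by (rule order_trans[OF integral_norm_bound_ennreal[OF int] bd])
  then show "\<bar>\<integral>y. (\<integral>\<tau>. A y \<tau> \<partial>lborel) * f y \<partial>lborel\<bar> \<le> M * c"
    using M c unfolding eq by (subst (asm) ennreal_le_iff) simp_all
qed

text \<open>The subtraction takes place on the product space, since integrability in \<tau> for
  fixed \<open>y\<close> is available only almost everywhere.\<close>

lemma kernel_diff_le:
  fixes A B :: "'a::euclidean_space \<Rightarrow> real \<Rightarrow> real"
  assumes A [measurable]: "case_prod A \<in> borel_measurable (lborel \<Otimes>\<^sub>M lborel)"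
    and B [measurable]: "case_prod B \<in> borel_measurable (lborel \<Otimes>\<^sub>M lborel)"
    and f [measurable]: "f \<in> borel_measurable borel" and S [measurable]: "S \<in> sets borel"
    and fM: "\<And>y. \<bar>f y\<bar> \<le> M * indicator S y" and M: "0 \<le> M" and c: "0 \<le> a" "0 \<le> b" "0 \<le> c"
    and finA: "L1_total S A \<le> ennreal a"
    and finB: "L1_total S B \<le> ennreal b"
    and finD: "L1_total S (\<lambda>y \<tau>. A y \<tau> - B y \<tau>) \<le> ennreal c"
  shows "\<bar>(\<integral>y. (\<integral>\<tau>. A y \<tau> \<partial>lborel) * f y \<partial>lborel) - (\<integral>y. (\<integral>\<tau>. B y \<tau> \<partial>lborel) * f y \<partial>lborel)\<bar> \<le> M * c"
proof -
  note KA = kernel_pair[OF A f S fM M c(1) finA] and KB = kernel_pair[OF B f S fM M c(2) finB]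
  have D: "case_prod (\<lambda>y \<tau>. A y \<tau> - B y \<tau>) \<in> borel_measurable (lborel \<Otimes>\<^sub>M lborel)" by measurable
  note KD = kernel_pair[OF D f S fM M c(3) finD]
  have "(\<integral>y. (\<integral>\<tau>. A y \<tau> \<partial>lborel) * f y \<partial>lborel) - (\<integral>y. (\<integral>\<tau>. B y \<tau> \<partial>lborel) * f y \<partial>lborel)
      = (\<integral>y. (\<integral>\<tau>. A y \<tau> - B y \<tau> \<partial>lborel) * f y \<partial>lborel)"
    unfolding KA(3) KB(3) KD(3) Bochner_Integration.integral_diff[OF KA(1) KB(1), symmetric]
    by (rule Bochner_Integration.integral_cong) (auto simp: algebra_simps)
  then show ?thesis using KD(4) by simp
qed

section \<open>Reduction of the solution formulas to one family of kernels\<close>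

lemma H_eq_dyn_kernel:
  assumes \<delta>: "0 < \<delta>" and \<epsilon>: "0 < \<epsilon>"
  shows "H \<epsilon> \<delta> \<kappa> x y t / \<delta> = dyn_integral (\<delta> / \<epsilon>) \<kappa> (t / \<epsilon>) x y"
proof -
  let ?g = "\<lambda>\<tau>. indicator {0<..<t} \<tau> *\<^sub>R (Gamma (fst x - fst y) ((t - \<tau>) / \<epsilon> + \<kappa> / \<delta> * \<tau>) *
      dGamma1 (snd x + snd y + \<tau> / \<delta>) ((t - \<tau>) / \<epsilon>))"
  \<comment> \<open>The Jacobian \<delta> of \<tau> -> \<delta> \<tau> cancels the division by
    \<delta> in \<open>G\<close>, and \<tau> < t becomes d \<tau> < b.\<close>
  have "(\<integral>\<tau>. ?g \<tau> \<partial>lborel) = \<delta> * (\<integral>\<tau>. ?g (\<delta> * \<tau>) \<partial>lborel)"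
    using lborel_integral_real_affine[of \<delta> ?g 0] \<delta> by simp
  then have "H \<epsilon> \<delta> \<kappa> x y t / \<delta> = - 2 * (\<integral>\<tau>. ?g (\<delta> * \<tau>) \<partial>lborel)"
    using \<delta> by (simp add: H_def set_lebesgue_integral_def)
  also have "\<dots> = (\<integral>\<tau>. - 2 * ?g (\<delta> * \<tau>) \<partial>lborel)" by (rule integral_mult_right_zero[symmetric])
  also have "\<dots> = dyn_integral (\<delta> / \<epsilon>) \<kappa> (t / \<epsilon>) x y"
  proof (rule Bochner_Integration.integral_cong[OF HOL.refl])
    fix \<tau>
    have iff: "\<delta> * \<tau> \<in> {0<..<t} \<longleftrightarrow> 0 < \<tau> \<and> \<delta> / \<epsilon> * \<tau> < t / \<epsilon>"
      using \<delta> \<epsilon> by (auto simp: zero_less_mult_iff divide_less_cancel)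
    show "- 2 * ?g (\<delta> * \<tau>) = dyn_kernel (\<delta> / \<epsilon>) \<kappa> (t / \<epsilon>) x y \<tau>"
    proof (cases "\<delta> * \<tau> \<in> {0<..<t}")
      case True
      then have s: "(t - \<delta> * \<tau>) / \<epsilon> > 0" using \<epsilon> by simp
      have e: "(t - \<delta> * \<tau>) / \<epsilon> = t / \<epsilon> - \<delta> / \<epsilon> * \<tau>" "\<kappa> / \<delta> * (\<delta> * \<tau>) = \<kappa> * \<tau>" "\<delta> * \<tau> / \<delta> = \<tau>"
        using \<delta> by (simp_all add: diff_divide_distrib)
      have "- 2 * ?g (\<delta> * \<tau>) = Gamma (fst x - fst y) ((t - \<delta> * \<tau>) / \<epsilon> + \<kappa> / \<delta> * (\<delta> * \<tau>)) *
         (- 2 * dGamma1 (snd x + snd y + \<delta> * \<tau> / \<delta>) ((t - \<delta> * \<tau>) / \<epsilon>))"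
        using True by simp
      also have "\<dots> = dyn_kernel (\<delta> / \<epsilon>) \<kappa> (t / \<epsilon>) x y \<tau>"
        unfolding dGamma1_flux[OF s] dyn_kernel_def flux_kernel_def using True[unfolded iff] unfolding e by simp
      finally show ?thesis .
    next
      case False
      then have "dyn_kernel (\<delta> / \<epsilon>) \<kappa> (t / \<epsilon>) x y \<tau> = 0" unfolding iff dyn_kernel_def by (simp only: if_False)
      then show ?thesis using False by simp
    qed
  qed
  finally show ?thesis .
qed

lemma Hhat_eq_dyn_kernel:
  assumes t: "0 < t" and \<epsilon>: "0 < \<epsilon>"
  shows "Hhat \<epsilon> k x y t = dyn_integral 0 k (t / \<epsilon>) x y"
proof -
  have s: "0 < t / \<epsilon>" using t \<epsilon> by simp
  let ?g = "\<lambda>\<tau>. indicator {0<..} \<tau> *\<^sub>R (Gamma (fst x - fst y) (t / \<epsilon> + k * \<tau>) * dGamma1 (snd x + snd y + \<tau>) (t / \<epsilon>))"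
  have "Hhat \<epsilon> k x y t = (\<integral>\<tau>. - 2 * ?g \<tau> \<partial>lborel)"
    by (simp add: Hhat_def set_lebesgue_integral_def)
  also have "\<dots> = dyn_integral 0 k (t / \<epsilon>) x y"
  proof (rule Bochner_Integration.integral_cong[OF HOL.refl])
    fix \<tau>
    have "- 2 * ?g \<tau> = indicator {0<..} \<tau> * (Gamma (fst x - fst y) (t / \<epsilon> + k * \<tau>) * (- 2 * dGamma1 (snd x + snd y + \<tau>) (t / \<epsilon>)))" by simp
    also have "\<dots> = dyn_kernel 0 k (t / \<epsilon>) x y \<tau>"
      unfolding dGamma1_flux[OF s] dyn_kernel_def flux_kernel_def using s by (simp add: indicator_def)
    finally show "- 2 * ?g \<tau> = dyn_kernel 0 k (t / \<epsilon>) x y \<tau>" .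
  qed
  finally show ?thesis .
qed

text \<open>With the reflection moved to \<open>x\<close>, the mirror kernel becomes a reflected
  translate in \<open>y\<close>, to which the whole-space facts apply.\<close>

lemma Gamma_refl_eq: "Gamma (x - refl y) s = Gamma (refl x - y) s"
  for x y :: "('n::finite) pt"
proof -
  have "norm (x - refl y) = norm (refl x - y)"
    by (simp add: refl_def norm_prod_def abs_minus_commute) (metis abs_minus_cancel minus_add_distrib uminus_add_conv_diff add.commute diff_minus_eq_add)
  then show ?thesis by (simp add: Gamma_def)
qed

lemma integrable_Gamma_mult:
  fixes f :: "'a::euclidean_space \<Rightarrow> real"
  assumes s: "0 < s" and [measurable]: "f \<in> borel_measurable borel" and f: "\<And>y. \<bar>f y\<bar> \<le> M"
  shows "integrable lborel (\<lambda>y. Gamma (x - y) s * f y)"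
    and "\<bar>\<integral>y. Gamma (x - y) s * f y \<partial>lborel\<bar> \<le> M"
proof -
  have G: "has_bochner_integral lborel (\<lambda>y. Gamma (x - y) s * M) (1 * M)"
    by (intro has_bochner_integral_mult_left has_bochner_integral_Gamma s)
  have le: "norm (Gamma (x - y) s * f y) \<le> Gamma (x - y) s * M" for y
    using f[of y] by (simp add: abs_mult mult_left_mono)
  show int: "integrable lborel (\<lambda>y. Gamma (x - y) s * f y)"
  proof (rule Bochner_Integration.integrable_bound)
    show "integrable lborel (\<lambda>y. Gamma (x - y) s * M)" using G by (simp add: has_bochner_integral_iff)
    show "AE y in lborel. norm (Gamma (x - y) s * f y) \<le> norm (Gamma (x - y) s * M)"
      using le by (intro AE_I2 order_trans[OF le]) simp
  qed measurable
  have "\<bar>\<integral>y. Gamma (x - y) s * f y \<partial>lborel\<bar> \<le> (\<integral>y. Gamma (x - y) s * M \<partial>lborel)"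
    using G le by (intro integral_abs_bound_integral int) (auto simp: has_bochner_integral_iff)
  then show "\<bar>\<integral>y. Gamma (x - y) s * f y \<partial>lborel\<bar> \<le> M" using G by (auto simp: has_bochner_integral_iff)
qed

text \<open>The integral runs over the whole space because \<open>f\<close> will vanish outside
  \<open>Omega\<close>. The choice d = 0 gives z_k, and d = \<kappa> = 0 gives z^N.\<close>

definition dyn_sol :: "real \<Rightarrow> real \<Rightarrow> real \<Rightarrow> (('n::finite) pt \<Rightarrow> real) \<Rightarrow> 'n pt \<Rightarrow> real" where
  "dyn_sol d \<kappa> b f x = (\<integral>y. (G0 x y b + dyn_integral d \<kappa> b x y) * f y \<partial>lborel)"

lemma dyn_kernel_pair_measurable [measurable]:
  "(\<lambda>(y, \<tau>). dyn_kernel d \<kappa> b (x :: ('n::finite) pt) y \<tau>) \<in> borel_measurable (lborel \<Otimes>\<^sub>M lborel)"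
  by measurable

lemma dyn_kernel_integral_measurable [measurable]:
  "(\<lambda>y. \<integral>\<tau>. dyn_kernel d \<kappa> b (x :: ('n::finite) pt) y \<tau> \<partial>lborel) \<in> borel_measurable lborel"
  by measurable

lemma G0_measurable [measurable]: "(\<lambda>y. G0 (x :: ('n::finite) pt) y b) \<in> borel_measurable lborel"
  unfolding G0_def Gamma_refl_eq by measurable

text \<open>Essentially bounded data enter through a Borel representative that is bounded
  everywhere; the indicator in \<open>f_bound\<close> also records the extension by zero. All
  estimates in \<open>y\<close> can then be pointwise.\<close>

locale half_space_data =
  fixes f :: "('n::finite) pt \<Rightarrow> real" and M :: real
  assumes f_meas [measurable]: "f \<in> borel_measurable borel"
    and f_bound: "\<And>y. \<bar>f y\<bar> \<le> M * indicator Omega y" and M_nonneg: "0 \<le> M"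
begin

lemma f_le: "\<bar>f y\<bar> \<le> M"
  using f_bound[of y] M_nonneg by (cases "y \<in> Omega") simp_all

lemma f_outside: "snd y \<le> 0 \<Longrightarrow> f y = 0"
  using f_bound[of y] by (simp add: indicator_def)

lemma integrable_G0: "0 < b \<Longrightarrow> integrable lborel (\<lambda>y. G0 x y b * f y)"
  unfolding G0_def Gamma_refl_eq left_diff_distrib
  by (intro Bochner_Integration.integrable_diff integrable_Gamma_mult(1)[OF _ f_meas f_le])

lemma dyn_kernel_total_le:
  assumes "time_lag d \<kappa> b x"
  shows "L1_total Omega (dyn_kernel d \<kappa> b x) \<le> ennreal 4"
  using order_trans[OF time_lag.dyn_kernel_total[OF assms] mult_left_mono[OF nn_integral_Gamma_ray]] time_lag.b[OF assms]
  by simp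

lemma dyn_sol_split:
  assumes t: "time_lag d \<kappa> b x"
  shows "dyn_sol d \<kappa> b f x = (\<integral>y. G0 x y b * f y \<partial>lborel) + (\<integral>y. dyn_integral d \<kappa> b x y * f y \<partial>lborel)"
proof -
  have "integrable lborel (\<lambda>y. dyn_integral d \<kappa> b x y * f y)"
    by (rule integrable_kernel[OF dyn_kernel_pair_measurable f_meas Omega_measurable f_bound M_nonneg _ dyn_kernel_total_le[OF t]]) simp
  from Bochner_Integration.integral_add[OF integrable_G0[OF time_lag.b[OF t]] this] show ?thesis
    unfolding dyn_sol_def distrib_right .
qed

lemma time_lag_0: "0 \<le> \<kappa> \<Longrightarrow> 0 < b \<Longrightarrow> 0 \<le> snd x \<Longrightarrow> time_lag 0 \<kappa> b x"
  by unfold_locales simp_all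

lemma dyn_sol_lag_diff:
  assumes t: "time_lag d \<kappa> b x"
  shows "\<bar>dyn_sol d \<kappa> b f x - dyn_sol 0 \<kappa> b f x\<bar> \<le> M * (d * ((16 * real CARD('n) + 88) * (Gamma (snd x) b + Gamma (snd x) (2 * b))))"
proof -
  interpret time_lag d \<kappa> b x by (rule t)
  have t0: "time_lag 0 \<kappa> b x" by (rule time_lag_0[OF \<kappa> b x])
  have c0: "0 \<le> d * ((16 * real CARD('n) + 88) * (Gamma (snd x) b + Gamma (snd x) (2 * b)))" using d by simp
  show ?thesis
    using kernel_diff_le[OF dyn_kernel_pair_measurable dyn_kernel_pair_measurable f_meas Omega_measurable f_bound M_nonneg _ _ c0
      dyn_kernel_total_le[OF t] dyn_kernel_total_le[OF t0] dyn_kernel_diff_total]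
    unfolding dyn_sol_split[OF t] dyn_sol_split[OF t0] by simp
qed

lemma dyn_sol_diffusion_diff:
  assumes k: "0 \<le> k" and b: "0 < b" and x: "0 \<le> snd x"
  shows "\<bar>dyn_sol 0 k b f x - dyn_sol 0 0 b f x\<bar> \<le> M * (k * ((4 * real CARD('n) + 40) * (Gamma (snd x) b + Gamma (snd x) (2 * b))))"
proof -
  have t: "time_lag 0 k b x" by (rule time_lag_0[OF k b x])
  have t0: "time_lag 0 0 b x" by (rule time_lag_0[OF _ b x]) simp
  have c0: "0 \<le> k * ((4 * real CARD('n) + 40) * (Gamma (snd x) b + Gamma (snd x) (2 * b)))" using k by simp
  show ?thesis
    using kernel_diff_le[OF dyn_kernel_pair_measurable dyn_kernel_pair_measurable f_meas Omega_measurable f_bound M_nonneg _ _ c0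
      dyn_kernel_total_le[OF t] dyn_kernel_total_le[OF t0] dyn_kernel_diffusion_diff_total[OF k b x]]
    unfolding dyn_sol_split[OF t] dyn_sol_split[OF t0] by simp
qed

lemma zk_eq_dyn_sol:
  assumes meas: "set_borel_measurable lborel Omega \<phi>" and ae: "AE y in lborel. indicator Omega y * \<phi> y = f y"
    and t: "0 < t" and \<epsilon>: "0 < \<epsilon>"
  shows "zk \<epsilon> k \<phi> x t = dyn_sol 0 k (t / \<epsilon>) f x"
proof -
  have [measurable]: "(\<lambda>y. indicator Omega y * \<phi> y) \<in> borel_measurable lborel"
    using meas by (simp add: set_borel_measurable_def)
  have "zk \<epsilon> k \<phi> x t = (\<integral>y. Psi \<epsilon> k x y t * (indicator Omega y * \<phi> y) \<partial>lborel)"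
    by (simp add: zk_def set_lebesgue_integral_def mult_ac)
  also have "\<dots> = (\<integral>y. Psi \<epsilon> k x y t * f y \<partial>lborel)"
    unfolding Psi_def Hhat_eq_dyn_kernel[OF t \<epsilon>] using ae by (intro integral_cong_AE) (measurable, auto)
  finally show ?thesis unfolding dyn_sol_def Psi_def Hhat_eq_dyn_kernel[OF t \<epsilon>] .
qed

text \<open>For k = 0 the tangential factor leaves the \<tau>-integral, and the flux integrates to
  twice the mirror Gaussian. This turns the minus sign in \<open>G0\<close> into the plus sign in
  \<open>GN\<close>.\<close>

lemma zN_eq_dyn_sol:
  assumes meas: "set_borel_measurable lborel Omega \<phi>" and ae: "AE y in lborel. indicator Omega y * \<phi> y = f y"
    and t: "0 < t" and \<epsilon>: "0 < \<epsilon>" and x: "0 \<le> snd x"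
  shows "zN \<epsilon> \<phi> x t = dyn_sol 0 0 (t / \<epsilon>) f x"
proof -
  have b: "0 < t / \<epsilon>" using t \<epsilon> by simp
  have [measurable]: "(\<lambda>y. indicator Omega y * \<phi> y) \<in> borel_measurable lborel"
    using meas by (simp add: set_borel_measurable_def)
  have "zN \<epsilon> \<phi> x t = (\<integral>y. GN x y (t / \<epsilon>) * (indicator Omega y * \<phi> y) \<partial>lborel)"
    by (simp add: zN_def set_lebesgue_integral_def mult_ac)
  also have "\<dots> = (\<integral>y. GN x y (t / \<epsilon>) * f y \<partial>lborel)"
    unfolding GN_def Gamma_refl_eq using ae by (intro integral_cong_AE) (measurable, auto)
  also have "\<dots> = dyn_sol 0 0 (t / \<epsilon>) f x"
    unfolding dyn_sol_def
  proof (rule Bochner_Integration.integral_cong[OF HOL.refl])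
    fix y
    show "GN x y (t / \<epsilon>) * f y = (G0 x y (t / \<epsilon>) + dyn_integral 0 0 (t / \<epsilon>) x y) * f y"
    proof (cases "0 < snd y")
      case True
      have "dyn_integral 0 0 (t / \<epsilon>) x y
        = (\<integral>\<tau>. Gamma (fst x - fst y) (t / \<epsilon>) * (flux ((snd x + snd y) + \<tau>) (t / \<epsilon>) * indicator {0<..} \<tau>) \<partial>lborel)"
        using b by (intro Bochner_Integration.integral_cong) (auto simp: dyn_kernel_def flux_kernel_def indicator_def)
      also have "\<dots> = Gamma (fst x - fst y) (t / \<epsilon>) * (2 * Gamma (snd x + snd y) (t / \<epsilon>))"
        using has_bochner_integral_flux[OF b, of "snd x + snd y"] x True by (simp add: has_bochner_integral_iff)
      also have "\<dots> = 2 * Gamma (x - refl y) (t / \<epsilon>)"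
        unfolding Gamma_prod[OF b] by (simp add: refl_def)
      finally show ?thesis by (simp add: GN_def G0_def)
    qed (simp add: f_outside)
  qed
  finally show ?thesis .
qed

lemma usol_eq_dyn_sol:
  assumes meas: "set_borel_measurable lborel Omega \<phi>" and ae: "AE y in lborel. indicator Omega y * \<phi> y = f y"
    and psi: "\<psi> \<in> borel_measurable lborel" and g [measurable]: "g \<in> borel_measurable borel" and aeg: "AE y in lborel. \<psi> y = g y"
    and \<delta>: "0 < \<delta>" and \<epsilon>: "0 < \<epsilon>"
  shows "usol \<epsilon> \<delta> \<kappa> \<phi> \<psi> x t = dyn_sol (\<delta> / \<epsilon>) \<kappa> (t / \<epsilon>) f x
     + \<delta> / \<epsilon> * (\<integral>y'. dyn_integral (\<delta> / \<epsilon>) \<kappa> (t / \<epsilon>) x (y', 0) * g y' \<partial>lborel)"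
proof -
  have [measurable]: "(\<lambda>y. indicator Omega y * \<phi> y) \<in> borel_measurable lborel"
    using meas by (simp add: set_borel_measurable_def)
  note psi[measurable]
  have "(LINT y:Omega|lborel. G \<epsilon> \<delta> \<kappa> x y t * \<phi> y) = (\<integral>y. G \<epsilon> \<delta> \<kappa> x y t * (indicator Omega y * \<phi> y) \<partial>lborel)"
    by (simp add: set_lebesgue_integral_def mult_ac)
  also have "\<dots> = (\<integral>y. G \<epsilon> \<delta> \<kappa> x y t * f y \<partial>lborel)"
    unfolding G_def H_eq_dyn_kernel[OF \<delta> \<epsilon>] using ae by (intro integral_cong_AE) (measurable, auto)
  also have "\<dots> = dyn_sol (\<delta> / \<epsilon>) \<kappa> (t / \<epsilon>) f x"
    unfolding dyn_sol_def G_def H_eq_dyn_kernel[OF \<delta> \<epsilon>] ..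
  finally have 1: "(LINT y:Omega|lborel. G \<epsilon> \<delta> \<kappa> x y t * \<phi> y) = dyn_sol (\<delta> / \<epsilon>) \<kappa> (t / \<epsilon>) f x" .
  \<comment> \<open>A boundary point is its own reflection, so \<open>G0\<close> drops out.\<close>
  have "(LINT y'|lborel. G \<epsilon> \<delta> \<kappa> x (y', 0) t * \<psi> y')
     = (\<integral>y'. dyn_integral (\<delta> / \<epsilon>) \<kappa> (t / \<epsilon>) x (y', 0) * \<psi> y' \<partial>lborel)"
    unfolding G_def H_eq_dyn_kernel[OF \<delta> \<epsilon>] by (simp add: G0_def refl_def)
  also have "\<dots> = (\<integral>y'. dyn_integral (\<delta> / \<epsilon>) \<kappa> (t / \<epsilon>) x (y', 0) * g y' \<partial>lborel)"
    using aeg by (intro integral_cong_AE) (measurable, auto)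
  finally show ?thesis by (simp add: usol_def 1)
qed

lemma usol_rate:
  assumes meas: "set_borel_measurable lborel Omega \<phi>" and ae: "AE y in lborel. indicator Omega y * \<phi> y = f y"
    and psi: "\<psi> \<in> borel_measurable lborel" and g: "g \<in> borel_measurable borel" "\<And>y. \<bar>g y\<bar> \<le> L" and aeg: "AE y in lborel. \<psi> y = g y"
    and \<epsilon>: "0 < \<epsilon>" and \<kappa>: "0 \<le> \<kappa>" and R: "0 < R"
  shows "\<exists>C \<delta>0. \<delta>0 > 0 \<and> (\<forall>\<delta>. 0 < \<delta> \<and> \<delta> < \<delta>0 \<longrightarrow>
      (\<forall>x t. 0 \<le> snd x \<and> 0 < t \<and> R < snd x + t \<longrightarrow> \<bar>usol \<epsilon> \<delta> \<kappa> \<phi> \<psi> x t - dyn_sol 0 \<kappa> (t / \<epsilon>) f x\<bar> \<le> C * \<delta>))"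
proof -
  define B where "B = 2 / R + 1 / sqrt (4 * pi * (R / 2 / \<epsilon>))"
  define C where "C = (M * ((16 * real CARD('n) + 88) * (B + B)) + L * (6 * B)) / \<epsilon>"
  have L: "0 \<le> L" using g(2)[of 0] by linarith
  \<comment> \<open>The two thresholds of \<open>time_lag_Q\<close>, solved for \<delta>.\<close>
  define \<delta>0 where "\<delta>0 = min (R * \<epsilon> / 12) (sqrt (R * \<epsilon> / 48))"
  have "\<bar>usol \<epsilon> \<delta> \<kappa> \<phi> \<psi> x t - dyn_sol 0 \<kappa> (t / \<epsilon>) f x\<bar> \<le> C * \<delta>"
    if \<delta>: "0 < \<delta>" "\<delta> < \<delta>0" and x: "0 \<le> snd x" and t: "0 < t" and Q: "R < snd x + t" for \<delta> x t
  proof -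
    have "\<delta> \<le> R * \<epsilon> / 12" using \<delta> by (simp add: \<delta>0_def)
    moreover have "48 * \<delta>\<^sup>2 \<le> R * \<epsilon>"
    proof -
      have "\<delta>\<^sup>2 \<le> (sqrt (R * \<epsilon> / 48))\<^sup>2" using \<delta> by (intro power_mono) (simp_all add: \<delta>0_def)
      then show ?thesis using R \<epsilon> by simp
    qed
    ultimately have tl: "time_lag (\<delta> / \<epsilon>) \<kappa> (t / \<epsilon>) x"
      by (intro time_lag_Q[OF \<epsilon> R x t Q \<delta>(1) _ _ \<kappa>])
    let ?d = "\<delta> / \<epsilon>" and ?b = "t / \<epsilon>"
    have G1: "Gamma (snd x) ?b \<le> B" unfolding B_def by (rule Gamma_bound_Q[OF \<epsilon> R x t Q]) simp
    have G2: "Gamma (snd x) (2 * ?b) \<le> B" unfolding B_def by (rule Gamma_bound_Q[OF \<epsilon> R x t Q]) (use t \<epsilon> divide_pos_pos[OF t \<epsilon>] in linarith)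
    have "\<bar>dyn_sol ?d \<kappa> ?b f x - dyn_sol 0 \<kappa> ?b f x\<bar>
        \<le> M * (?d * ((16 * real CARD('n) + 88) * (Gamma (snd x) ?b + Gamma (snd x) (2 * ?b))))"
      by (rule dyn_sol_lag_diff[OF tl])
    also have "\<dots> \<le> M * (?d * ((16 * real CARD('n) + 88) * (B + B)))"
      using \<delta> \<epsilon> M_nonneg G1 G2 by (intro mult_left_mono add_mono) simp_all
    finally have 1: "\<bar>dyn_sol ?d \<kappa> ?b f x - dyn_sol 0 \<kappa> ?b f x\<bar> \<le> M * (?d * ((16 * real CARD('n) + 88) * (B + B)))" .
    have "\<bar>\<integral>y'. dyn_integral ?d \<kappa> ?b x (y', 0) * g y' \<partial>lborel\<bar> \<le> L * (6 * Gamma (snd x) ?b)"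
    proof (rule abs_integral_kernel_le[where S = UNIV])
      show "(\<lambda>(y', \<tau>). dyn_kernel ?d \<kappa> ?b x (y', 0) \<tau>) \<in> borel_measurable (lborel \<Otimes>\<^sub>M lborel)" by measurable
    qed (use time_lag.dyn_kernel_boundary_total[OF tl] g L in auto)
    also have "\<dots> \<le> L * (6 * B)" using G1 L by (intro mult_left_mono) simp_all
    finally have "?d * \<bar>\<integral>y'. dyn_integral ?d \<kappa> ?b x (y', 0) * g y' \<partial>lborel\<bar> \<le> ?d * (L * (6 * B))"
      using \<delta> \<epsilon> by (intro mult_left_mono) simp_all
    then have 2: "\<bar>?d * (\<integral>y'. dyn_integral ?d \<kappa> ?b x (y', 0) * g y' \<partial>lborel)\<bar> \<le> ?d * (L * (6 * B))"
      using \<delta> \<epsilon> by (simp only: abs_mult) simp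
    have "C * \<delta> = M * (?d * ((16 * real CARD('n) + 88) * (B + B))) + ?d * (L * (6 * B))"
      by (simp add: C_def add_divide_distrib distrib_left distrib_right mult_ac)
    then show ?thesis
      unfolding usol_eq_dyn_sol[OF meas ae psi g(1) aeg \<delta>(1) \<epsilon>] using 1 2 by linarith
  qed
  moreover have "\<delta>0 > 0" using R \<epsilon> by (simp add: \<delta>0_def)
  ultimately show ?thesis by blast
qed

lemma diffusion_rate:
  assumes \<epsilon>: "0 < \<epsilon>" and R: "0 < R"
  shows "\<exists>C. \<forall>k\<ge>0. \<forall>x t. 0 \<le> snd x \<and> 0 < t \<and> R < snd x + t \<longrightarrow> \<bar>dyn_sol 0 k (t / \<epsilon>) f x - dyn_sol 0 0 (t / \<epsilon>) f x\<bar> \<le> C * k"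
proof -
  define B where "B = 2 / R + 1 / sqrt (4 * pi * (R / 2 / \<epsilon>))"
  have "\<bar>dyn_sol 0 k (t / \<epsilon>) f x - dyn_sol 0 0 (t / \<epsilon>) f x\<bar> \<le> (M * ((4 * real CARD('n) + 40) * (B + B))) * k"
    if k: "0 \<le> k" and x: "0 \<le> snd x" and t: "0 < t" and Q: "R < snd x + t" for k x t
  proof -
    have G1: "Gamma (snd x) (t / \<epsilon>) \<le> B" unfolding B_def by (rule Gamma_bound_Q[OF \<epsilon> R x t Q]) simp
    have G2: "Gamma (snd x) (2 * (t / \<epsilon>)) \<le> B" unfolding B_def by (rule Gamma_bound_Q[OF \<epsilon> R x t Q]) (use t \<epsilon> divide_pos_pos[OF t \<epsilon>] in linarith)
    have "\<bar>dyn_sol 0 k (t / \<epsilon>) f x - dyn_sol 0 0 (t / \<epsilon>) f x\<bar>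
        \<le> M * (k * ((4 * real CARD('n) + 40) * (Gamma (snd x) (t / \<epsilon>) + Gamma (snd x) (2 * (t / \<epsilon>)))))"
      using t \<epsilon> by (intro dyn_sol_diffusion_diff k x) simp
    also have "\<dots> \<le> M * (k * ((4 * real CARD('n) + 40) * (B + B)))"
      using k M_nonneg G1 G2 by (intro mult_left_mono add_mono) simp_all
    finally show ?thesis by (simp add: mult_ac)
  qed
  then show ?thesis by blast
qed

end

section \<open>Averages of Gaussian kernels\<close>

text \<open>Gaussian domination, locally uniform in time: just what is needed to dominate translates
  of \<open>K\<close> under an integral. The constants may depend on the time interval, so the class
  is closed under multiplication by linear factors in \<open>z\<close> and by continuous functions
  of time, hence contains all derivatives used below.\<close>

definition gauss_kernel :: "('a::euclidean_space \<Rightarrow> real \<Rightarrow> real) \<Rightarrow> bool" where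
  "gauss_kernel K \<longleftrightarrow> continuous_on (UNIV \<times> {0<..}) (\<lambda>(z, s). K z s) \<and>
     (\<forall>a>0. \<forall>b. \<exists>C c. 0 < c \<and> 0 \<le> C \<and> (\<forall>z. \<forall>s\<in>{a..b}. \<bar>K z s\<bar> \<le> C * exp (- (c * (norm z)\<^sup>2))))"

lemma gauss_kernelE:
  assumes "gauss_kernel K" "0 < a"
  obtains C c where "0 < c" "0 \<le> C" "\<And>z s. a \<le> s \<Longrightarrow> s \<le> b \<Longrightarrow> \<bar>K z s\<bar> \<le> C * exp (- (c * (norm z)\<^sup>2))"
proof -
  from assms have "\<exists>C c. 0 < c \<and> 0 \<le> C \<and> (\<forall>z. \<forall>s\<in>{a..b}. \<bar>K z s\<bar> \<le> C * exp (- (c * (norm z)\<^sup>2)))"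
    unfolding gauss_kernel_def by blast
  then obtain C c where "0 < c" "0 \<le> C" "\<forall>z. \<forall>s\<in>{a..b}. \<bar>K z s\<bar> \<le> C * exp (- (c * (norm z)\<^sup>2))" by blast
  then show ?thesis by (intro that[of c C]) simp_all
qed

lemma gauss_kernelI:
  assumes "continuous_on (UNIV \<times> {0<..}) (\<lambda>(z, s). K z s)"
    and "\<And>a b. 0 < a \<Longrightarrow> \<exists>C c. 0 < c \<and> 0 \<le> C \<and> (\<forall>z s. a \<le> s \<longrightarrow> s \<le> b \<longrightarrow> \<bar>K z s\<bar> \<le> C * exp (- (c * (norm z)\<^sup>2)))"
  shows "gauss_kernel K"
  unfolding gauss_kernel_def
proof (intro conjI allI impI assms(1))
  fix a b :: real assume "0 < a"
  from assms(2)[OF this, of b] obtain C c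
    where "0 < c" "0 \<le> C" "\<forall>z s. a \<le> s \<longrightarrow> s \<le> b \<longrightarrow> \<bar>K z s\<bar> \<le> C * exp (- (c * (norm z)\<^sup>2))" by blast
  then show "\<exists>C c. 0 < c \<and> 0 \<le> C \<and> (\<forall>z. \<forall>s\<in>{a..b}. \<bar>K z s\<bar> \<le> C * exp (- (c * (norm z)\<^sup>2)))"
    by (intro exI[of _ C] exI[of _ c]) simp
qed

lemma gauss_kernel_continuous: "gauss_kernel K \<Longrightarrow> continuous_on (UNIV \<times> {0<..}) (\<lambda>p. K (fst p) (snd p))"
  by (simp add: gauss_kernel_def case_prod_beta)

lemma gauss_kernel_Gamma: "gauss_kernel Gamma"
proof (rule gauss_kernelI)
  show "continuous_on (UNIV \<times> {0<..}) (\<lambda>(z :: 'a, s). Gamma z s)"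
    unfolding Gamma_def case_prod_beta by (intro continuous_intros) auto
  fix a b :: real assume a: "0 < a"
  show "\<exists>C c. 0 < c \<and> 0 \<le> C \<and> (\<forall>z s. a \<le> s \<longrightarrow> s \<le> b \<longrightarrow> \<bar>Gamma (z :: 'a) s\<bar> \<le> C * exp (- (c * (norm z)\<^sup>2)))"
  proof (intro exI conjI allI impI)
    show "0 < 1 / (4 * max a b)" using a by simp
    show "0 \<le> (4 * pi * a) powr (- real DIM('a) / 2)" by simp
    fix z :: 'a and s assume s: "a \<le> s" "s \<le> b"
    have "(4 * pi * s) powr (- real DIM('a) / 2) \<le> (4 * pi * a) powr (- real DIM('a) / 2)"
      using a s by (intro powr_mono2') simp_all
    moreover have "exp (- (norm z)\<^sup>2 / (4 * s)) \<le> exp (- (1 / (4 * max a b) * (norm z)\<^sup>2))"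
      using a s by (simp add: frac_le)
    ultimately have "Gamma z s \<le> (4 * pi * a) powr (- real DIM('a) / 2) * exp (- (1 / (4 * max a b) * (norm z)\<^sup>2))"
      unfolding Gamma_def by (intro mult_mono) simp_all
    then show "\<bar>Gamma z s\<bar> \<le> (4 * pi * a) powr (- real DIM('a) / 2) * exp (- (1 / (4 * max a b) * (norm z)\<^sup>2))"
      using Gamma_nonneg[of z s] by linarith
  qed
qed

lemma gauss_kernel_add:
  fixes K L :: "'a::euclidean_space \<Rightarrow> real \<Rightarrow> real"
  assumes K: "gauss_kernel K" and L: "gauss_kernel L"
  shows "gauss_kernel (\<lambda>z s. K z s + L z s)"
proof (rule gauss_kernelI)
  show "continuous_on (UNIV \<times> {0<..}) (\<lambda>(z, s). K z s + L z s)"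
    unfolding case_prod_beta by (intro continuous_intros gauss_kernel_continuous K L)
  fix a b :: real assume a: "0 < a"
  obtain C c where C: "0 < c" "0 \<le> C" "\<And>z s. a \<le> s \<Longrightarrow> s \<le> b \<Longrightarrow> \<bar>K z s\<bar> \<le> C * exp (- (c * (norm z)\<^sup>2))"
    using gauss_kernelE[OF K a] by metis
  obtain D d where D: "0 < d" "0 \<le> D" "\<And>z s. a \<le> s \<Longrightarrow> s \<le> b \<Longrightarrow> \<bar>L z s\<bar> \<le> D * exp (- (d * (norm z)\<^sup>2))"
    using gauss_kernelE[OF L a] by metis
  show "\<exists>C c. 0 < c \<and> 0 \<le> C \<and> (\<forall>z s. a \<le> s \<longrightarrow> s \<le> b \<longrightarrow> \<bar>K z s + L z s\<bar> \<le> C * exp (- (c * (norm z)\<^sup>2)))"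
  proof (intro exI conjI allI impI)
    show "0 < min c d" "0 \<le> C + D" using C D by simp_all
    fix z :: 'a and s assume s: "a \<le> s" "s \<le> b"
    have "C * exp (- (c * (norm z)\<^sup>2)) \<le> C * exp (- (min c d * (norm z)\<^sup>2))"
      "D * exp (- (d * (norm z)\<^sup>2)) \<le> D * exp (- (min c d * (norm z)\<^sup>2))"
      using C D by (auto intro!: mult_left_mono mult_right_mono)
    then show "\<bar>K z s + L z s\<bar> \<le> (C + D) * exp (- (min c d * (norm z)\<^sup>2))"
      using C(3)[OF s, of z] D(3)[OF s, of z] by (simp add: distrib_right)
  qed
qed

lemma gauss_kernel_mult_time:
  fixes K :: "'a::euclidean_space \<Rightarrow> real \<Rightarrow> real"
  assumes K: "gauss_kernel K" and q: "continuous_on {0<..} q"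
  shows "gauss_kernel (\<lambda>z s. q s * K z s)"
proof (rule gauss_kernelI)
  show "continuous_on (UNIV \<times> {0<..}) (\<lambda>(z, s). q s * K z s)"
    unfolding case_prod_beta
    by (intro continuous_on_mult gauss_kernel_continuous K continuous_on_compose2[OF q continuous_on_snd[OF continuous_on_id]]) auto
  fix a b :: real assume a: "0 < a"
  obtain C c where C: "0 < c" "0 \<le> C" "\<And>z s. a \<le> s \<Longrightarrow> s \<le> b \<Longrightarrow> \<bar>K z s\<bar> \<le> C * exp (- (c * (norm z)\<^sup>2))"
    using gauss_kernelE[OF K a] by metis
  have "compact (q ` {a..b})" using a by (intro compact_continuous_image continuous_on_subset[OF q]) auto
  then have "bounded (q ` {a..b})" by (rule compact_imp_bounded)
  then obtain B where "\<forall>y\<in>q ` {a..b}. norm y \<le> B" unfolding bounded_iff by blast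
  then have B: "\<bar>q s\<bar> \<le> B" if "a \<le> s" "s \<le> b" for s using that by simp
  show "\<exists>C c. 0 < c \<and> 0 \<le> C \<and> (\<forall>z s. a \<le> s \<longrightarrow> s \<le> b \<longrightarrow> \<bar>q s * K z s\<bar> \<le> C * exp (- (c * (norm z)\<^sup>2)))"
  proof (intro exI conjI allI impI)
    show "0 < c" "0 \<le> \<bar>B\<bar> * C" using C by simp_all
    fix z s assume s: "a \<le> s" "s \<le> b"
    have "\<bar>q s * K z s\<bar> \<le> \<bar>B\<bar> * (C * exp (- (c * (norm z)\<^sup>2)))"
      unfolding abs_mult using B[OF s] C(3)[OF s] by (intro mult_mono) auto
    then show "\<bar>q s * K z s\<bar> \<le> \<bar>B\<bar> * C * exp (- (c * (norm z)\<^sup>2))" by (simp add: mult.assoc)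
  qed
qed

lemma gauss_kernel_cmult: "gauss_kernel K \<Longrightarrow> gauss_kernel (\<lambda>z s. r * K z s)"
  by (rule gauss_kernel_mult_time[OF _ continuous_on_const])

lemma gauss_kernel_mult_inner:
  fixes K :: "'a::euclidean_space \<Rightarrow> real \<Rightarrow> real"
  assumes K: "gauss_kernel K"
  shows "gauss_kernel (\<lambda>z s. (z \<bullet> v) * K z s)"
proof (rule gauss_kernelI)
  show "continuous_on (UNIV \<times> {0<..}) (\<lambda>(z, s). (z \<bullet> v) * K z s)"
    unfolding case_prod_beta by (intro continuous_intros gauss_kernel_continuous K)
  fix a b :: real assume a: "0 < a"
  obtain C c where C: "0 < c" "0 \<le> C" "\<And>z s. a \<le> s \<Longrightarrow> s \<le> b \<Longrightarrow> \<bar>K z s\<bar> \<le> C * exp (- (c * (norm z)\<^sup>2))"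
    using gauss_kernelE[OF K a] by metis
  \<comment> \<open>Chosen so that m >= 1 and m c / 2 >= 1; then 1 + r^2 <= m (1 + c r^2 / 2) <= m
    exp (c r^2 / 2), and the linear factor costs half of the rate \<open>c\<close>.\<close>
  define m where "m = 1 + 2 / c"
  have m: "1 \<le> m" "2 \<le> m * c" using C by (simp_all add: m_def distrib_right)
  show "\<exists>C c. 0 < c \<and> 0 \<le> C \<and> (\<forall>z s. a \<le> s \<longrightarrow> s \<le> b \<longrightarrow> \<bar>(z \<bullet> v) * K z s\<bar> \<le> C * exp (- (c * (norm z)\<^sup>2)))"
  proof (intro exI conjI allI impI)
    show "0 < c / 2" "0 \<le> norm v * m * C" using C m by simp_all
    fix z :: 'a and s assume s: "a \<le> s" "s \<le> b"
    let ?r = "norm z"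
    have "2 * ?r \<le> 1 + ?r\<^sup>2" using sum_squares_bound[of 1 ?r] by simp
    then have "?r \<le> 1 + ?r\<^sup>2" using norm_ge_zero[of z] by linarith
    also have "\<dots> \<le> m * (1 + c / 2 * ?r\<^sup>2)"
      using m mult_right_mono[OF m(2), of "?r\<^sup>2"] by (simp add: distrib_left)
    also have "\<dots> \<le> m * exp (c / 2 * ?r\<^sup>2)" using m by (intro mult_left_mono exp_ge_add_one_self) simp
    finally have r: "?r \<le> m * exp (c / 2 * ?r\<^sup>2)" .
    have e: "exp (c / 2 * ?r\<^sup>2) * exp (- (c * ?r\<^sup>2)) = exp (- (c / 2 * ?r\<^sup>2))"
      unfolding exp_add[symmetric] by simp
    have "\<bar>(z \<bullet> v) * K z s\<bar> \<le> (?r * norm v) * (C * exp (- (c * ?r\<^sup>2)))"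
      unfolding abs_mult using C(3)[OF s] Cauchy_Schwarz_ineq2 by (intro mult_mono) auto
    also have "\<dots> \<le> (m * exp (c / 2 * ?r\<^sup>2) * norm v) * (C * exp (- (c * ?r\<^sup>2)))"
      using C r by (intro mult_right_mono) auto
    also have "\<dots> = norm v * m * C * (exp (c / 2 * ?r\<^sup>2) * exp (- (c * ?r\<^sup>2)))" by (simp only: mult_ac)
    finally show "\<bar>(z \<bullet> v) * K z s\<bar> \<le> norm v * m * C * exp (- (c / 2 * ?r\<^sup>2))" unfolding e .
  qed
qed

lemma gauss_kernel_0: "gauss_kernel (\<lambda>z s. 0)"
  using gauss_kernel_cmult[OF gauss_kernel_Gamma, of 0] by simp

lemma gauss_kernel_sum: "(\<And>i. i \<in> I \<Longrightarrow> gauss_kernel (K i)) \<Longrightarrow> gauss_kernel (\<lambda>z s. \<Sum>i\<in>I. K i z s)"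
  by (induction I rule: infinite_finite_induct) (simp_all add: gauss_kernel_0 gauss_kernel_add)

text \<open>The mean value inequality turns the bound on \<open>F'\<close> into a bound by
  \<open>g\<close> on all difference quotients, after which dominated convergence applies along
  sequences.\<close>

lemma has_real_derivative_integral:
  fixes F F' :: "real \<Rightarrow> 'w \<Rightarrow> real"
  assumes r: "0 < r" and int: "\<And>h. \<bar>h\<bar> < r \<Longrightarrow> integrable \<mu> (F h)"
    and D: "\<And>h \<omega>. \<bar>h\<bar> < r \<Longrightarrow> ((\<lambda>h. F h \<omega>) has_real_derivative F' h \<omega>) (at h)"
    and bd: "\<And>h \<omega>. \<bar>h\<bar> < r \<Longrightarrow> \<bar>F' h \<omega>\<bar> \<le> g \<omega>" and g: "integrable \<mu> g"
    and meas: "F' 0 \<in> borel_measurable \<mu>"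
  shows "((\<lambda>h. \<integral>\<omega>. F h \<omega> \<partial>\<mu>) has_real_derivative (\<integral>\<omega>. F' 0 \<omega> \<partial>\<mu>)) (at 0)"
proof -
  let ?S = "{- r<..<r}"
  have "((\<lambda>h. ((\<integral>\<omega>. F h \<omega> \<partial>\<mu>) - (\<integral>\<omega>. F 0 \<omega> \<partial>\<mu>)) / (h - 0)) \<longlongrightarrow> (\<integral>\<omega>. F' 0 \<omega> \<partial>\<mu>)) (at 0 within ?S)"
    unfolding tendsto_at_iff_sequentially
  proof (intro allI impI)
    fix X :: "nat \<Rightarrow> real" assume X: "\<forall>i. X i \<in> ?S - {0}" and lim: "X \<longlonglongrightarrow> 0"
    have Xi: "\<bar>X i\<bar> < r" "X i \<noteq> 0" for i using X[rule_format, of i] by auto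
    have eq: "((\<lambda>h. ((\<integral>\<omega>. F h \<omega> \<partial>\<mu>) - (\<integral>\<omega>. F 0 \<omega> \<partial>\<mu>)) / (h - 0)) \<circ> X)
       = (\<lambda>i. \<integral>\<omega>. (F (X i) \<omega> - F 0 \<omega>) / X i \<partial>\<mu>)"
      using int[OF Xi(1)] int[of 0] r by (auto simp: fun_eq_iff)
    show "((\<lambda>h. ((\<integral>\<omega>. F h \<omega> \<partial>\<mu>) - (\<integral>\<omega>. F 0 \<omega> \<partial>\<mu>)) / (h - 0)) \<circ> X) \<longlonglongrightarrow> (\<integral>\<omega>. F' 0 \<omega> \<partial>\<mu>)"
      unfolding eq
    proof (rule integral_dominated_convergence[where w = g])
      show "(\<lambda>\<omega>. (F (X i) \<omega> - F 0 \<omega>) / X i) \<in> borel_measurable \<mu>" for i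
        using int[OF Xi(1), of i] int[of 0] r by (intro borel_measurable_divide borel_measurable_diff) auto
      show "AE \<omega> in \<mu>. (\<lambda>i. (F (X i) \<omega> - F 0 \<omega>) / X i) \<longlonglongrightarrow> F' 0 \<omega>"
      proof (rule AE_I2)
        fix \<omega>
        have "((\<lambda>h. (F h \<omega> - F 0 \<omega>) / (h - 0)) \<longlongrightarrow> F' 0 \<omega>) (at 0)"
          using D[of 0 \<omega>] r by (simp add: has_field_derivative_iff)
        then show "(\<lambda>i. (F (X i) \<omega> - F 0 \<omega>) / X i) \<longlonglongrightarrow> F' 0 \<omega>"
          using Xi lim unfolding tendsto_at_iff_sequentially by (auto simp: o_def)
      qed
      show "AE \<omega> in \<mu>. norm ((F (X i) \<omega> - F 0 \<omega>) / X i) \<le> g \<omega>" for i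
      proof (rule AE_I2)
        fix \<omega>
        have "norm (F (X i) \<omega> - F 0 \<omega>) \<le> g \<omega> * norm (X i - 0)"
        proof (rule field_differentiable_bound[where S = ?S and f = "\<lambda>h. F h \<omega>" and f' = "\<lambda>h. F' h \<omega>"
              and B = "g \<omega>" and x = "X i" and y = 0])
          show "((\<lambda>h. F h \<omega>) has_real_derivative F' h \<omega>) (at h within ?S)" if "h \<in> ?S" for h
            by (rule has_field_derivative_at_within[OF D]) (use that in \<open>simp add: abs_less_iff\<close>)
          show "norm (F' h \<omega>) \<le> g \<omega>" if "h \<in> ?S" for h
            using that bd[of h \<omega>] by (simp add: abs_less_iff)
          show "X i \<in> ?S" using X by blast
          show "0 \<in> ?S" using r by simp
          show "convex ?S" by (rule convex_real_interval)
        qed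
        then show "norm ((F (X i) \<omega> - F 0 \<omega>) / X i) \<le> g \<omega>" using Xi(2)[of i] by (simp add: divide_le_eq)
      qed
    qed (use meas g in auto)
  qed
  moreover have "at 0 within ?S = at (0::real)" using r by (intro at_within_open) auto
  ultimately show ?thesis by (simp add: has_field_derivative_iff)
qed

text \<open>The weight need not be integrable: \<open>moment\<close> asks for integrability against
  every Gaussian in \<open>Y\<close> only. Merely bounded data and the boundary weight are both
  covered.\<close>

locale gauss_average =
  fixes \<mu> :: "'w measure" and Y :: "'w \<Rightarrow> 'a::euclidean_space" and w :: "'w \<Rightarrow> real"
  assumes Y [measurable]: "Y \<in> borel_measurable \<mu>" and w [measurable]: "w \<in> borel_measurable \<mu>"
    and moment: "\<And>c. 0 < c \<Longrightarrow> integrable \<mu> (\<lambda>\<omega>. exp (- (c * (norm (Y \<omega>))\<^sup>2)) * w \<omega>)"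
begin

definition avg :: "('a \<Rightarrow> real \<Rightarrow> real) \<Rightarrow> 'a \<Rightarrow> real \<Rightarrow> real" where
  "avg K x s = (\<integral>\<omega>. K (x - Y \<omega>) s * w \<omega> \<partial>\<mu>)"

lemma kernel_measurable:
  assumes K: "gauss_kernel K" and s: "0 < s"
  shows "(\<lambda>\<omega>. K (x - Y \<omega>) s * w \<omega>) \<in> borel_measurable \<mu>"
proof -
  have "continuous_on UNIV (\<lambda>z. K z s)"
    using continuous_on_compose2[OF gauss_kernel_continuous[OF K] continuous_on_Pair[OF continuous_on_id continuous_on_const[of UNIV s]]] s
    by auto
  then have "(\<lambda>z. K z s) \<in> borel_measurable borel" by (rule borel_measurable_continuous_onI)
  then have "(\<lambda>\<omega>. K (x - Y \<omega>) s) \<in> borel_measurable \<mu>"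
    by (rule measurable_compose[rotated]) measurable
  then show ?thesis by measurable
qed

lemma dominated:
  assumes K: "gauss_kernel K" and a: "0 < a"
  obtains g where "integrable \<mu> g" "\<And>x s \<omega>. norm x \<le> B \<Longrightarrow> a \<le> s \<Longrightarrow> s \<le> b \<Longrightarrow> \<bar>K (x - Y \<omega>) s * w \<omega>\<bar> \<le> g \<omega>"
proof -
  obtain C c where C: "0 < c" "0 \<le> C" "\<And>z s. a \<le> s \<Longrightarrow> s \<le> b \<Longrightarrow> \<bar>K z s\<bar> \<le> C * exp (- (c * (norm z)\<^sup>2))"
    using gauss_kernelE[OF K a] by metis
  \<comment> \<open>From |Y|^2 <= 2 |x - Y|^2 + 2 |x|^2: for |x| <= B, a Gaussian of rate c in x - Y
    is at most exp (c B^2) times a Gaussian of rate c/2 in Y.\<close>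
  define g where "g = (\<lambda>\<omega>. C * exp (c * B\<^sup>2) * \<bar>exp (- (c / 2 * (norm (Y \<omega>))\<^sup>2)) * w \<omega>\<bar>)"
  have "integrable \<mu> g"
    unfolding g_def using moment[of "c / 2"] C by (intro integrable_mult_right integrable_abs) simp
  moreover have "\<bar>K (x - Y \<omega>) s * w \<omega>\<bar> \<le> g \<omega>" if x: "norm x \<le> B" and s: "a \<le> s" "s \<le> b" for x s \<omega>
  proof -
    have "norm (Y \<omega>) \<le> norm (x - Y \<omega>) + norm x" by (metis norm_minus_commute norm_triangle_sub add.commute)
    then have "(norm (Y \<omega>))\<^sup>2 \<le> (norm (x - Y \<omega>) + norm x)\<^sup>2" by (intro power_mono) simp_all
    also have "\<dots> \<le> 2 * (norm (x - Y \<omega>))\<^sup>2 + 2 * (norm x)\<^sup>2"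
      using sum_squares_bound[of "norm (x - Y \<omega>)" "norm x"] by (simp add: power2_sum)
    also have "(norm x)\<^sup>2 \<le> B\<^sup>2" using x by (intro power_mono) simp_all
    finally have "(norm (Y \<omega>))\<^sup>2 / 2 - B\<^sup>2 \<le> (norm (x - Y \<omega>))\<^sup>2" by simp
    then have "c * ((norm (Y \<omega>))\<^sup>2 / 2 - B\<^sup>2) \<le> c * (norm (x - Y \<omega>))\<^sup>2" using C by (intro mult_left_mono) simp_all
    then have "exp (- (c * (norm (x - Y \<omega>))\<^sup>2)) \<le> exp (c * B\<^sup>2) * exp (- (c / 2 * (norm (Y \<omega>))\<^sup>2))"
      unfolding exp_add[symmetric] by (simp add: algebra_simps)
    then have "C * exp (- (c * (norm (x - Y \<omega>))\<^sup>2)) \<le> C * (exp (c * B\<^sup>2) * exp (- (c / 2 * (norm (Y \<omega>))\<^sup>2)))"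
      using C by (intro mult_left_mono)
    then have "\<bar>K (x - Y \<omega>) s\<bar> \<le> C * (exp (c * B\<^sup>2) * exp (- (c / 2 * (norm (Y \<omega>))\<^sup>2)))"
      using C(3)[OF s] by (meson order_trans)
    then have "\<bar>K (x - Y \<omega>) s\<bar> * \<bar>w \<omega>\<bar> \<le> C * (exp (c * B\<^sup>2) * exp (- (c / 2 * (norm (Y \<omega>))\<^sup>2))) * \<bar>w \<omega>\<bar>"
      by (intro mult_right_mono) simp_all
    then show ?thesis by (simp add: g_def abs_mult mult.assoc)
  qed
  ultimately show ?thesis by (rule that)
qed

lemma integrable_avg:
  assumes K: "gauss_kernel K" and s: "0 < s"
  shows "integrable \<mu> (\<lambda>\<omega>. K (x - Y \<omega>) s * w \<omega>)"
proof -
  obtain g where g: "integrable \<mu> g" "\<And>x' s' \<omega>. norm x' \<le> norm x \<Longrightarrow> s \<le> s' \<Longrightarrow> s' \<le> s \<Longrightarrow> \<bar>K (x' - Y \<omega>) s' * w \<omega>\<bar> \<le> g \<omega>"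
    using dominated[OF K s, of "norm x" s] by metis
  show ?thesis
  proof (rule Bochner_Integration.integrable_bound[OF g(1) kernel_measurable[OF K s]])
    show "AE \<omega> in \<mu>. norm (K (x - Y \<omega>) s * w \<omega>) \<le> norm (g \<omega>)"
    proof (rule AE_I2)
      fix \<omega>
      have "\<bar>K (x - Y \<omega>) s * w \<omega>\<bar> \<le> g \<omega>" by (rule g(2)) simp_all
      then show "norm (K (x - Y \<omega>) s * w \<omega>) \<le> norm (g \<omega>)" by simp
    qed
  qed
qed

lemma continuous_on_avg:
  assumes K: "gauss_kernel K"
  shows "continuous_on (UNIV \<times> {0<..}) (\<lambda>(x, s). avg K x s)"
  unfolding continuous_on_sequentially
proof (intro allI ballI impI, elim conjE)
  fix X :: "nat \<Rightarrow> 'a \<times> real" and p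
  assume p: "p \<in> UNIV \<times> {0<..}" and X: "\<forall>n. X n \<in> UNIV \<times> {0<..}" and lim: "X \<longlonglongrightarrow> p"
  have lim1: "(\<lambda>n. fst (X n)) \<longlonglongrightarrow> fst p" and lim2: "(\<lambda>n. snd (X n)) \<longlonglongrightarrow> snd p"
    using lim by (auto intro: tendsto_intros)
  have "bounded (range (\<lambda>n. fst (X n)))" using lim1 by (rule convergent_imp_bounded)
  then obtain B where B: "\<And>n. norm (fst (X n)) \<le> B" unfolding bounded_iff by auto
  \<comment> \<open>A convergent sequence of positive times together with its positive limit is
    compact, hence contained in some [a, b] with a > 0, where one dominating function works for all
    terms.\<close>
  let ?T = "insert (snd p) (range (\<lambda>n. snd (X n)))"
  have T: "compact ?T" using lim2 by (rule compact_sequence_with_limit)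
  obtain a where a: "a \<in> ?T" "\<And>s. s \<in> ?T \<Longrightarrow> a \<le> s" using compact_attains_inf[OF T] by blast
  obtain b where b: "\<And>s. s \<in> ?T \<Longrightarrow> s \<le> b" using compact_attains_sup[OF T] by blast
  have a0: "0 < a" using a(1) p X by (auto simp: mem_Times_iff)
  obtain g where g: "integrable \<mu> g" "\<And>x s \<omega>. norm x \<le> B \<Longrightarrow> a \<le> s \<Longrightarrow> s \<le> b \<Longrightarrow> \<bar>K (x - Y \<omega>) s * w \<omega>\<bar> \<le> g \<omega>"
    using dominated[OF K a0, of B b] by metis
  have "(\<lambda>n. \<integral>\<omega>. K (fst (X n) - Y \<omega>) (snd (X n)) * w \<omega> \<partial>\<mu>) \<longlonglongrightarrow> (\<integral>\<omega>. K (fst p - Y \<omega>) (snd p) * w \<omega> \<partial>\<mu>)"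
  proof (rule integral_dominated_convergence[where w = g])
    show "AE \<omega> in \<mu>. (\<lambda>n. K (fst (X n) - Y \<omega>) (snd (X n)) * w \<omega>) \<longlonglongrightarrow> K (fst p - Y \<omega>) (snd p) * w \<omega>"
    proof (rule AE_I2)
      fix \<omega>
      have "(\<lambda>n. (fst (X n) - Y \<omega>, snd (X n))) \<longlonglongrightarrow> (fst p - Y \<omega>, snd p)"
        by (intro tendsto_intros lim1 lim2)
      then have "(\<lambda>n. K (fst (X n) - Y \<omega>) (snd (X n))) \<longlonglongrightarrow> K (fst p - Y \<omega>) (snd p)"
        using continuous_on_tendsto_compose[OF gauss_kernel_continuous[OF K],
            of "\<lambda>n. (fst (X n) - Y \<omega>, snd (X n))" "(fst p - Y \<omega>, snd p)" sequentially] p X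
        by (simp add: mem_Times_iff)
      then show "(\<lambda>n. K (fst (X n) - Y \<omega>) (snd (X n)) * w \<omega>) \<longlonglongrightarrow> K (fst p - Y \<omega>) (snd p) * w \<omega>"
        by (intro tendsto_intros)
    qed
    show "AE \<omega> in \<mu>. norm (K (fst (X n) - Y \<omega>) (snd (X n)) * w \<omega>) \<le> g \<omega>" for n
      using g(2)[OF B a(2) b, of "snd (X n)" n] by simp
  qed (use g p X in \<open>auto intro!: kernel_measurable[OF K] simp: mem_Times_iff\<close>)
  then show "((\<lambda>(x, s). avg K x s) \<circ> X) \<longlonglongrightarrow> (\<lambda>(x, s). avg K x s) p"
    by (simp add: o_def case_prod_beta avg_def)
qed

lemma avg_directional_derivative:
  assumes K: "gauss_kernel K" and K': "gauss_kernel K'"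
    and D: "\<And>z. ((\<lambda>h. K (z + h *\<^sub>R v) s) has_real_derivative K' z s) (at 0)" and s: "0 < s"
  shows "((\<lambda>h. avg K (x + h *\<^sub>R v) s) has_real_derivative avg K' x s) (at 0)"
proof -
  obtain g where g: "integrable \<mu> g" "\<And>x' s' \<omega>. norm x' \<le> norm x + norm v \<Longrightarrow> s \<le> s' \<Longrightarrow> s' \<le> s \<Longrightarrow> \<bar>K' (x' - Y \<omega>) s' * w \<omega>\<bar> \<le> g \<omega>"
    using dominated[OF K' s, of "norm x + norm v" s] by metis
  have "((\<lambda>h. \<integral>\<omega>. K ((x + h *\<^sub>R v) - Y \<omega>) s * w \<omega> \<partial>\<mu>) has_real_derivative (\<integral>\<omega>. K' ((x + 0 *\<^sub>R v) - Y \<omega>) s * w \<omega> \<partial>\<mu>)) (at 0)"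
  proof (rule has_real_derivative_integral[where r = 1 and g = g])
    fix h \<omega>
    \<comment> \<open>The hypothesis \<open>D\<close> concerns h = 0 but every base point; moving
      the base point along the line gives the derivative at every \<open>h\<close>.\<close>
    have "((\<lambda>h'. K ((x + (h' + h) *\<^sub>R v) - Y \<omega>) s) has_real_derivative K' ((x + h *\<^sub>R v) - Y \<omega>) s) (at 0)"
      using D[of "x + h *\<^sub>R v - Y \<omega>"] by (simp add: algebra_simps)
    then have "((\<lambda>h. K ((x + h *\<^sub>R v) - Y \<omega>) s) has_real_derivative K' ((x + h *\<^sub>R v) - Y \<omega>) s) (at (0 + h))"
      unfolding DERIV_shift .
    then show "((\<lambda>h. K ((x + h *\<^sub>R v) - Y \<omega>) s * w \<omega>) has_real_derivative K' ((x + h *\<^sub>R v) - Y \<omega>) s * w \<omega>) (at h)"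
      by (intro DERIV_cmult_right) simp
  next
    fix h :: real and \<omega> assume h: "\<bar>h\<bar> < 1"
    have "norm (x + h *\<^sub>R v) \<le> norm x + \<bar>h\<bar> * norm v" using norm_triangle_ineq[of x "h *\<^sub>R v"] by simp
    also have "\<dots> \<le> norm x + norm v" using h by (simp add: mult_left_le_one_le)
    finally show "\<bar>K' ((x + h *\<^sub>R v) - Y \<omega>) s * w \<omega>\<bar> \<le> g \<omega>" by (intro g(2)) simp_all
  qed (use g integrable_avg[OF K s] kernel_measurable[OF K' s] in auto)
  then show ?thesis by (simp add: avg_def)
qed

lemma avg_time_derivative:
  assumes K: "gauss_kernel K" and K': "gauss_kernel K'"
    and D: "\<And>z s. 0 < s \<Longrightarrow> ((\<lambda>s. K z s) has_real_derivative K' z s) (at s)" and s: "0 < s"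
  shows "((\<lambda>s. avg K x s) has_real_derivative avg K' x s) (at s)"
proof -
  \<comment> \<open>The radius s/2 keeps the times h + s inside [s/2, 2 s], away from 0.\<close>
  have s2: "0 < s / 2" using s by simp
  obtain g where g: "integrable \<mu> g" "\<And>x' s' \<omega>. norm x' \<le> norm x \<Longrightarrow> s / 2 \<le> s' \<Longrightarrow> s' \<le> 2 * s \<Longrightarrow> \<bar>K' (x' - Y \<omega>) s' * w \<omega>\<bar> \<le> g \<omega>"
    using dominated[OF K' s2, of "norm x" "2 * s"] by metis
  have "((\<lambda>h. \<integral>\<omega>. K (x - Y \<omega>) (h + s) * w \<omega> \<partial>\<mu>) has_real_derivative (\<integral>\<omega>. K' (x - Y \<omega>) (0 + s) * w \<omega> \<partial>\<mu>)) (at 0)"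
  proof (rule has_real_derivative_integral[where r = "s / 2" and g = g])
    fix h :: real and \<omega> assume h: "\<bar>h\<bar> < s / 2"
    have "((\<lambda>h. K (x - Y \<omega>) (h + s)) has_real_derivative K' (x - Y \<omega>) (h + s)) (at h)"
      using D[of "h + s" "x - Y \<omega>"] h by (simp add: DERIV_shift[symmetric] abs_less_iff)
    then show "((\<lambda>h. K (x - Y \<omega>) (h + s) * w \<omega>) has_real_derivative K' (x - Y \<omega>) (h + s) * w \<omega>) (at h)"
      by (rule DERIV_cmult_right)
    show "\<bar>K' (x - Y \<omega>) (h + s) * w \<omega>\<bar> \<le> g \<omega>" using h by (intro g(2)) (auto simp: abs_less_iff)
    show "integrable \<mu> (\<lambda>\<omega>. K (x - Y \<omega>) (h + s) * w \<omega>)" using h by (intro integrable_avg[OF K]) (auto simp: abs_less_iff)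
  qed (use g s kernel_measurable[OF K' s] in auto)
  then show ?thesis using DERIV_shift[of "\<lambda>s. avg K x s" _ 0 s] by (simp add: avg_def)
qed

end

section \<open>Derivatives of the Gaussian and the heat equation for them\<close>

definition Gamma_D1 :: "'a::euclidean_space \<Rightarrow> 'a \<Rightarrow> real \<Rightarrow> real" where
  "Gamma_D1 v z s = - ((z \<bullet> v) / (2 * s)) * Gamma z s"

definition Gamma_D2 :: "'a::euclidean_space \<Rightarrow> 'a \<Rightarrow> 'a \<Rightarrow> real \<Rightarrow> real" where
  "Gamma_D2 v u z s = ((z \<bullet> v) * (z \<bullet> u) / (4 * s\<^sup>2) - (v \<bullet> u) / (2 * s)) * Gamma z s"

text \<open>Third order occurs because the boundary part of the solution already contains one normal
  derivative of the Gaussian. The closed formulas, rather than iterated derivatives, make membership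
  in \<open>gauss_kernel\<close> immediate.\<close>

definition Gamma_D3 :: "'a::euclidean_space \<Rightarrow> 'a \<Rightarrow> 'a \<Rightarrow> 'a \<Rightarrow> real \<Rightarrow> real" where
  "Gamma_D3 v u w z s = (((v \<bullet> u) * (z \<bullet> w) + (v \<bullet> w) * (z \<bullet> u) + (u \<bullet> w) * (z \<bullet> v)) / (4 * s\<^sup>2)
     - (z \<bullet> v) * (z \<bullet> u) * (z \<bullet> w) / (8 * s ^ 3)) * Gamma z s"

lemma gauss_kernel_Gamma_D1: "gauss_kernel (Gamma_D1 v)"
proof -
  have "gauss_kernel (\<lambda>z s. (- 1 / (2 * s)) * ((z \<bullet> v) * Gamma z s))"
    by (intro gauss_kernel_mult_time gauss_kernel_mult_inner gauss_kernel_Gamma continuous_intros) auto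
  moreover have "(\<lambda>z s. (- 1 / (2 * s)) * ((z \<bullet> v) * Gamma z s)) = Gamma_D1 v"
    by (simp add: fun_eq_iff Gamma_D1_def)
  ultimately show ?thesis by simp
qed

lemma gauss_kernel_Gamma_D2: "gauss_kernel (Gamma_D2 v u)"
proof -
  have "gauss_kernel (\<lambda>z s. (1 / (4 * s\<^sup>2)) * ((z \<bullet> v) * ((z \<bullet> u) * Gamma z s)) + (- (v \<bullet> u) / (2 * s)) * Gamma z s)"
    by (intro gauss_kernel_add gauss_kernel_mult_time gauss_kernel_mult_inner gauss_kernel_Gamma continuous_intros) auto
  moreover have "(\<lambda>z s. (1 / (4 * s\<^sup>2)) * ((z \<bullet> v) * ((z \<bullet> u) * Gamma z s)) + (- (v \<bullet> u) / (2 * s)) * Gamma z s) = Gamma_D2 v u"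
    by (simp add: fun_eq_iff Gamma_D2_def left_diff_distrib)
  ultimately show ?thesis by simp
qed

lemma gauss_kernel_Gamma_D3: "gauss_kernel (Gamma_D3 v u w)"
proof -
  let ?K = "\<lambda>z s. ((v \<bullet> u) / (4 * s\<^sup>2)) * ((z \<bullet> w) * Gamma z s) + ((v \<bullet> w) / (4 * s\<^sup>2)) * ((z \<bullet> u) * Gamma z s)
    + ((u \<bullet> w) / (4 * s\<^sup>2)) * ((z \<bullet> v) * Gamma z s) + (- 1 / (8 * s ^ 3)) * ((z \<bullet> v) * ((z \<bullet> u) * ((z \<bullet> w) * Gamma z s)))"
  have "gauss_kernel ?K"
    by (intro gauss_kernel_add gauss_kernel_mult_time gauss_kernel_mult_inner gauss_kernel_Gamma continuous_intros) auto
  moreover have "?K = Gamma_D3 v u w"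
    unfolding fun_eq_iff Gamma_D3_def by (simp add: add_divide_distrib algebra_simps)
  ultimately show ?thesis by simp
qed

lemma DERIV_Gamma:
  fixes z :: "'a::euclidean_space"
  assumes s: "0 < s"
  shows "((\<lambda>h. Gamma (z + h *\<^sub>R v) s) has_real_derivative Gamma_D1 v z s) (at 0)"
proof -
  have n: "(norm (z + h *\<^sub>R v))\<^sup>2 = z \<bullet> z + 2 * h * (z \<bullet> v) + h\<^sup>2 * (v \<bullet> v)" for h
    by (simp only: power2_norm_eq_inner) (simp add: inner_simps inner_commute power2_eq_square algebra_simps)
  have "((\<lambda>h. C * exp (- (z \<bullet> z + 2 * h * (z \<bullet> v) + h\<^sup>2 * (v \<bullet> v)) / (4 * s)))
     has_real_derivative C * (exp (- (z \<bullet> z) / (4 * s)) * (- (2 * (z \<bullet> v)) / (4 * s)))) (at 0)" for C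
    using s by (auto intro!: derivative_eq_intros)
  then have "((\<lambda>h. C * exp (- (z \<bullet> z + 2 * h * (z \<bullet> v) + h\<^sup>2 * (v \<bullet> v)) / (4 * s)))
     has_real_derivative - ((z \<bullet> v) / (2 * s)) * (C * exp (- (norm z)\<^sup>2 / (4 * s)))) (at 0)" for C
    by (simp add: power2_norm_eq_inner mult_ac)
  then show ?thesis unfolding Gamma_D1_def Gamma_def n .
qed

lemma DERIV_inner_line: "((\<lambda>h. (z + h *\<^sub>R u) \<bullet> v) has_real_derivative u \<bullet> v) (at 0)"
  unfolding inner_add_left inner_scaleR_left by (auto intro!: derivative_eq_intros)

lemma DERIV_Gamma_D1:
  fixes z :: "'a::euclidean_space"
  assumes s: "0 < s"
  shows "((\<lambda>h. Gamma_D1 v (z + h *\<^sub>R u) s) has_real_derivative Gamma_D2 v u z s) (at 0)"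
proof -
  have 1: "((\<lambda>h. - ((z + h *\<^sub>R u) \<bullet> v / (2 * s))) has_real_derivative - ((u \<bullet> v) / (2 * s))) (at 0)"
    by (intro DERIV_minus DERIV_cdivide DERIV_inner_line)
  have "- ((u \<bullet> v) / (2 * s)) * g + - ((z \<bullet> u) / (2 * s)) * g * - ((z \<bullet> v) / (2 * s))
     = ((z \<bullet> v) * (z \<bullet> u) / (4 * s\<^sup>2) - (v \<bullet> u) / (2 * s)) * g" for g
    using s by (simp add: inner_commute[of u v] field_simps power2_eq_square)
  then show ?thesis
    using DERIV_mult[OF 1 DERIV_Gamma[OF s, of z u]] unfolding Gamma_D1_def Gamma_D2_def by simp
qed

lemma DERIV_Gamma_D2:
  fixes z :: "'a::euclidean_space"
  assumes s: "0 < s"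
  shows "((\<lambda>h. Gamma_D2 v u (z + h *\<^sub>R w) s) has_real_derivative Gamma_D3 v u w z s) (at 0)"
proof -
  have 1: "((\<lambda>h. ((z + h *\<^sub>R w) \<bullet> v) * ((z + h *\<^sub>R w) \<bullet> u) / (4 * s\<^sup>2) - (v \<bullet> u) / (2 * s)) has_real_derivative
      ((w \<bullet> v) * (z \<bullet> u) + (w \<bullet> u) * (z \<bullet> v)) / (4 * s\<^sup>2) - 0) (at 0)"
    using DERIV_mult[OF DERIV_inner_line[of z w v] DERIV_inner_line[of z w u]]
    by (intro DERIV_diff DERIV_cdivide DERIV_const) simp
  have "(((w \<bullet> v) * (z \<bullet> u) + (w \<bullet> u) * (z \<bullet> v)) / (4 * s\<^sup>2) - 0) * g + - ((z \<bullet> w) / (2 * s)) * g * ((z \<bullet> v) * (z \<bullet> u) / (4 * s\<^sup>2) - (v \<bullet> u) / (2 * s))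
     = (((v \<bullet> u) * (z \<bullet> w) + (v \<bullet> w) * (z \<bullet> u) + (u \<bullet> w) * (z \<bullet> v)) / (4 * s\<^sup>2) - (z \<bullet> v) * (z \<bullet> u) * (z \<bullet> w) / (8 * s ^ 3)) * g" for g
    using s by (simp add: inner_commute[of w v] inner_commute[of w u] field_simps power2_eq_square power3_eq_cube)
  then show ?thesis
    using DERIV_mult[OF 1 DERIV_Gamma[OF s, of z w]] unfolding Gamma_D1_def Gamma_D2_def Gamma_D3_def by simp
qed

lemma sum_Gamma_D2: "(\<Sum>b\<in>Basis. Gamma_D2 b b z s) = ((z \<bullet> z) / (4 * s\<^sup>2) - real DIM('a) / (2 * s)) * Gamma (z :: 'a::euclidean_space) s"
  unfolding Gamma_D2_def sum_distrib_right[symmetric] sum_subtractf sum_divide_distrib[symmetric]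
  by (simp add: euclidean_inner[of z z] inner_same_Basis)

lemma sum_Gamma_D3: "(\<Sum>b\<in>Basis. Gamma_D3 v b b z s)
    = ((real DIM('a) + 2) * (z \<bullet> v) / (4 * s\<^sup>2) - (z \<bullet> v) * (z \<bullet> z) / (8 * s ^ 3)) * Gamma (z :: 'a::euclidean_space) s"
proof -
  have 1: "(\<Sum>b\<in>Basis. (v \<bullet> b) * (z \<bullet> b)) = z \<bullet> v" by (simp add: euclidean_inner[of z v] mult.commute)
  have 2: "(\<Sum>b\<in>Basis. (z \<bullet> v) * (z \<bullet> b) * (z \<bullet> b)) = (z \<bullet> v) * (z \<bullet> z)"
    by (simp add: euclidean_inner[of z z] sum_distrib_left mult.assoc)
  have 3: "(\<Sum>b\<in>(Basis::'a set). (b \<bullet> b) * (z \<bullet> v)) = real DIM('a) * (z \<bullet> v)" by (simp add: inner_same_Basis)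
  show ?thesis
    unfolding Gamma_D3_def sum_distrib_right[symmetric] sum_subtractf sum_divide_distrib[symmetric] sum.distrib 1 2 3
    by (simp add: distrib_right add.commute)
qed

lemma DERIV_Gamma_time:
  fixes z :: "'a::euclidean_space"
  assumes s: "0 < s"
  shows "((\<lambda>s. Gamma z s) has_real_derivative (\<Sum>b\<in>Basis. Gamma_D2 b b z s)) (at s)"
proof -
  define q where "q = - real DIM('a) / 2"
  have 1: "((\<lambda>s. (4 * pi * s) powr q) has_real_derivative (4 * pi * s) powr q * (q / s)) (at s)"
  proof -
    have "((\<lambda>s. (4 * pi * s) powr q) has_real_derivative q * (4 * pi * s) powr (q - 1) * (4 * pi)) (at s)"
      using s by (auto intro!: derivative_eq_intros)
    moreover have "(4 * pi * s) powr (q - 1) = (4 * pi * s) powr q / (4 * pi * s)"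
      using s by (simp add: powr_diff)
    ultimately show ?thesis using s by (simp add: mult_ac)
  qed
  have 2: "((\<lambda>s. exp (- (norm z)\<^sup>2 / (4 * s))) has_real_derivative exp (- (norm z)\<^sup>2 / (4 * s)) * ((norm z)\<^sup>2 / (4 * s\<^sup>2))) (at s)"
    using s by (auto intro!: derivative_eq_intros simp: power2_eq_square)
  have "((\<lambda>s. Gamma z s) has_real_derivative (4 * pi * s) powr q * (q / s) * exp (- (norm z)\<^sup>2 / (4 * s))
      + exp (- (norm z)\<^sup>2 / (4 * s)) * ((norm z)\<^sup>2 / (4 * s\<^sup>2)) * (4 * pi * s) powr q) (at s)"
    unfolding Gamma_def q_def[symmetric] by (rule DERIV_mult[OF 1 2])
  moreover have "(4 * pi * s) powr q * (q / s) * exp (- (norm z)\<^sup>2 / (4 * s))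
      + exp (- (norm z)\<^sup>2 / (4 * s)) * ((norm z)\<^sup>2 / (4 * s\<^sup>2)) * (4 * pi * s) powr q
    = ((norm z)\<^sup>2 / (4 * s\<^sup>2) + q / s) * Gamma z s"
    unfolding Gamma_def q_def[symmetric] by (simp add: algebra_simps)
  ultimately show ?thesis
    unfolding sum_Gamma_D2 by (simp add: power2_norm_eq_inner q_def)
qed

lemma DERIV_Gamma_D1_time:
  fixes z :: "'a::euclidean_space"
  assumes s: "0 < s"
  shows "((\<lambda>s. Gamma_D1 v z s) has_real_derivative (\<Sum>b\<in>Basis. Gamma_D3 v b b z s)) (at s)"
proof -
  have 1: "((\<lambda>s. - ((z \<bullet> v) / (2 * s))) has_real_derivative (z \<bullet> v) / (2 * s\<^sup>2)) (at s)"
    using s by (auto intro!: derivative_eq_intros simp: power2_eq_square field_simps)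
  have "((\<lambda>s. Gamma_D1 v z s) has_real_derivative (z \<bullet> v) / (2 * s\<^sup>2) * Gamma z s + (\<Sum>b\<in>Basis. Gamma_D2 b b z s) * - ((z \<bullet> v) / (2 * s))) (at s)"
    unfolding Gamma_D1_def by (rule DERIV_mult[OF 1 DERIV_Gamma_time[OF s]])
  moreover have "(z \<bullet> v) / (2 * s\<^sup>2) * g + ((z \<bullet> z) / (4 * s\<^sup>2) - n / (2 * s)) * g * - ((z \<bullet> v) / (2 * s))
     = ((n + 2) * (z \<bullet> v) / (4 * s\<^sup>2) - (z \<bullet> v) * (z \<bullet> z) / (8 * s ^ 3)) * g" for g n :: real
    using s by (simp add: field_simps power2_eq_square power3_eq_cube)
  ultimately show ?thesis unfolding sum_Gamma_D2 sum_Gamma_D3 by simp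
qed

lemma exp_eq_Gamma:
  assumes "0 < c"
  shows "exp (- (c * (norm (z :: 'a::euclidean_space))\<^sup>2)) = (pi / c) powr (real DIM('a) / 2) * Gamma z (1 / (4 * c))"
proof -
  have "Gamma z (1 / (4 * c)) = (pi / c) powr (- (real DIM('a) / 2)) * exp (- (c * (norm z)\<^sup>2))"
    using assms by (simp add: Gamma_def mult.commute)
  moreover have "(pi / c) powr (real DIM('a) / 2) * (pi / c) powr (- (real DIM('a) / 2)) = 1"
    using assms by (simp add: powr_add[symmetric])
  ultimately show ?thesis by (simp only: mult.assoc[symmetric] mult_1)
qed

lemma integrable_gauss:
  assumes "0 < c"
  shows "integrable lborel (\<lambda>z :: 'a::euclidean_space. exp (- (c * (norm z)\<^sup>2)))"
proof -
  show ?thesis unfolding exp_eq_Gamma[OF assms]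
    using has_bochner_integral_Gamma[of "1 / (4 * c)" "0::'a"] assms
    by (intro integrable_mult_right) (simp add: has_bochner_integral_iff)
qed

lemma nn_integral_gauss_finite:
  assumes "0 < c"
  shows "(\<integral>\<^sup>+z. ennreal (exp (- (c * (norm (z :: 'a::euclidean_space))\<^sup>2))) \<partial>lborel) < \<infinity>"
  using integrable_gauss[OF assms, where 'a = 'a] by (simp add: integrable_iff_bounded)

text \<open>Stated for norm-preserving \<open>Y\<close> to cover the identity and the reflection at
  once.\<close>

lemma gauss_average_bounded:
  fixes Y :: "'a::euclidean_space \<Rightarrow> 'a"
  assumes [measurable]: "w \<in> borel_measurable borel" "Y \<in> borel_measurable borel" and Y: "\<And>y. norm (Y y) = norm y" and w: "\<And>y. \<bar>w y\<bar> \<le> M"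
  shows "gauss_average lborel Y w"
proof
  fix c :: real assume c: "0 < c"
  show "integrable lborel (\<lambda>y. exp (- (c * (norm (Y y))\<^sup>2)) * w y)"
  proof (rule Bochner_Integration.integrable_bound)
    show "integrable lborel (\<lambda>y::'a. exp (- (c * (norm y)\<^sup>2)) * M)" by (intro integrable_mult_left integrable_gauss c)
    show "AE y in lborel. norm (exp (- (c * (norm (Y y))\<^sup>2)) * w y) \<le> norm (exp (- (c * (norm y)\<^sup>2)) * M)"
    proof (rule AE_I2)
      fix y
      have "\<bar>w y\<bar> \<le> \<bar>M\<bar>" using w[of y] by simp
      then show "norm (exp (- (c * (norm (Y y))\<^sup>2)) * w y) \<le> norm (exp (- (c * (norm y)\<^sup>2)) * M)"
        by (simp add: Y abs_mult)
    qed
  qed measurable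
qed simp_all

context gauss_average
begin

lemma avg_sum:
  assumes "\<And>i. i \<in> I \<Longrightarrow> gauss_kernel (K i)" "0 < s"
  shows "avg (\<lambda>z s. \<Sum>i\<in>I. K i z s) x s = (\<Sum>i\<in>I. avg (K i) x s)"
  unfolding avg_def sum_distrib_right using assms by (intro Bochner_Integration.integral_sum integrable_avg)

end

text \<open>The semigroup law is differentiated in the time \<open>s\<close>: by the heat equation
  the time derivative is the Laplacian on either side, and uniqueness of derivatives identifies the
  two.\<close>

lemma Gamma_D2_semigroup:
  fixes x y :: "'a::euclidean_space"
  assumes s: "0 < s" and b: "0 < b"
  shows "has_bochner_integral lborel (\<lambda>z. (\<Sum>i\<in>Basis. Gamma_D2 i i (x - z) s) * Gamma (z - y) b) (\<Sum>i\<in>Basis. Gamma_D2 i i (x - y) (s + b))"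
proof -
  have "gauss_average lborel (\<lambda>z::'a. z) (\<lambda>z. Gamma (z - y) b)"
  proof (rule gauss_average_bounded)
    fix z show "\<bar>Gamma (z - y) b\<bar> \<le> (4 * pi * b) powr (- real DIM('a) / 2)"
      using b by (simp add: Gamma_def mult_left_le)
  qed simp_all
  then interpret gauss_average lborel "\<lambda>z::'a. z" "\<lambda>z. Gamma (z - y) b" .
  let ?K = "\<lambda>z s. \<Sum>i\<in>(Basis :: 'a set). Gamma_D2 i i z s"
  have K: "gauss_kernel ?K" by (intro gauss_kernel_sum gauss_kernel_Gamma_D2)
  have "((\<lambda>s. avg Gamma x s) has_real_derivative avg ?K x s) (at s)"
    by (intro avg_time_derivative gauss_kernel_Gamma K DERIV_Gamma_time s)
  moreover have avg: "avg Gamma x s' = Gamma (x - y) (s' + b)" if "s' \<in> {0<..}" for s'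
    using Gamma_semigroup[of s' b x y] that b by (simp add: avg_def has_bochner_integral_iff)
  ultimately have "((\<lambda>s. Gamma (x - y) (s + b)) has_real_derivative avg ?K x s) (at s)"
    using has_field_derivative_transform_within_open[of "\<lambda>s. avg Gamma x s" "avg ?K x s" s "{0<..}" "\<lambda>s. Gamma (x - y) (s + b)"] s
    by (simp add: avg)
  moreover have "((\<lambda>s. Gamma (x - y) (s + b)) has_real_derivative ?K (x - y) (s + b)) (at s)"
    using DERIV_Gamma_time[of "s + b" "x - y"] s b by (simp add: DERIV_shift)
  ultimately have "avg ?K x s = ?K (x - y) (s + b)" by (rule DERIV_unique)
  then show ?thesis
    using integrable_avg[OF K s, of x] by (simp add: has_bochner_integral_iff avg_def)
qed

lemma nn_integral_lborel_snd:
  fixes F :: "'a::euclidean_space \<times> 'b::euclidean_space \<Rightarrow> ennreal"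
  assumes F: "F \<in> borel_measurable borel"
  shows "(\<integral>\<^sup>+p. F p \<partial>lborel) = (\<integral>\<^sup>+y. \<integral>\<^sup>+x. F (x, y) \<partial>lborel \<partial>lborel)"
proof -
  have "F \<in> borel_measurable (lborel \<Otimes>\<^sub>M lborel)" using F by (simp add: lborel_prod)
  from lborel_pair.nn_integral_snd[OF this] show ?thesis by (simp add: lborel_prod)
qed

lemma lborel_Fubini:
  fixes F :: "'a::euclidean_space \<times> 'b::euclidean_space \<Rightarrow> real"
  assumes F: "integrable lborel F"
  shows integral_lborel_fst: "(\<integral>p. F p \<partial>lborel) = (\<integral>x. \<integral>y. F (x, y) \<partial>lborel \<partial>lborel)"
    and integrable_lborel_fst: "integrable lborel (\<lambda>x. \<integral>y. F (x, y) \<partial>lborel)"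
    and AE_integrable_lborel_fst: "AE x in lborel. integrable lborel (\<lambda>y. F (x, y))"
proof -
  have F': "integrable (lborel \<Otimes>\<^sub>M lborel) F" using F by (simp add: lborel_prod)
  show "(\<integral>p. F p \<partial>lborel) = (\<integral>x. \<integral>y. F (x, y) \<partial>lborel \<partial>lborel)"
    using lborel_pair.integral_fst'[OF F'] by (simp add: lborel_prod)
  show "integrable lborel (\<lambda>x. \<integral>y. F (x, y) \<partial>lborel)" by (rule lborel_pair.integrable_fst'[OF F'])
  show "AE x in lborel. integrable lborel (\<lambda>y. F (x, y))" by (rule lborel_pair.AE_integrable_fst'[OF F'])
qed

section \<open>The limit problem\<close>

definition flux_D1 :: "real \<Rightarrow> real \<Rightarrow> real" where
  "flux_D1 \<xi> s = (1 / s - \<xi>\<^sup>2 / (2 * s\<^sup>2)) * Gamma \<xi> s"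

lemma DERIV_flux:
  assumes s: "0 < s"
  shows "((\<lambda>\<xi>. flux \<xi> s) has_real_derivative flux_D1 \<xi> s) (at \<xi>)"
proof -
  have "((\<lambda>\<xi>. \<xi> / s) has_real_derivative 1 / s) (at \<xi>)" by (intro DERIV_cdivide DERIV_ident)
  from DERIV_mult[OF this DERIV_Gamma_real[OF s]]
  have "((\<lambda>\<xi>. flux \<xi> s) has_real_derivative 1 / s * Gamma \<xi> s + - (\<xi> / (2 * s)) * Gamma \<xi> s * (\<xi> / s)) (at \<xi>)"
    unfolding flux_def .
  moreover have "1 / s * g + - (\<xi> / (2 * s)) * g * (\<xi> / s) = (1 / s - \<xi>\<^sup>2 / (2 * s\<^sup>2)) * g" for g
    using s by (simp add: field_simps power2_eq_square)
  ultimately show ?thesis by (simp add: flux_D1_def)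
qed

lemma flux_tendsto_0:
  assumes s: "0 < s" shows "((\<lambda>\<xi>. flux \<xi> s) \<longlongrightarrow> 0) at_top"
  unfolding flux_def Gamma_real[OF s] using s by real_asymp

text \<open>Along \<open>\<tau>\<close> the boundary operator applied to the kernel is the total derivative
  \<open>d/d\<tau> (Gamma a (s + k \<tau>) * flux (\<eta> + \<tau>) s)\<close>.\<close>

lemma integral_boundary_operator:
  fixes a :: "'a::euclidean_space" and \<eta> :: real
  assumes s: "0 < s" and k: "0 < k"
  defines "h \<equiv> (\<lambda>\<tau>. k * ((\<Sum>i\<in>Basis. Gamma_D2 i i a (s + k * \<tau>)) * flux (\<eta> + \<tau>) s) + Gamma a (s + k * \<tau>) * flux_D1 (\<eta> + \<tau>) s)"
  assumes int: "integrable lborel (\<lambda>\<tau>. indicator {0<..} \<tau> * h \<tau>)"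
  shows "(\<integral>\<tau>. indicator {0<..} \<tau> * h \<tau> \<partial>lborel) = - Gamma a s * flux \<eta> s"
proof -
  define F where "F = (\<lambda>\<tau>. Gamma a (s + k * \<tau>) * flux (\<eta> + \<tau>) s)"
  have D1: "((\<lambda>\<tau>. Gamma a (s + k * \<tau>)) has_real_derivative (\<Sum>i\<in>Basis. Gamma_D2 i i a (s + k * \<tau>)) * k) (at \<tau>)"
    if "0 \<le> \<tau>" for \<tau>
  proof (rule DERIV_chain2[where g = "\<lambda>\<tau>. s + k * \<tau>"])
    show "((\<lambda>s. Gamma a s) has_real_derivative (\<Sum>i\<in>Basis. Gamma_D2 i i a (s + k * \<tau>))) (at (s + k * \<tau>))"
      using s k that by (intro DERIV_Gamma_time) (simp add: add_pos_nonneg)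
  qed (auto intro!: derivative_eq_intros)
  have D2: "((\<lambda>\<tau>. flux (\<eta> + \<tau>) s) has_real_derivative flux_D1 (\<eta> + \<tau>) s) (at \<tau>)" for \<tau>
    using DERIV_chain2[where g = "\<lambda>\<tau>. \<eta> + \<tau>", OF DERIV_flux[OF s] DERIV_add[OF DERIV_const DERIV_ident]] by simp
  have D3: "((\<lambda>\<tau>. Gamma (\<eta> + \<tau>) s) has_real_derivative - ((\<eta> + \<tau>) / (2 * s)) * Gamma (\<eta> + \<tau>) s) (at \<tau>)" for \<tau>
    using DERIV_chain2[where g = "\<lambda>\<tau>. \<eta> + \<tau>", OF DERIV_Gamma_real[OF s] DERIV_add[OF DERIV_const DERIV_ident]] by simp
  have D: "(F has_real_derivative h \<tau>) (at \<tau>)" if "0 \<le> \<tau>" for \<tau>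
    unfolding F_def h_def using DERIV_mult[OF D1[OF that] D2[of \<tau>]] by (simp add: mult_ac)
  have cont: "isCont h \<tau>" if "0 < \<tau>" for \<tau>
  proof -
    have sk: "s + k * \<tau> \<noteq> 0" using s k that by (simp add: add_pos_pos less_imp_neq[symmetric])
    have 1: "isCont (\<lambda>\<tau>. Gamma a (s + k * \<tau>)) \<tau>" using D1[of \<tau>] that by (intro DERIV_isCont) auto
    have 2: "isCont (\<lambda>\<tau>. \<Sum>i\<in>Basis. Gamma_D2 i i a (s + k * \<tau>)) \<tau>"
      unfolding sum_Gamma_D2 using sk by (intro continuous_intros 1) auto
    have 3: "isCont (\<lambda>\<tau>. flux (\<eta> + \<tau>) s) \<tau>"
      using D2 by (rule DERIV_isCont)
    have 4: "isCont (\<lambda>\<tau>. Gamma (\<eta> + \<tau>) s) \<tau>"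
      using D3 by (rule DERIV_isCont)
    show ?thesis unfolding h_def flux_D1_def using s by (intro continuous_intros 1 2 3 4) auto
  qed
  \<comment> \<open>The tangential factor is bounded because its time never falls below
    \<open>s\<close>; the decay is that of the flux.\<close>
  have "(F \<longlongrightarrow> 0) at_top"
  proof (rule Lim_null_comparison)
    have "norm (F \<tau>) \<le> (4 * pi * s) powr (- real DIM('a) / 2) * \<bar>flux (\<eta> + \<tau>) s\<bar>" if "0 \<le> \<tau>" for \<tau>
    proof -
      have "(4 * pi * (s + k * \<tau>)) powr (- real DIM('a) / 2) \<le> (4 * pi * s) powr (- real DIM('a) / 2)"
        using s k that by (intro powr_mono2') simp_all
      moreover have "exp (- (norm a)\<^sup>2 / (4 * (s + k * \<tau>))) \<le> 1" using s k that by simp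
      ultimately have "Gamma a (s + k * \<tau>) \<le> (4 * pi * s) powr (- real DIM('a) / 2) * 1"
        unfolding Gamma_def by (intro mult_mono) simp_all
      then have "\<bar>Gamma a (s + k * \<tau>)\<bar> * \<bar>flux (\<eta> + \<tau>) s\<bar> \<le> (4 * pi * s) powr (- real DIM('a) / 2) * \<bar>flux (\<eta> + \<tau>) s\<bar>"
        by (intro mult_right_mono) simp_all
      then show ?thesis by (simp add: F_def abs_mult)
    qed
    then show "\<forall>\<^sub>F \<tau> in at_top. norm (F \<tau>) \<le> (4 * pi * s) powr (- real DIM('a) / 2) * \<bar>flux (\<eta> + \<tau>) s\<bar>"
      using eventually_ge_at_top[of 0] by (rule eventually_mono[rotated])
    have "((\<lambda>\<tau>. flux (\<eta> + \<tau>) s) \<longlongrightarrow> 0) at_top"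
      by (rule filterlim_compose[OF flux_tendsto_0[OF s] filterlim_tendsto_add_at_top[OF tendsto_const filterlim_ident]])
    then show "((\<lambda>\<tau>. (4 * pi * s) powr (- real DIM('a) / 2) * \<bar>flux (\<eta> + \<tau>) s\<bar>) \<longlongrightarrow> 0) at_top"
      by (intro tendsto_mult_right_zero tendsto_rabs_zero)
  qed
  moreover have "(F \<longlongrightarrow> F 0) (at_right 0)"
    using DERIV_isCont[OF D[of 0]] by (simp add: isCont_def filterlim_at_split)
  ultimately have "(LBINT x=ereal 0..\<infinity>. h x) = 0 - F 0"
    using int D cont
    by (intro interval_integral_FTC_integrable)
       (auto simp: ereal_tendsto_simps has_real_derivative_iff_has_vector_derivative[symmetric] set_integrable_def einterval_def greaterThan_def[symmetric])
  then show ?thesis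
    by (simp add: interval_lebesgue_integral_0_infty set_lebesgue_integral_def F_def zero_ereal_def[symmetric])
qed

lemma norm_refl [simp]: "norm (refl y) = norm y"
  by (simp add: refl_def norm_prod_def)

lemma refl_measurable [measurable]: "refl \<in> borel_measurable borel"
  unfolding refl_def by measurable

sublocale half_space_data \<subseteq> direct: gauss_average lborel "\<lambda>y. y" f
  by (rule gauss_average_bounded) (use f_le in auto)

sublocale half_space_data \<subseteq> mirror: gauss_average lborel refl f
  by (rule gauss_average_bounded) (use f_le in auto)

text \<open>The semigroup property writes \<open>Gamma (x' - y') (s + k \<tau>)\<close> as an average of \<open>Gamma (x' - z') s\<close>
  over \<open>z'\<close>. So the boundary term of the solution is an average of translates \<open>K (x - Y \<omega>) s\<close> of a
  single kernel, with \<open>\<omega> = ((y, \<tau>), z')\<close> and \<open>Y \<omega> = (z', - (y\<^sub>N + \<tau>))\<close>.\<close>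

locale dynamic_data = half_space_data f M for f :: "('n::finite) pt \<Rightarrow> real" and M +
  fixes k :: real
  assumes k: "0 < k"
begin

definition source :: "('n pt \<times> real) \<times> (real^'n) \<Rightarrow> 'n pt" where
  "source p = (snd p, - (snd (fst (fst p)) + snd (fst p)))"

text \<open>With k > 0 the number k \<tau> is an admissible time, and the part k \<tau> of the
  tangential time s + k \<tau> is moved into the weight. The kernel that remains depends on neither
  k nor \<tau>.\<close>

definition weight :: "('n pt \<times> real) \<times> (real^'n) \<Rightarrow> real" where
  "weight p = indicator {0<..} (snd (fst p)) * Gamma (snd p - fst (fst (fst p))) (k * snd (fst p)) * f (fst (fst p))"

lemma source_measurable [measurable]: "source \<in> borel_measurable borel"
  unfolding source_def by measurable

lemma weight_measurable [measurable]: "weight \<in> borel_measurable borel"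
  unfolding weight_def by measurable

text \<open>For positive y_N and \<tau>, (y_N + \<tau>)^2 >= y_N^2 + \<tau>^2, so a Gaussian in
  \<open>source\<close> is at most a product of Gaussians in z', \<tau> and y_N. The one missing
  variable y' is integrated by the Gaussian in the weight, which has mass one.\<close>

lemma gauss_average_boundary: "gauss_average lborel source weight"
proof
  show "source \<in> borel_measurable lborel" unfolding measurable_lborel2 by (rule source_measurable)
  show "weight \<in> borel_measurable lborel" unfolding measurable_lborel2 by (rule weight_measurable)
next
  fix c :: real assume c: "0 < c"
  let ?e = "\<lambda>r :: real. ennreal (exp (- (c * r\<^sup>2)))"
  let ?W = "\<lambda>p :: ('n pt \<times> real) \<times> (real^'n). ?e (norm (snd p)) * (?e (norm (snd (fst p))) * (ennreal M *
     (indicator {0<..} (snd (fst p)) * ennreal (Gamma (snd p - fst (fst (fst p))) (k * snd (fst p))) * ?e (norm (snd (fst (fst p)))))))"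
  define E where "E = (\<integral>\<^sup>+r. ?e (norm r) \<partial>(lborel :: real measure))"
  define E' where "E' = (\<integral>\<^sup>+z. ?e (norm z) \<partial>(lborel :: (real^'n) measure))"
  have E: "E < \<infinity>" and E': "E' < \<infinity>" unfolding E_def E'_def by (rule nn_integral_gauss_finite[OF c])+
  have "(\<integral>\<^sup>+p. ennreal (norm (exp (- (c * (norm (source p))\<^sup>2)) * weight p)) \<partial>lborel) \<le> (\<integral>\<^sup>+p. ?W p \<partial>lborel)"
  proof (rule nn_integral_mono)
    fix p :: "('n pt \<times> real) \<times> (real^'n)"
    obtain y' \<eta> \<tau> z where p: "p = (((y', \<eta>), \<tau>), z)" by (metis surj_pair)
    show "ennreal (norm (exp (- (c * (norm (source p))\<^sup>2)) * weight p)) \<le> ?W p"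
    proof (cases "0 < \<tau> \<and> 0 < \<eta>")
      case True
      have "(norm z)\<^sup>2 + \<tau>\<^sup>2 + \<eta>\<^sup>2 \<le> (norm (source p))\<^sup>2"
        using True by (simp add: source_def p norm_Pair power2_sum)
      then have "c * ((norm z)\<^sup>2 + \<tau>\<^sup>2 + \<eta>\<^sup>2) \<le> c * (norm (source p))\<^sup>2" using c by (intro mult_left_mono) simp_all
      then have "exp (- (c * (norm (source p))\<^sup>2)) \<le> exp (- (c * (norm z)\<^sup>2)) * exp (- (c * \<tau>\<^sup>2)) * exp (- (c * \<eta>\<^sup>2))"
        unfolding exp_add[symmetric] by (simp add: algebra_simps)
      then have "exp (- (c * (norm (source p))\<^sup>2)) * (Gamma (z - y') (k * \<tau>) * \<bar>f (y', \<eta>)\<bar>)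
        \<le> (exp (- (c * (norm z)\<^sup>2)) * exp (- (c * \<tau>\<^sup>2)) * exp (- (c * \<eta>\<^sup>2))) * (Gamma (z - y') (k * \<tau>) * M)"
        by (intro mult_mono mult_left_mono f_le) simp_all
      also have "\<dots> = exp (- (c * (norm z)\<^sup>2)) * (exp (- (c * \<tau>\<^sup>2)) * (M * (Gamma (z - y') (k * \<tau>) * exp (- (c * \<eta>\<^sup>2)))))"
        by (simp only: mult_ac)
      finally show ?thesis
        using True M_nonneg by (simp add: p weight_def abs_mult ennreal_mult[symmetric])
    next
      case False
      then have "weight p = 0" using f_outside[of "(y', \<eta>)"] by (auto simp: p weight_def)
      then show ?thesis by simp
    qed
  qed
  also have "\<dots> = (\<integral>\<^sup>+z. \<integral>\<^sup>+\<tau>. \<integral>\<^sup>+y. ?W ((y, \<tau>), z) \<partial>lborel \<partial>lborel \<partial>lborel)"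
  proof -
    have 1: "(\<integral>\<^sup>+q. ?W (q, z) \<partial>lborel) = (\<integral>\<^sup>+\<tau>. \<integral>\<^sup>+y. ?W ((y, \<tau>), z) \<partial>lborel \<partial>lborel)" for z
      by (rule nn_integral_lborel_snd) measurable
    have "(\<integral>\<^sup>+p. ?W p \<partial>lborel) = (\<integral>\<^sup>+z. \<integral>\<^sup>+q. ?W (q, z) \<partial>lborel \<partial>lborel)"
      by (rule nn_integral_lborel_snd) measurable
    then show ?thesis unfolding 1 .
  qed
  also have "\<dots> \<le> (\<integral>\<^sup>+z. \<integral>\<^sup>+\<tau>. ?e (norm z) * (?e (norm \<tau>) * (ennreal M * E)) \<partial>(lborel :: real measure) \<partial>(lborel :: (real^'n) measure))"
  proof (intro nn_integral_mono)
    fix z :: "real^'n" and \<tau> :: real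
    have "(\<integral>\<^sup>+y. ?W ((y, \<tau>), z) \<partial>lborel) = ?e (norm z) * (?e (norm \<tau>) * (ennreal M *
       (\<integral>\<^sup>+y. (indicator {0<..} \<tau> * ennreal (Gamma (z - fst y) (k * \<tau>))) * ?e (norm (snd y)) \<partial>(lborel :: 'n pt measure))))"
      by (simp add: nn_integral_cmult)
    also have "(\<integral>\<^sup>+y. (indicator {0<..} \<tau> * ennreal (Gamma (z - fst y) (k * \<tau>))) * ?e (norm (snd y)) \<partial>(lborel :: 'n pt measure))
       = (\<integral>\<^sup>+y. indicator {0<..} \<tau> * ennreal (Gamma (z - y) (k * \<tau>)) \<partial>lborel) * E"
      unfolding E_def by (rule nn_integral_pt_product) measurable
    also have "(\<integral>\<^sup>+y. indicator {0<..} \<tau> * ennreal (Gamma (z - y) (k * \<tau>)) \<partial>lborel) = indicator {0<..} \<tau>"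
      using nn_integral_lborel_reflect[of "\<lambda>y. ennreal (Gamma y (k * \<tau>))" z] k
      by (cases "0 < \<tau>") (simp_all add: nn_integral_Gamma)
    also have "indicator {0<..} \<tau> * E \<le> E" by (simp add: indicator_def)
    finally show "(\<integral>\<^sup>+y. ?W ((y, \<tau>), z) \<partial>lborel) \<le> ?e (norm z) * (?e (norm \<tau>) * (ennreal M * E))"
      by (simp add: mult_left_mono)
  qed
  also have "\<dots> = E' * (E * (ennreal M * E))"
  proof -
    have "(\<integral>\<^sup>+\<tau>. ?e (norm z) * (?e (norm \<tau>) * (ennreal M * E)) \<partial>(lborel :: real measure)) = ?e (norm z) * (E * (ennreal M * E))" for z :: "real^'n"
      unfolding E_def by (subst nn_integral_cmult, measurable, subst nn_integral_multc) simp_all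
    then show ?thesis by (simp only:) (simp add: nn_integral_multc E'_def)
  qed
  also have "\<dots> < \<infinity>" using E E' by (simp add: ennreal_mult_less_top)
  finally have fin: "(\<integral>\<^sup>+p. ennreal (norm (exp (- (c * (norm (source p))\<^sup>2)) * weight p)) \<partial>lborel) < \<infinity>" .
  show "integrable lborel (\<lambda>p. exp (- (c * (norm (source p))\<^sup>2)) * weight p)"
  proof -
    have "(\<lambda>z :: 'n pt. exp (- (c * (norm z)\<^sup>2))) \<in> borel_measurable borel"
      by (intro borel_measurable_continuous_onI continuous_intros)
    from borel_measurable_times[OF measurable_compose[OF source_measurable this] weight_measurable]
    have "(\<lambda>p. exp (- (c * (norm (source p))\<^sup>2)) * weight p) \<in> borel_measurable borel" .
    then have m: "(\<lambda>p. exp (- (c * (norm (source p))\<^sup>2)) * weight p) \<in> borel_measurable lborel"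
      unfolding measurable_lborel2 .
    show ?thesis unfolding integrable_iff_bounded using m fin by (rule conjI)
  qed
qed

sublocale boundary: gauss_average lborel source weight
  by (rule gauss_average_boundary)

text \<open>Integrates out the auxiliary variable z', returning to an integral over (y, \<tau>). The
  hypothesis \<open>conv\<close> is the semigroup law, for the Gaussian or for its
  Laplacian.\<close>

lemma boundary_avg_product:
  assumes K: "gauss_kernel K" and s: "0 < s" and fact: "\<And>z. K z s = A (fst z) * B (snd z)"
    and conv: "\<And>x y b. 0 < b \<Longrightarrow> has_bochner_integral lborel (\<lambda>z. A (x - z) * Gamma (z - y) b) (A' (x - y) b)"
  defines "q \<equiv> (\<lambda>x (y, \<tau>). indicator {0<..} \<tau> * (A' (fst x - fst y) (k * \<tau>) * B (snd x + snd y + \<tau>)) * f y)"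
  shows "boundary.avg K x s = (\<integral>p. q x p \<partial>lborel)" and "integrable lborel (q x)"
proof -
  note F = lborel_Fubini[OF boundary.integrable_avg[OF K s, of x]]
  have eq: "(\<integral>z. K (x - source (p, z)) s * weight (p, z) \<partial>lborel) = q x p" for p
  proof -
    obtain y \<tau> where p: "p = (y, \<tau>)" by (metis surj_pair)
    show ?thesis
    proof (cases "0 < \<tau>")
      case True
      have "(\<integral>z. K (x - source (p, z)) s * weight (p, z) \<partial>lborel)
        = (\<integral>z. (A (fst x - z) * Gamma (z - fst y) (k * \<tau>)) * (B (snd x + snd y + \<tau>) * f y) \<partial>lborel)"
        using True by (intro Bochner_Integration.integral_cong) (simp_all add: fact source_def weight_def p algebra_simps)
      then show ?thesis
        using conv[of "k * \<tau>" "fst x" "fst y"] True k by (simp add: q_def p has_bochner_integral_iff)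
    qed (simp add: q_def p weight_def)
  qed
  show "boundary.avg K x s = (\<integral>p. q x p \<partial>lborel)" using F(1) unfolding boundary.avg_def eq .
  show "integrable lborel (q x)" using F(2) unfolding eq .
qed

end

section \<open>Smoothness, heat equation and boundary condition\<close>

lemma closure_Omega_nonneg: "x \<in> closure Omega \<Longrightarrow> 0 \<le> snd x"
proof -
  have "closed {x :: 'a pt. 0 \<le> snd x}" by (intro closed_Collect_le continuous_intros)
  then have "closure Omega \<subseteq> {x :: 'a pt. 0 \<le> snd x}" by (intro closure_minimal) auto
  then show "x \<in> closure Omega \<Longrightarrow> 0 \<le> snd x" by auto
qed

lemma open_Omega: "open (Omega :: ('n::finite) pt set)"
  unfolding Omega_def by (intro open_Collect_less continuous_intros)

lemma frontier_Omega_zero: "x \<in> frontier Omega \<Longrightarrow> snd x = 0"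
  using closure_Omega_nonneg[of x] by (auto simp: frontier_def interior_open[OF open_Omega])

context dynamic_data
begin

text \<open>\<open>K\<close> is the kernel of the Dirichlet part and \<open>L\<close> that of the
  boundary part. A derivative of the solution is again a \<open>sol\<close>, with both kernels
  differentiated, so one set of rules serves all orders.\<close>

definition sol :: "('n pt \<Rightarrow> real \<Rightarrow> real) \<Rightarrow> ('n pt \<Rightarrow> real \<Rightarrow> real) \<Rightarrow> 'n pt \<Rightarrow> real \<Rightarrow> real" where
  "sol K L x s = direct.avg K x s - mirror.avg K x s + boundary.avg (\<lambda>z s. - 2 * L z s) x s"

lemma continuous_on_sol:
  assumes "gauss_kernel K" "gauss_kernel L"
  shows "continuous_on (UNIV \<times> {0<..}) (\<lambda>(x, s). sol K L x s)"
  using direct.continuous_on_avg[OF assms(1)] mirror.continuous_on_avg[OF assms(1)]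
    boundary.continuous_on_avg[OF gauss_kernel_cmult[OF assms(2)], of "- 2"]
  unfolding sol_def case_prod_beta by (intro continuous_on_add continuous_on_diff)

lemma sol_directional_derivative:
  assumes "gauss_kernel K" "gauss_kernel K'" "gauss_kernel L" "gauss_kernel L'" "0 < s"
    and DK: "\<And>z. ((\<lambda>h. K (z + h *\<^sub>R v) s) has_real_derivative K' z s) (at 0)"
    and DL: "\<And>z. ((\<lambda>h. L (z + h *\<^sub>R v) s) has_real_derivative L' z s) (at 0)"
  shows "((\<lambda>h. sol K L (x + h *\<^sub>R v) s) has_real_derivative sol K' L' x s) (at 0)"
  unfolding sol_def
  by (intro DERIV_add DERIV_diff direct.avg_directional_derivative mirror.avg_directional_derivative
      boundary.avg_directional_derivative gauss_kernel_cmult DERIV_cmult DK DL assms)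

lemma sol_time_derivative:
  assumes "gauss_kernel K" "gauss_kernel K'" "gauss_kernel L" "gauss_kernel L'" "0 < s"
    and DK: "\<And>z s. 0 < s \<Longrightarrow> ((\<lambda>s. K z s) has_real_derivative K' z s) (at s)"
    and DL: "\<And>z s. 0 < s \<Longrightarrow> ((\<lambda>s. L z s) has_real_derivative L' z s) (at s)"
  shows "((\<lambda>s. sol K L x s) has_real_derivative sol K' L' x s) (at s)"
  unfolding sol_def
  by (intro DERIV_add DERIV_diff direct.avg_time_derivative mirror.avg_time_derivative
      boundary.avg_time_derivative gauss_kernel_cmult DERIV_cmult DK DL assms)

lemma sol_sum:
  assumes "\<And>i. i \<in> I \<Longrightarrow> gauss_kernel (K i)" "\<And>i. i \<in> I \<Longrightarrow> gauss_kernel (L i)" "0 < s"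
  shows "sol (\<lambda>z s. \<Sum>i\<in>I. K i z s) (\<lambda>z s. \<Sum>i\<in>I. L i z s) x s = (\<Sum>i\<in>I. sol (K i) (L i) x s)"
  unfolding sol_def sum_distrib_left sum_subtractf sum.distrib
  by (simp only: direct.avg_sum[OF assms(1,3)] mirror.avg_sum[OF assms(1,3)] boundary.avg_sum[OF gauss_kernel_cmult[OF assms(2)] assms(3)])

lemma boundary_avg_flux:
  assumes s: "0 < s"
  shows "boundary.avg (\<lambda>z s. - 2 * Gamma_D1 (0, 1) z s) x s = (\<integral>y. dyn_integral 0 k s x y * f y \<partial>lborel)"
proof -
  have fact: "- 2 * Gamma_D1 (0, 1) z s = Gamma (fst z) s * flux (snd z) s" for z :: "'n pt"
    unfolding Gamma_D1_def Gamma_prod[OF s] by (simp add: flux_def inner_prod_def)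
  note P = boundary_avg_product[OF gauss_kernel_cmult[OF gauss_kernel_Gamma_D1] s fact Gamma_semigroup[OF s], of x]
  have eq: "(\<integral>\<tau>. (case (y, \<tau>) of (y, \<tau>) \<Rightarrow> indicator {0<..} \<tau> * (Gamma (fst x - fst y) (s + k * \<tau>) * flux (snd x + snd y + \<tau>) s) * f y) \<partial>lborel)
      = dyn_integral 0 k s x y * f y" for y
    unfolding prod.case
    by (subst integral_mult_left_zero[symmetric], rule Bochner_Integration.integral_cong)
       (use s in \<open>simp_all add: dyn_kernel_def flux_kernel_def\<close>)
  show ?thesis using P(1) integral_lborel_fst[OF P(2)] unfolding eq by simp
qed

text \<open>On the closed half space the two agree; \<open>sol\<close> continues the solution to the
  whole space, where derivatives are two-sided.\<close>

lemma dyn_sol_eq_sol: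
  assumes s: "0 < s" and x: "0 \<le> snd x"
  shows "dyn_sol 0 k s f x = sol Gamma (Gamma_D1 (0, 1)) x s"
proof -
  have "time_lag 0 k s x" using s x k by (intro time_lag_0) simp_all
  moreover have "(\<integral>y. G0 x y s * f y \<partial>lborel) = direct.avg Gamma x s - mirror.avg Gamma x s"
    unfolding direct.avg_def mirror.avg_def G0_def left_diff_distrib
    by (intro Bochner_Integration.integral_diff direct.integrable_avg mirror.integrable_avg gauss_kernel_Gamma s)
  ultimately show ?thesis unfolding sol_def boundary_avg_flux[OF s] by (simp only: dyn_sol_split)
qed

lemma boundary_avg_operator:
  assumes s: "0 < s"
  shows "k * boundary.avg (\<lambda>z s. \<Sum>i\<in>Basis. - 2 * Gamma_D3 (0, 1) (i, 0) (i, 0) z s) x s + boundary.avg (\<lambda>z s. - 2 * Gamma_D2 (0, 1) (0, 1) z s) x s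
     = - (\<integral>y. Gamma (fst x - fst y) s * flux (snd x + snd y) s * f y \<partial>lborel)"
proof -
  \<comment> \<open>The tangential derivatives act on the first factor only, and the normal
    derivative with its factor -2 turns the second into the flux.\<close>
  have f1: "(\<Sum>i\<in>Basis. - 2 * Gamma_D3 (0, 1) (i, 0) (i, 0) z s) = (\<Sum>i\<in>Basis. Gamma_D2 i i (fst z) s) * flux (snd z) s" for z :: "'n pt"
    unfolding sum_distrib_right
  proof (rule sum.cong[OF HOL.refl])
    fix i :: "real^'n" assume i: "i \<in> Basis"
    have "- 2 * ((\<eta> / (4 * s\<^sup>2) - \<eta> * u * u / (8 * s ^ 3)) * (a * b)) = ((u * u / (4 * s\<^sup>2) - 1 / (2 * s)) * a) * (\<eta> / s * b)" for \<eta> u a b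
      using s by (simp add: field_simps power2_eq_square power3_eq_cube)
    then show "- 2 * Gamma_D3 (0, 1) (i, 0) (i, 0) z s = Gamma_D2 i i (fst z) s * flux (snd z) s"
      unfolding Gamma_D3_def Gamma_D2_def Gamma_prod[OF s] flux_def using i by (simp add: inner_prod_def inner_same_Basis)
  qed
  have f2: "- 2 * Gamma_D2 (0, 1) (0, 1) z s = Gamma (fst z) s * flux_D1 (snd z) s" for z :: "'n pt"
    unfolding Gamma_D2_def Gamma_prod[OF s] flux_D1_def using s by (simp add: inner_prod_def field_simps power2_eq_square)
  have K1: "gauss_kernel (\<lambda>(z :: 'n pt) s. \<Sum>i\<in>Basis. - 2 * Gamma_D3 (0, 1) (i, 0) (i, 0) z s)"
    by (intro gauss_kernel_sum gauss_kernel_cmult gauss_kernel_Gamma_D3)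
  have K2: "gauss_kernel (\<lambda>(z :: 'n pt) s. - 2 * Gamma_D2 (0, 1) (0, 1) z s)"
    by (intro gauss_kernel_cmult gauss_kernel_Gamma_D2)
  define q1 where "q1 = (\<lambda>(y, \<tau>). indicator {0<..} \<tau> * ((\<Sum>i\<in>Basis. Gamma_D2 i i (fst x - fst y) (s + k * \<tau>)) * flux (snd x + snd y + \<tau>) s) * f y)"
  define q2 where "q2 = (\<lambda>(y, \<tau>). indicator {0<..} \<tau> * (Gamma (fst x - fst y) (s + k * \<tau>) * flux_D1 (snd x + snd y + \<tau>) s) * f y)"
  note P1 = boundary_avg_product[OF K1 s f1 Gamma_D2_semigroup[OF s], of x, folded q1_def]
  note P2 = boundary_avg_product[OF K2 s f2 Gamma_semigroup[OF s], of x, folded q2_def]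
  define h where "h = (\<lambda>y \<tau>. k * ((\<Sum>i\<in>Basis. Gamma_D2 i i (fst x - fst y) (s + k * \<tau>)) * flux (snd x + snd y + \<tau>) s)
      + Gamma (fst x - fst y) (s + k * \<tau>) * flux_D1 (snd x + snd y + \<tau>) s)"
  define q where "q = (\<lambda>p. k * q1 p + q2 p)"
  have q: "q (y, \<tau>) = (indicator {0<..} \<tau> * h y \<tau>) * f y" for y \<tau>
    unfolding q_def q1_def q2_def h_def prod.case by (simp only: distrib_left distrib_right mult_ac)
  have int: "integrable lborel q" unfolding q_def by (intro Bochner_Integration.integrable_add integrable_mult_right P1(2) P2(2))
  have "integrable lborel (\<lambda>p. k * q1 p)" by (rule integrable_mult_right[OF P1(2)])
  moreover have "(\<integral>p. k * q1 p \<partial>lborel) = k * (\<integral>p. q1 p \<partial>lborel)" by (rule integral_mult_right_zero)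
  ultimately have "(\<integral>p. q p \<partial>lborel) = k * (\<integral>p. q1 p \<partial>lborel) + (\<integral>p. q2 p \<partial>lborel)"
    unfolding q_def using P2(2) by (simp only: Bochner_Integration.integral_add)
  then have "k * boundary.avg (\<lambda>z s. \<Sum>i\<in>Basis. - 2 * Gamma_D3 (0, 1) (i, 0) (i, 0) z s) x s + boundary.avg (\<lambda>z s. - 2 * Gamma_D2 (0, 1) (0, 1) z s) x s
     = (\<integral>p. q p \<partial>lborel)"
    by (simp only: P1(1) P2(1))
  also have "\<dots> = (\<integral>y. \<integral>\<tau>. q (y, \<tau>) \<partial>lborel \<partial>lborel)" by (rule integral_lborel_fst[OF int])
  also have "\<dots> = (\<integral>y. - (Gamma (fst x - fst y) s * flux (snd x + snd y) s * f y) \<partial>lborel)"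
  proof (rule integral_cong_AE)
    show "(\<lambda>y. \<integral>\<tau>. q (y, \<tau>) \<partial>lborel) \<in> borel_measurable lborel"
      using integrable_lborel_fst[OF int] by simp
    \<comment> \<open>Fubini provides integrability in \<tau> for almost every \<open>y\<close>
      only, and of the product with \<open>f y\<close>. Where \<open>f y\<close> is nonzero,
      division isolates the total derivative; elsewhere both sides vanish.\<close>
    show "AE y in lborel. (\<integral>\<tau>. q (y, \<tau>) \<partial>lborel) = - (Gamma (fst x - fst y) s * flux (snd x + snd y) s * f y)"
      using AE_integrable_lborel_fst[OF int]
    proof eventually_elim
      fix y assume iy: "integrable lborel (\<lambda>\<tau>. q (y, \<tau>))"
      show "(\<integral>\<tau>. q (y, \<tau>) \<partial>lborel) = - (Gamma (fst x - fst y) s * flux (snd x + snd y) s * f y)"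
      proof (cases "f y = 0")
        case False
        have "integrable lborel (\<lambda>\<tau>. q (y, \<tau>) / f y)" using iy by (rule integrable_divide_zero)
        then have "integrable lborel (\<lambda>\<tau>. indicator {0<..} \<tau> * h y \<tau>)" using False by (simp add: q)
        then have "(\<integral>\<tau>. indicator {0<..} \<tau> * h y \<tau> \<partial>lborel) = - Gamma (fst x - fst y) s * flux (snd x + snd y) s"
          unfolding h_def by (rule integral_boundary_operator[OF s k])
        then show ?thesis unfolding q by simp
      qed (simp add: q)
    qed
  qed measurable
  finally show ?thesis by simp
qed

lemma sol_boundary_condition:
  assumes s: "0 < s" and x: "snd x = 0"
  shows "- k * (\<Sum>i\<in>Basis. sol (Gamma_D2 (i, 0) (i, 0)) (Gamma_D3 (0, 1) (i, 0) (i, 0)) x s)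
     - sol (Gamma_D1 (0, 1)) (Gamma_D2 (0, 1) (0, 1)) x s = 0"
proof -
  have n: "norm (x - y) = norm (x - refl y)" for y :: "'n pt" using x by (simp add: refl_def norm_prod_def)
  then have g: "Gamma (x - y) s = Gamma (x - refl y) s" for y :: "'n pt" by (simp add: Gamma_def)
  \<comment> \<open>At x_N = 0 the direct and the mirror Gaussian coincide, so their tangential
    derivatives cancel and only the boundary part contributes.\<close>
  have "direct.avg (Gamma_D2 (i, 0) (i, 0)) x s = mirror.avg (Gamma_D2 (i, 0) (i, 0)) x s" for i
    unfolding direct.avg_def mirror.avg_def
  proof (rule Bochner_Integration.integral_cong[OF HOL.refl])
    fix y
    show "Gamma_D2 (i, 0) (i, 0) (x - y) s * f y = Gamma_D2 (i, 0) (i, 0) (x - refl y) s * f y"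
      unfolding Gamma_D2_def g[of y] by (simp add: refl_def inner_prod_def)
  qed
  moreover have "boundary.avg (\<lambda>z s. \<Sum>i\<in>Basis. - 2 * Gamma_D3 (0, 1) (i, 0) (i, 0) z s) x s
     = (\<Sum>i\<in>Basis. boundary.avg (\<lambda>z s. - 2 * Gamma_D3 (0, 1) (i, 0) (i, 0) z s) x s)"
    by (intro boundary.avg_sum gauss_kernel_cmult gauss_kernel_Gamma_D3 s)
  ultimately have 1: "(\<Sum>i\<in>Basis. sol (Gamma_D2 (i, 0) (i, 0)) (Gamma_D3 (0, 1) (i, 0) (i, 0)) x s)
     = boundary.avg (\<lambda>z s. \<Sum>i\<in>Basis. - 2 * Gamma_D3 (0, 1) (i, 0) (i, 0) z s) x s"
    by (simp add: sol_def)
  \<comment> \<open>The normal derivatives have opposite signs at x_N = 0 and add up to the flux,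
    which is the negative of what \<open>boundary_avg_operator\<close> produces.\<close>
  have "direct.avg (Gamma_D1 (0, 1)) x s - mirror.avg (Gamma_D1 (0, 1)) x s
     = (\<integral>y. Gamma_D1 (0, 1) (x - y) s * f y - Gamma_D1 (0, 1) (x - refl y) s * f y \<partial>lborel)"
    unfolding direct.avg_def mirror.avg_def
    by (intro Bochner_Integration.integral_diff[symmetric] direct.integrable_avg mirror.integrable_avg gauss_kernel_Gamma_D1 s)
  also have "\<dots> = (\<integral>y. Gamma (fst x - fst y) s * flux (snd x + snd y) s * f y \<partial>lborel)"
  proof (rule Bochner_Integration.integral_cong[OF HOL.refl])
    fix y
    have "Gamma (x - y) s = Gamma (fst x - fst y) s * Gamma (snd y) s"
      unfolding Gamma_prod[OF s] using x by simp
    then show "Gamma_D1 (0, 1) (x - y) s * f y - Gamma_D1 (0, 1) (x - refl y) s * f y = Gamma (fst x - fst y) s * flux (snd x + snd y) s * f y"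
      unfolding Gamma_D1_def g[of y, symmetric] using x s by (simp add: refl_def inner_prod_def flux_def field_simps)
  qed
  finally have "sol (Gamma_D1 (0, 1)) (Gamma_D2 (0, 1) (0, 1)) x s
     = (\<integral>y. Gamma (fst x - fst y) s * flux (snd x + snd y) s * f y \<partial>lborel) + boundary.avg (\<lambda>z s. - 2 * Gamma_D2 (0, 1) (0, 1) z s) x s"
    by (simp add: sol_def)
  then show ?thesis unfolding 1 using boundary_avg_operator[OF s, of x] by linarith
qed

lemma sol_heat_equation:
  fixes x :: "'n pt"
  assumes s: "0 < s"
  shows "((\<lambda>s. sol Gamma (Gamma_D1 (0, 1)) x s) has_real_derivative
     (\<Sum>b\<in>Basis. sol (Gamma_D2 b b) (Gamma_D3 (0, 1) b b) x s)) (at s)"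
proof -
  have "((\<lambda>s. sol Gamma (Gamma_D1 (0, 1)) x s) has_real_derivative
     sol (\<lambda>z s. \<Sum>b\<in>Basis. Gamma_D2 b b z s) (\<lambda>z s. \<Sum>b\<in>Basis. Gamma_D3 (0, 1) b b z s) x s) (at s)"
    by (intro sol_time_derivative gauss_kernel_Gamma gauss_kernel_sum gauss_kernel_Gamma_D1 gauss_kernel_Gamma_D2
        gauss_kernel_Gamma_D3 DERIV_Gamma_time DERIV_Gamma_D1_time s)
  then show ?thesis
    by (subst (asm) sol_sum[OF gauss_kernel_Gamma_D2 gauss_kernel_Gamma_D3 s])
qed

end

section \<open>Initial values\<close>

text \<open>Inserting the factor (\<xi> + \<tau>)/\<xi> >= 1 turns the integrand into s/\<xi> times
  the flux, whose integral is 2 Gamma \<xi> s <= 2/\<xi>.\<close>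

lemma nn_integral_Gamma_ray_le:
  assumes s: "0 < s" and x: "0 < \<xi>"
  shows "(\<integral>\<^sup>+\<tau>. ennreal (Gamma (\<xi> + \<tau> :: real) s) * indicator {0<..} \<tau> \<partial>lborel) \<le> ennreal (2 * s / \<xi>\<^sup>2)"
proof -
  have "(\<integral>\<^sup>+\<tau>. ennreal (Gamma (\<xi> + \<tau>) s) * indicator {0<..} \<tau> \<partial>lborel)
    \<le> (\<integral>\<^sup>+\<tau>. ennreal (s / \<xi>) * (ennreal (flux (\<xi> + \<tau>) s) * indicator {0<..} \<tau>) \<partial>lborel)"
  proof (rule nn_integral_mono)
    fix \<tau> :: real
    show "ennreal (Gamma (\<xi> + \<tau>) s) * indicator {0<..} \<tau> \<le> ennreal (s / \<xi>) * (ennreal (flux (\<xi> + \<tau>) s) * indicator {0<..} \<tau>)"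
    proof (cases "0 < \<tau>")
      case True
      have "1 * Gamma (\<xi> + \<tau>) s \<le> (\<xi> + \<tau>) / \<xi> * Gamma (\<xi> + \<tau>) s"
        using True x by (intro mult_right_mono) simp_all
      also have "\<dots> = s / \<xi> * flux (\<xi> + \<tau>) s" using s by (simp add: flux_def)
      finally have "Gamma (\<xi> + \<tau>) s \<le> s / \<xi> * flux (\<xi> + \<tau>) s" by simp
      then show ?thesis using True s x by (simp add: ennreal_mult[symmetric] flux_nonneg ennreal_leI)
    qed simp
  qed
  also have "\<dots> = ennreal (s / \<xi>) * ennreal (2 * Gamma \<xi> s)"
    by (subst nn_integral_cmult, simp, subst nn_integral_flux) (use s x in auto)
  also have "\<dots> = ennreal (s / \<xi> * (2 * Gamma \<xi> s))" using s x by (intro ennreal_mult[symmetric]) simp_all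
  also have "\<dots> \<le> ennreal (s / \<xi> * (2 * (1 / \<xi>)))"
    using s x Gamma_le_inverse[OF x s] by (intro ennreal_leI mult_left_mono) simp_all
  finally show ?thesis by (simp add: power2_eq_square mult_ac)
qed

text \<open>The counterpart of \<open>square_Gamma_le\<close> in any dimension; 2^(n/2), with n the
  dimension, is the change of the prefactor when the time doubles.\<close>

lemma square_norm_Gamma_le:
  fixes z :: "'a::euclidean_space"
  assumes s: "0 < s"
  shows "(norm z)\<^sup>2 * Gamma z s \<le> (8 * 2 powr (real DIM('a) / 2)) * s * Gamma z (2 * s)"
proof -
  define u where "u = (norm z)\<^sup>2 / (8 * s)"
  have "u \<le> exp u" using exp_ge_add_one_self[of u] by linarith
  then have "u * exp (- u) \<le> 1" by (simp add: exp_minus field_simps)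
  then have 1: "u * exp (- u) * exp (- u) \<le> 1 * exp (- u)" by (rule mult_right_mono) simp
  have e: "exp (- (norm z)\<^sup>2 / (4 * s)) = exp (- u) * exp (- u)" unfolding exp_add[symmetric] u_def by simp
  have n: "(norm z)\<^sup>2 = 8 * s * u" using s by (simp add: u_def)
  have e2: "exp (- (norm z)\<^sup>2 / (4 * (2 * s))) = exp (- u)" by (simp add: u_def)
  have p: "(4 * pi * s) powr q = 2 powr (- q) * (4 * pi * (2 * s)) powr q" for q
  proof -
    have "(4 * pi * (2 * s)) powr q = 2 powr q * (4 * pi * s) powr q"
      using s by (subst powr_mult[symmetric]) (simp_all add: mult_ac)
    then show ?thesis by (simp add: powr_minus)
  qed
  have "(norm z)\<^sup>2 * Gamma z s = (8 * s * (4 * pi * s) powr (- real DIM('a) / 2)) * (u * exp (- u) * exp (- u))"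
    unfolding Gamma_def e by (subst n) (simp only: mult_ac)
  also have "\<dots> \<le> (8 * s * (4 * pi * s) powr (- real DIM('a) / 2)) * (1 * exp (- u))"
    using s by (intro mult_left_mono 1) simp
  also have "\<dots> = (8 * 2 powr (real DIM('a) / 2)) * s * Gamma z (2 * s)"
    unfolding Gamma_def e2 by (subst p) simp
  finally show ?thesis .
qed

text \<open>A Chebyshev argument without splitting the integral: |g y - g x| <= \<omega> + 2 M |x -
  y|^2 / r^2 for every \<open>y\<close>, and the second moment of the Gaussian is of order
  s.\<close>

lemma Gamma_average_close:
  fixes g :: "'a::euclidean_space \<Rightarrow> real"
  assumes s: "0 < s" and g [measurable]: "g \<in> borel_measurable borel" and M: "\<And>y. \<bar>g y\<bar> \<le> M"
    and r: "0 < r" and \<omega>: "0 \<le> \<omega>" "\<And>y. dist x y < r \<Longrightarrow> \<bar>g y - g x\<bar> \<le> \<omega>"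
  shows "\<bar>(\<integral>y. Gamma (x - y) s * g y \<partial>lborel) - g x\<bar> \<le> \<omega> + 2 * M / r\<^sup>2 * ((8 * 2 powr (real DIM('a) / 2)) * s)"
proof -
  let ?C = "8 * 2 powr (real DIM('a) / 2)"
  have M0: "0 \<le> M" using M[of 0] by linarith
  note I = integrable_Gamma_mult(1)[OF s g M, of x]
  have G: "has_bochner_integral lborel (\<lambda>y. Gamma (x - y) s * g x) (1 * g x)"
    by (intro has_bochner_integral_mult_left has_bochner_integral_Gamma s)
  have B: "has_bochner_integral lborel (\<lambda>y. \<omega> * Gamma (x - y) s + 2 * M / r\<^sup>2 * (?C * s) * Gamma (x - y) (2 * s)) (\<omega> * 1 + 2 * M / r\<^sup>2 * (?C * s) * 1)"
    using s by (intro has_bochner_integral_add has_bochner_integral_mult_right has_bochner_integral_Gamma) simp_all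
  have le: "norm (Gamma (x - y) s * g y - Gamma (x - y) s * g x) \<le> \<omega> * Gamma (x - y) s + 2 * M / r\<^sup>2 * (?C * s) * Gamma (x - y) (2 * s)" for y
  proof -
    have "\<bar>g y - g x\<bar> \<le> \<omega> + 2 * M / r\<^sup>2 * (norm (x - y))\<^sup>2"
    proof (cases "dist x y < r")
      case True
      have "0 \<le> 2 * M / r\<^sup>2 * (norm (x - y))\<^sup>2" using M0 by simp
      then show ?thesis using \<omega>(2)[OF True] by linarith
    next
      case False
      then have "r\<^sup>2 \<le> (norm (x - y))\<^sup>2" using r by (intro power_mono) (simp_all add: dist_norm)
      then have "2 * M * r\<^sup>2 \<le> 2 * M * (norm (x - y))\<^sup>2" using M0 by (intro mult_left_mono) simp_all
      then have "2 * M \<le> 2 * M / r\<^sup>2 * (norm (x - y))\<^sup>2" using r by (simp add: le_divide_eq)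
      then show ?thesis using M[of y] M[of x] \<omega>(1) by linarith
    qed
    then have "\<bar>g y - g x\<bar> * Gamma (x - y) s \<le> (\<omega> + 2 * M / r\<^sup>2 * (norm (x - y))\<^sup>2) * Gamma (x - y) s"
      by (intro mult_right_mono) simp_all
    also have "\<dots> = \<omega> * Gamma (x - y) s + 2 * M / r\<^sup>2 * ((norm (x - y))\<^sup>2 * Gamma (x - y) s)" by (simp add: distrib_right)
    also have "\<dots> \<le> \<omega> * Gamma (x - y) s + 2 * M / r\<^sup>2 * (?C * s * Gamma (x - y) (2 * s))"
      using M0 by (intro add_left_mono mult_left_mono square_norm_Gamma_le s) simp
    also have "\<bar>g y - g x\<bar> * Gamma (x - y) s = norm (Gamma (x - y) s * g y - Gamma (x - y) s * g x)"
      unfolding right_diff_distrib[symmetric] real_norm_def abs_mult by simp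
    finally show ?thesis by (simp only: mult.assoc)
  qed
  have eq: "(\<integral>y. Gamma (x - y) s * g y \<partial>lborel) - g x = (\<integral>y. Gamma (x - y) s * g y - Gamma (x - y) s * g x \<partial>lborel)"
    using G by (subst Bochner_Integration.integral_diff[OF I]) (simp_all only: has_bochner_integral_iff mult_1)
  have "\<bar>\<integral>y. Gamma (x - y) s * g y - Gamma (x - y) s * g x \<partial>lborel\<bar> \<le> (\<integral>y. \<omega> * Gamma (x - y) s + 2 * M / r\<^sup>2 * (?C * s) * Gamma (x - y) (2 * s) \<partial>lborel)"
  proof (rule integral_abs_bound_integral)
    show "integrable lborel (\<lambda>y. Gamma (x - y) s * g y - Gamma (x - y) s * g x)"
      using G by (intro Bochner_Integration.integrable_diff I) (simp only: has_bochner_integral_iff)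
    show "integrable lborel (\<lambda>y. \<omega> * Gamma (x - y) s + 2 * M / r\<^sup>2 * (?C * s) * Gamma (x - y) (2 * s))"
      using B by (simp only: has_bochner_integral_iff)
    show "\<bar>Gamma (x - y) s * g y - Gamma (x - y) s * g x\<bar> \<le> \<omega> * Gamma (x - y) s + 2 * M / r\<^sup>2 * (?C * s) * Gamma (x - y) (2 * s)" for y
      by (rule le[unfolded real_norm_def])
  qed
  also have "\<dots> = \<omega> * 1 + 2 * M / r\<^sup>2 * (?C * s) * 1" using B by (simp only: has_bochner_integral_iff)
  finally show ?thesis unfolding eq by (simp only: mult_1_right)
qed

text \<open>The point \<open>y\<close> may leave \<open>K\<close>, which uniform continuity on
  \<open>K\<close> would not allow. The radius is a Lebesgue number for a cover of \<open>K\<close>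
  by open sets on which \<open>f\<close> oscillates by at most \<open>e\<close>.\<close>

lemma uniformly_continuous_near_compact:
  fixes f :: "'a::heine_borel \<Rightarrow> real"
  assumes K: "compact K" "K \<subseteq> U" and U: "open U" and f: "continuous_on U f" and e: "0 < e"
  shows "\<exists>r>0. \<forall>x\<in>K. \<forall>y. dist x y < r \<longrightarrow> \<bar>f y - f x\<bar> \<le> e"
proof -
  define \<G> where "\<G> = {S. open S \<and> (\<forall>y\<in>S. \<forall>z\<in>S. \<bar>f y - f z\<bar> \<le> e)}"
  have "K \<subseteq> \<Union>\<G>"
  proof
    fix x assume "x \<in> K"
    then have "isCont f x" using K(2) f unfolding continuous_on_eq_continuous_at[OF U] by blast
    then obtain d where d: "d > 0" "\<And>y. dist y x < d \<Longrightarrow> dist (f y) (f x) < e / 2"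
      using e unfolding continuous_at_eps_delta by (meson half_gt_zero)
    have "ball x d \<in> \<G>"
      unfolding \<G>_def
    proof (intro CollectI conjI open_ball ballI)
      fix y z assume "y \<in> ball x d" "z \<in> ball x d"
      then have "dist y x < d" "dist z x < d" by (simp_all add: dist_commute)
      then have "dist (f y) (f x) < e / 2" "dist (f z) (f x) < e / 2" by (blast intro: d(2))+
      then show "\<bar>f y - f z\<bar> \<le> e" unfolding dist_real_def by linarith
    qed
    then show "x \<in> \<Union>\<G>" using d(1) by (meson UnionI centre_in_ball)
  qed
  moreover have "open S" if "S \<in> \<G>" for S using that unfolding \<G>_def by blast
  ultimately have "\<exists>r>0. \<forall>x\<in>K. \<exists>S\<in>\<G>. ball x r \<subseteq> S"
    using Heine_Borel_lemma[OF K(1), of \<G> "\<exists>r>0. \<forall>x\<in>K. \<exists>S\<in>\<G>. ball x r \<subseteq> S"] by blast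
  then obtain r where r: "r > 0" "\<And>x. x \<in> K \<Longrightarrow> \<exists>S\<in>\<G>. ball x r \<subseteq> S"
    by blast
  have "\<bar>f y - f x\<bar> \<le> e" if "x \<in> K" "dist x y < r" for x y
  proof -
    obtain S where S: "S \<in> \<G>" "ball x r \<subseteq> S" using r(2)[OF \<open>x \<in> K\<close>] by blast
    have "y \<in> S" "x \<in> S" using S(2) that(2) r(1) by (auto simp: subset_eq)
    then show ?thesis using S(1) unfolding \<G>_def by blast
  qed
  then show ?thesis using r(1) by blast
qed

context half_space_data
begin

text \<open>The contributions are M each for the direct and the mirror Gaussian and 4 M for the
  boundary kernel.\<close>

lemma dyn_sol_bounded:
  assumes k: "0 \<le> k" and s: "0 < s" and x: "0 \<le> snd x"
  shows "\<bar>dyn_sol 0 k s f x\<bar> \<le> 6 * M"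
proof -
  have t: "time_lag 0 k s x" by (rule time_lag_0[OF k s x])
  have "(\<integral>y. G0 x y s * f y \<partial>lborel) = (\<integral>y. Gamma (x - y) s * f y \<partial>lborel) - (\<integral>y. Gamma (refl x - y) s * f y \<partial>lborel)"
    unfolding G0_def Gamma_refl_eq left_diff_distrib
    by (intro Bochner_Integration.integral_diff integrable_Gamma_mult(1)[OF s f_meas f_le])
  moreover have "\<bar>\<integral>y. dyn_integral 0 k s x y * f y \<partial>lborel\<bar> \<le> M * 4"
    by (rule abs_integral_kernel_le[OF dyn_kernel_pair_measurable f_meas Omega_measurable f_bound M_nonneg _ dyn_kernel_total_le[OF t]]) simp
  ultimately show ?thesis
    unfolding dyn_sol_split[OF t]
    using integrable_Gamma_mult(2)[OF s f_meas f_le, of x] integrable_Gamma_mult(2)[OF s f_meas f_le, of "refl x"] by linarith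
qed

text \<open>With c = 2 s / x_N^2 the mirror part is at most M c and the boundary part at most 4 M c,
  since both reduce to the mass of a one-dimensional Gaussian beyond x_N.\<close>

lemma dyn_sol_interior:
  assumes k: "0 \<le> k" and s: "0 < s" and x: "0 < snd x"
  shows "\<bar>dyn_sol 0 k s f x - (\<integral>y. Gamma (x - y) s * f y \<partial>lborel)\<bar> \<le> 10 * M * s / (snd x)\<^sup>2"
proof -
  let ?c = "2 * s / (snd x)\<^sup>2"
  have c: "0 \<le> ?c" using s by simp
  have t: "time_lag 0 k s x" using x by (intro time_lag_0 k s) simp
  have "L1_total Omega (dyn_kernel 0 k s x) \<le> ennreal 4 * ennreal ?c"
    by (rule order_trans[OF time_lag.dyn_kernel_total[OF t] mult_left_mono[OF nn_integral_Gamma_ray_le[OF s x]]]) simp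
  also have "\<dots> = ennreal (4 * ?c)" using c by (intro ennreal_mult[symmetric]) simp_all
  finally have H: "\<bar>\<integral>y. dyn_integral 0 k s x y * f y \<partial>lborel\<bar> \<le> M * (4 * ?c)"
    using c by (intro abs_integral_kernel_le[OF dyn_kernel_pair_measurable f_meas Omega_measurable f_bound M_nonneg]) simp_all
  have I: "integrable lborel (\<lambda>y. Gamma (x - refl y) s * f y)"
    unfolding Gamma_refl_eq by (rule integrable_Gamma_mult(1)[OF s f_meas f_le])
  have "(\<integral>\<^sup>+y. ennreal (norm (Gamma (x - refl y) s * f y)) \<partial>lborel)
     \<le> (\<integral>\<^sup>+y. ennreal (Gamma (fst x - fst y) s) * (ennreal M * (ennreal (Gamma (snd x + snd y) s) * indicator {0<..} (snd y))) \<partial>(lborel :: 'n pt measure))"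
  proof (rule nn_integral_mono)
    fix y :: "'n pt"
    show "ennreal (norm (Gamma (x - refl y) s * f y)) \<le> ennreal (Gamma (fst x - fst y) s) * (ennreal M * (ennreal (Gamma (snd x + snd y) s) * indicator {0<..} (snd y)))"
    proof (cases "0 < snd y")
      case True
      have "Gamma (x - refl y) s = Gamma (fst x - fst y) s * Gamma (snd x + snd y) s"
        unfolding Gamma_prod[OF s] by (simp add: refl_def)
      then have "norm (Gamma (x - refl y) s * f y) \<le> (Gamma (fst x - fst y) s * Gamma (snd x + snd y) s) * M"
        using f_le[of y] by (simp add: abs_mult mult_left_mono)
      also have "\<dots> = Gamma (fst x - fst y) s * (M * Gamma (snd x + snd y) s)" by simp
      finally show ?thesis using True M_nonneg by (simp add: ennreal_mult[symmetric] ennreal_leI)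
    qed (simp add: f_outside)
  qed
  also have "\<dots> = (\<integral>\<^sup>+y. ennreal (Gamma (fst x - y) s) \<partial>lborel) * (\<integral>\<^sup>+y. ennreal M * (ennreal (Gamma (snd x + y) s) * indicator {0<..} y) \<partial>lborel)"
    by (rule nn_integral_pt_product) measurable
  also have "\<dots> = ennreal M * (\<integral>\<^sup>+y. ennreal (Gamma (snd x + y) s) * indicator {0<..} y \<partial>lborel)"
    using nn_integral_lborel_reflect[of "\<lambda>y. ennreal (Gamma y s)" "fst x"] s
    by (simp add: nn_integral_Gamma nn_integral_cmult)
  also have "\<dots> \<le> ennreal M * ennreal ?c" by (intro mult_left_mono nn_integral_Gamma_ray_le s x) simp
  also have "\<dots> = ennreal (M * ?c)" using c M_nonneg by (intro ennreal_mult[symmetric])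
  finally have "ennreal (norm (\<integral>y. Gamma (x - refl y) s * f y \<partial>lborel)) \<le> ennreal (M * ?c)"
    by (rule order_trans[OF integral_norm_bound_ennreal[OF I]])
  then have "norm (\<integral>y. Gamma (x - refl y) s * f y \<partial>lborel) \<le> M * ?c"
    unfolding ennreal_le_iff[OF mult_nonneg_nonneg[OF M_nonneg c]] .
  moreover have "(\<integral>y. G0 x y s * f y \<partial>lborel) = (\<integral>y. Gamma (x - y) s * f y \<partial>lborel) - (\<integral>y. Gamma (x - refl y) s * f y \<partial>lborel)"
    unfolding G0_def left_diff_distrib
    by (intro Bochner_Integration.integral_diff I integrable_Gamma_mult(1)[OF s f_meas f_le])
  ultimately have "\<bar>dyn_sol 0 k s f x - (\<integral>y. Gamma (x - y) s * f y \<partial>lborel)\<bar> \<le> M * ?c + M * (4 * ?c)"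
    unfolding dyn_sol_split[OF t] using H by simp
  also have "\<dots> = 10 * M * s / (snd x)\<^sup>2" by simp
  finally show ?thesis .
qed

text \<open>Since only s = t/\<epsilon> matters, this serves both t -> 0 at fixed \<epsilon> and
  \<epsilon> -> infinity on bounded time intervals. It is uniform in k >= 0, so that z^N is
  included.\<close>

lemma dyn_sol_initial:
  assumes K: "compact K" "K \<subseteq> Omega" and f: "continuous_on Omega f" and e: "0 < e"
  shows "\<exists>s0>0. \<forall>k\<ge>0. \<forall>x\<in>K. \<forall>s. 0 < s \<and> s < s0 \<longrightarrow> \<bar>dyn_sol 0 k s f x - f x\<bar> \<le> e"
proof (cases "K = {}")
  case True
  then show ?thesis by (intro exI[of _ 1]) simp
next
  case False
  obtain r where r: "0 < r" "\<And>x y. x \<in> K \<Longrightarrow> dist x y < r \<Longrightarrow> \<bar>f y - f x\<bar> \<le> e / 2"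
    using uniformly_continuous_near_compact[OF K open_Omega f, of "e / 2"] e by auto
  have "compact (snd ` K)" by (intro compact_continuous_image continuous_intros K)
  then obtain m where m: "m \<in> snd ` K" "\<And>y. y \<in> snd ` K \<Longrightarrow> m \<le> y"
    using compact_attains_inf[of "snd ` K"] False by auto
  have m0: "0 < m" using m(1) K(2) by auto
  \<comment> \<open>The total coefficient of s in the two error terms; the later division by D + 1
    avoids a zero denominator.\<close>
  define D where "D = 2 * M / r\<^sup>2 * (8 * 2 powr (real DIM('n pt) / 2)) + 10 * M / m\<^sup>2"
  have D: "0 \<le> D" using M_nonneg by (simp add: D_def)
  have "\<bar>dyn_sol 0 k s f x - f x\<bar> \<le> e" if k: "0 \<le> k" and x: "x \<in> K" and s: "0 < s" "s < e / 2 / (D + 1)" for k x s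
  proof -
    have xm: "m \<le> snd x" using m(2) x by simp
    have "\<bar>dyn_sol 0 k s f x - (\<integral>y. Gamma (x - y) s * f y \<partial>lborel)\<bar> \<le> 10 * M * s / (snd x)\<^sup>2"
      using xm m0 by (intro dyn_sol_interior k s) simp
    also have "\<dots> \<le> 10 * M * s / m\<^sup>2"
      using xm m0 M_nonneg s by (intro divide_left_mono power_mono mult_nonneg_nonneg mult_pos_pos) simp_all
    finally have 1: "\<bar>dyn_sol 0 k s f x - (\<integral>y. Gamma (x - y) s * f y \<partial>lborel)\<bar> \<le> 10 * M * s / m\<^sup>2" .
    have 2: "\<bar>(\<integral>y. Gamma (x - y) s * f y \<partial>lborel) - f x\<bar> \<le> e / 2 + 2 * M / r\<^sup>2 * ((8 * 2 powr (real DIM('n pt) / 2)) * s)"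
      using r x e by (intro Gamma_average_close[OF s(1) f_meas f_le]) simp_all
    have "10 * M * s / m\<^sup>2 + 2 * M / r\<^sup>2 * ((8 * 2 powr (real DIM('n pt) / 2)) * s) = D * s"
      by (simp add: D_def distrib_right)
    moreover have "D * s \<le> (D + 1) * s" using s by simp
    moreover have "(D + 1) * s \<le> e / 2" using s D by (simp add: field_simps)
    ultimately show ?thesis using 1 2 by linarith
  qed
  moreover have "0 < e / 2 / (D + 1)" using e D by simp
  ultimately show ?thesis by blast
qed

end

section \<open>The classical solution up to the boundary and up to time zero\<close>

lemma has_pdI:
  assumes "((\<lambda>h. F (x + h *\<^sub>R v)) has_real_derivative D) (at 0)" "x \<in> S" "\<And>y. y \<in> S \<Longrightarrow> f y = F y"
  shows "has_pd f S v x D"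
  unfolding has_pd_def
  \<comment> \<open>A two-sided derivative of the extension \<open>F\<close> restricts to the
    derivative within \<open>S\<close>; the values of \<open>f\<close> outside \<open>S\<close> do
    not enter.\<close>
  by (rule has_field_derivative_transform_within[OF has_field_derivative_at_within[OF assms(1)] zero_less_one])
     (use assms in auto)

context dynamic_data
begin

lemma continuous_on_sol_scaled:
  assumes "gauss_kernel K" "gauss_kernel L" "0 < \<epsilon>" "S \<subseteq> UNIV \<times> {0<..}"
  shows "continuous_on S (\<lambda>(x, t). sol K L x (t / \<epsilon>))"
proof -
  have c: "continuous_on (UNIV \<times> {0<..}) (\<lambda>p. sol K L (fst p) (snd p))"
    using continuous_on_sol[OF assms(1,2)] by (simp add: case_prod_beta)
  have "continuous_on S (\<lambda>p. (fst p, snd p / \<epsilon>))" using assms(3) by (intro continuous_intros) auto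
  then show ?thesis unfolding case_prod_beta
    using continuous_on_compose2[OF c, of S "\<lambda>p. (fst p, snd p / \<epsilon>)"] assms(3,4) by fastforce
qed

lemma classical_sol:
  fixes \<phi> :: "'n pt \<Rightarrow> real"
  assumes \<epsilon>: "0 < \<epsilon>" and f: "continuous_on Omega f" and \<phi>: "\<And>x. x \<in> Omega \<Longrightarrow> \<phi> x = f x"
    and z: "\<And>x t. 0 < t \<Longrightarrow> z x t = dyn_sol 0 k (t / \<epsilon>) f x"
  shows "classical_sol_HDN \<epsilon> k \<phi> (\<lambda>x t. if t = 0 then \<phi> x else z x t)"
proof -
  let ?u = "\<lambda>x t. if t = 0 then \<phi> x else z x t"
  define e :: "'n pt" where "e = (0, 1)"
  define U where "U = (\<lambda>x t. sol Gamma (Gamma_D1 e) x (t / \<epsilon>))"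
  define D1 where "D1 = (\<lambda>b x t. sol (Gamma_D1 b) (Gamma_D2 e b) x (t / \<epsilon>))"
  define D2 where "D2 = (\<lambda>b c x t. sol (Gamma_D2 b c) (Gamma_D3 e b c) x (t / \<epsilon>))"
  define Dt where "Dt = (\<lambda>x t. (\<Sum>b\<in>Basis. D2 b b x t) / \<epsilon>)"
  note gk = gauss_kernel_Gamma gauss_kernel_Gamma_D1 gauss_kernel_Gamma_D2 gauss_kernel_Gamma_D3
  have u: "?u x t = U x t" if "0 < t" "0 \<le> snd x" for x t
    using that \<epsilon> by (simp add: U_def e_def z dyn_sol_eq_sol)
  have clo: "0 \<le> snd x" if "x \<in> closure Omega" for x :: "'n pt" using closure_Omega_nonneg[OF that] .
  have pd1: "has_pd (\<lambda>y. ?u y t) (closure Omega) b x (D1 b x t)" if "x \<in> closure Omega" "0 < t" for b x t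
  proof (rule has_pdI[where F = "\<lambda>y. U y t"])
    show "((\<lambda>h. U (x + h *\<^sub>R b) t) has_real_derivative D1 b x t) (at 0)"
      unfolding U_def D1_def using that \<epsilon>
      by (intro sol_directional_derivative gk DERIV_Gamma DERIV_Gamma_D1) simp_all
  qed (use that u clo in auto)
  have pd2: "has_pd (\<lambda>y. D1 b y t) (closure Omega) c x (D2 b c x t)" if "x \<in> closure Omega" "0 < t" for b c x t
  proof (rule has_pdI[where F = "\<lambda>y. D1 b y t"])
    show "((\<lambda>h. D1 b (x + h *\<^sub>R c) t) has_real_derivative D2 b c x t) (at 0)"
      unfolding D1_def D2_def using that \<epsilon>
      by (intro sol_directional_derivative gk DERIV_Gamma_D1 DERIV_Gamma_D2) simp_all
  qed (use that in auto)
  have cU: "continuous_on S (\<lambda>(x, t). U x t)" if "S \<subseteq> UNIV \<times> {0<..}" for S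
    unfolding U_def by (intro continuous_on_sol_scaled gk \<epsilon> that)
  have c0: "continuous_on (closure Omega \<times> {0<..}) (\<lambda>(x, t). ?u x t)"
    by (rule continuous_on_eq[OF cU]) (use u clo in auto)
  have c1: "continuous_on (closure Omega \<times> {0<..}) (\<lambda>(x, t). D1 b x t)" for b
    unfolding D1_def by (intro continuous_on_sol_scaled gk \<epsilon>) auto
  have c2: "continuous_on S (\<lambda>(x, t). D2 b c x t)" if "S \<subseteq> UNIV \<times> {0<..}" for b c S
    unfolding D2_def by (intro continuous_on_sol_scaled gk \<epsilon> that)
  have ct: "continuous_on (Omega \<times> {0<..}) (\<lambda>(x, t). Dt x t)"
  proof -
    have "continuous_on (Omega \<times> {0<..}) (\<lambda>p. (\<Sum>b\<in>Basis. D2 b b (fst p) (snd p)) / \<epsilon>)"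
      using \<epsilon> by (intro continuous_on_divide continuous_on_sum continuous_on_const c2[unfolded case_prod_beta]) auto
    then show ?thesis by (simp add: Dt_def case_prod_beta)
  qed
  have dt: "((\<lambda>s. ?u x s) has_real_derivative Dt x t) (at t)" if x: "x \<in> Omega" and t: "0 < t" for x t
  proof -
    have "((\<lambda>s. sol Gamma (Gamma_D1 e) x s) has_real_derivative (\<Sum>b\<in>Basis. D2 b b x t)) (at (t / \<epsilon>))"
      unfolding D2_def e_def using t \<epsilon> by (intro sol_heat_equation) simp
    from DERIV_chain2[where g = "\<lambda>t. t / \<epsilon>", OF this DERIV_cdivide[OF DERIV_ident]]
    have "((\<lambda>t. U x t) has_real_derivative Dt x t) (at t)"
      by (simp add: U_def Dt_def)
    then show ?thesis
      by (rule has_field_derivative_transform_within_open[where S = "{0<..}"]) (use x t u in auto)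
  qed
  have init: "continuous_on (Omega \<times> {0..}) (\<lambda>(x, t). ?u x t)"
    unfolding continuous_on_eq_continuous_within
  proof
    fix p :: "'n pt \<times> real" assume p: "p \<in> Omega \<times> {0..}"
    obtain x t where xt: "p = (x, t)" by (metis surj_pair)
    show "continuous (at p within Omega \<times> {0..}) (\<lambda>(x, t). ?u x t)"
    proof (cases "t = 0")
      case False
      have op: "open ((Omega :: 'n pt set) \<times> {0::real<..})" by (intro open_Times open_Omega open_greaterThan)
      have "continuous_on (Omega \<times> {0<..}) (\<lambda>(x, t). ?u x t)"
        by (rule continuous_on_subset[OF c0]) (use closure_subset in auto)
      moreover have "p \<in> Omega \<times> {0<..}" using p False xt by auto
      ultimately have "continuous (at p) (\<lambda>(x, t). ?u x t)"
        using continuous_on_eq_continuous_at[OF op] by blast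
      then show ?thesis by (rule continuous_at_imp_continuous_at_within)
    next
      case True
      have x: "x \<in> Omega" using p xt by simp
      show ?thesis
        unfolding continuous_within_eps_delta
      proof (intro allI impI)
        fix r :: real assume r: "0 < r"
        \<comment> \<open>The closed ball of radius d1 is the compact set on which the initial
          estimate is uniform, d2 controls the oscillation of \<open>f\<close>, and s0 * \<epsilon>
          translates the bound on s = t/\<epsilon> back to t. Each error is r/4, so their sum stays
          strictly below r.\<close>
        obtain d1 where d1: "0 < d1" "cball x d1 \<subseteq> Omega" using open_Omega x open_contains_cball by metis
        obtain d2 where d2: "0 < d2" "\<And>y. dist x y < d2 \<Longrightarrow> \<bar>f y - f x\<bar> \<le> r / 4"
          using uniformly_continuous_near_compact[of "{x}" Omega f "r / 4"] x r f open_Omega by auto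
        obtain s0 where s0: "0 < s0" "\<And>y s. y \<in> cball x d1 \<Longrightarrow> 0 < s \<Longrightarrow> s < s0 \<Longrightarrow> \<bar>dyn_sol 0 k s f y - f y\<bar> \<le> r / 4"
          using dyn_sol_initial[OF compact_cball d1(2) f, of "r / 4"] r k by (auto dest: less_imp_le)
        define d where "d = min d1 (min d2 (s0 * \<epsilon>))"
        have d: "0 < d" using d1 d2 s0 \<epsilon> by (simp add: d_def)
        have "dist (case q of (x, t) \<Rightarrow> ?u x t) (case p of (x, t) \<Rightarrow> ?u x t) < r"
          if q: "q \<in> Omega \<times> {0..}" and qd: "dist q p < d" for q
        proof -
          obtain y t' where yt: "q = (y, t')" by (metis surj_pair)
          have y: "y \<in> Omega" "0 \<le> t'" using q yt by auto
          have "dist y x \<le> dist q p" "dist t' t \<le> dist q p"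
            using dist_fst_le[of q p] dist_snd_le[of q p] by (simp_all add: yt xt)
          then have "dist y x < d" "dist t' t < d" using qd by auto
          then have dd: "dist x y < d1" "dist x y < d2" "t' < s0 * \<epsilon>"
            using True y by (auto simp: d_def dist_commute dist_real_def)
          have fy: "\<bar>f y - f x\<bar> \<le> r / 4" by (rule d2(2)[OF dd(2)])
          have "\<bar>?u y t' - f y\<bar> \<le> r / 4"
          proof (cases "t' = 0")
            case True
            then show ?thesis using r y \<phi> by simp
          next
            case False
            then have t': "0 < t'" using y by simp
            have "\<bar>dyn_sol 0 k (t' / \<epsilon>) f y - f y\<bar> \<le> r / 4"
              using dd t' \<epsilon> by (intro s0(2)) (simp_all add: divide_less_eq)
            then show ?thesis using z[OF t', of y] False by simp
          qed
          then have "\<bar>?u y t' - f x\<bar> < r" using fy r by linarith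
          then show ?thesis using \<phi>[OF x] True by (simp add: yt xt dist_real_def)
        qed
        then show "\<exists>d>0. \<forall>q\<in>Omega \<times> {0..}. dist q p < d \<longrightarrow> dist (case q of (x, t) \<Rightarrow> ?u x t) (case p of (x, t) \<Rightarrow> ?u x t) < r"
          using d by blast
      qed
    qed
  qed
  have heat: "\<epsilon> * Dt x t - (\<Sum>b\<in>Basis. D2 b b x t) = 0" for x t
    using \<epsilon> by (simp add: Dt_def)
  have bc: "- k * (\<Sum>i\<in>(Basis :: (real^'n) set). D2 (i, 0) (i, 0) x t) - D1 (0, 1) x t = 0" if "x \<in> frontier Omega" "0 < t" for x t
    unfolding D1_def D2_def e_def using that \<epsilon> frontier_Omega_zero[of x] by (intro sol_boundary_condition) simp_all
  show ?thesis
    unfolding classical_sol_HDN_def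
    apply (rule exI[of _ D1], rule exI[of _ D2], rule exI[of _ Dt])
    apply (intro conjI ballI allI impI)
    subgoal by (rule pd1)
    subgoal by (rule pd2)
    subgoal by (rule c0)
    subgoal by (rule c1)
    subgoal by (rule c2) auto
    subgoal by (rule dt)
    subgoal by (rule ct)
    subgoal by (rule init)
    subgoal by (rule heat)
    subgoal by (rule bc)
    subgoal by simp
    done
qed

end

section \<open>From essentially bounded data to the four assertions\<close>

lemma bounded_representative:
  fixes \<phi> :: "('n::finite) pt \<Rightarrow> real"
  assumes meas: "set_borel_measurable lborel Omega \<phi>" and bd: "AE y in lborel. y \<in> Omega \<longrightarrow> \<bar>\<phi> y\<bar> \<le> M" and M: "0 \<le> M"
  obtains f where "half_space_data f M" "AE y in lborel. indicator Omega y * \<phi> y = f y"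
    "\<forall>y\<in>Omega. \<bar>\<phi> y\<bar> \<le> M \<longrightarrow> f y = \<phi> y"
proof -
  \<comment> \<open>Truncation changes \<phi> only on the null set where the essential bound fails,
    and not at all where the bound holds; so continuity survives for data bounded
    everywhere.\<close>
  define f where "f = (\<lambda>y. max (- M) (min M (indicator Omega y * \<phi> y)))"
  have [measurable]: "(\<lambda>y. indicator Omega y * \<phi> y) \<in> borel_measurable borel"
    using meas by (simp add: set_borel_measurable_def)
  have "half_space_data f M"
  proof
    show "f \<in> borel_measurable borel" unfolding f_def by measurable
    show "\<bar>f y\<bar> \<le> M * indicator Omega y" for y using M by (cases "y \<in> Omega") (auto simp: f_def)
  qed (rule M)
  moreover have "AE y in lborel. indicator Omega y * \<phi> y = f y"
    using bd by eventually_elim (use M in \<open>auto simp: f_def indicator_def abs_le_iff\<close>)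
  moreover have "\<forall>y\<in>Omega. \<bar>\<phi> y\<bar> \<le> M \<longrightarrow> f y = \<phi> y"
    by (auto simp: f_def abs_le_iff)
  ultimately show ?thesis by (rule that)
qed

lemma bounded_representative_boundary:
  fixes \<psi> :: "'a::euclidean_space \<Rightarrow> real"
  assumes [measurable]: "\<psi> \<in> borel_measurable borel" and bd: "AE y in lborel. \<bar>\<psi> y\<bar> \<le> L" and L: "0 \<le> L"
  obtains g where "g \<in> borel_measurable borel" "\<forall>y. \<bar>g y\<bar> \<le> L" "AE y in lborel. \<psi> y = g y"
proof (rule that[of "\<lambda>y. max (- L) (min L (\<psi> y))"])
  show "(\<lambda>y. max (- L) (min L (\<psi> y))) \<in> borel_measurable borel" by measurable
  show "\<forall>y. \<bar>max (- L) (min L (\<psi> y))\<bar> \<le> L" using L by auto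
  show "AE y in lborel. \<psi> y = max (- L) (min L (\<psi> y))" using bd by eventually_elim (auto simp: abs_le_iff)
qed

theorem theorem5p1:
  fixes \<phi> :: "('n::finite) pt \<Rightarrow> real" and \<psi> :: "real^'n \<Rightarrow> real"
  assumes phi_meas: "set_borel_measurable lborel Omega \<phi>"
    and phi_bdd: "\<exists>M. AE y in lborel. y \<in> Omega \<longrightarrow> \<bar>\<phi> y\<bar> \<le> M"
    and psi_meas: "\<psi> \<in> borel_measurable lborel"
    and psi_bdd: "\<exists>M. AE y in lborel. \<bar>\<psi> y\<bar> \<le> M"
  shows
    "(\<forall>\<epsilon>>0. \<forall>k>0. \<forall>R>0.
        (\<exists>C \<delta>0. \<delta>0 > 0 \<and> (\<forall>\<delta>. 0 < \<delta> \<and> \<delta> < \<delta>0 \<longrightarrow>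
            (\<forall>(x, t)\<in>Q R. \<bar>usol \<epsilon> \<delta> k \<phi> \<psi> x t - zk \<epsilon> k \<phi> x t\<bar> \<le> C * \<delta>))) \<and>
        (\<exists>C \<delta>0. \<delta>0 > 0 \<and> (\<forall>\<delta>. 0 < \<delta> \<and> \<delta> < \<delta>0 \<longrightarrow>
            (\<forall>(x, t)\<in>Q R. \<bar>usol \<epsilon> \<delta> 0 \<phi> \<psi> x t - zN \<epsilon> \<phi> x t\<bar> \<le> C * \<delta>))))
   \<and> ((continuous_on Omega \<phi> \<and> bounded (\<phi> ` Omega)) \<longrightarrow>
        (\<forall>\<epsilon>>0. \<forall>k>0.
           classical_sol_HDN \<epsilon> k \<phi> (\<lambda>x t. if t = 0 then \<phi> x else zk \<epsilon> k \<phi> x t) \<and>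
           bounded_sol (\<lambda>x t. if t = 0 then \<phi> x else zk \<epsilon> k \<phi> x t)))
   \<and> (\<forall>\<epsilon>>0. \<forall>R>0.
        \<exists>C k0. k0 > 0 \<and> (\<forall>k. 0 < k \<and> k < k0 \<longrightarrow>
            (\<forall>(x, t)\<in>Q R. \<bar>zk \<epsilon> k \<phi> x t - zN \<epsilon> \<phi> x t\<bar> \<le> C * k)))
   \<and> ((continuous_on Omega \<phi> \<and> bounded (\<phi> ` Omega)) \<longrightarrow>
        (\<forall>k>0. \<forall>T>0. \<forall>K. compact K \<and> K \<subseteq> Omega \<longrightarrow>
           (\<forall>e>0. (\<forall>\<^sub>F \<epsilon> in at_top. \<forall>x\<in>K. \<forall>t\<in>{0<..<T}. \<bar>zk \<epsilon> k \<phi> x t - \<phi> x\<bar> \<le> e)) \<and>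
           (\<forall>e>0. (\<forall>\<^sub>F \<epsilon> in at_top. \<forall>x\<in>K. \<forall>t\<in>{0<..<T}. \<bar>zN \<epsilon> \<phi> x t - \<phi> x\<bar> \<le> e))))"
proof -
  obtain M' where "AE y in lborel. y \<in> Omega \<longrightarrow> \<bar>\<phi> y\<bar> \<le> M'" using phi_bdd by blast
  then have "AE y in lborel. y \<in> Omega \<longrightarrow> \<bar>\<phi> y\<bar> \<le> \<bar>M'\<bar>" by eventually_elim auto
  from bounded_representative[OF phi_meas this abs_ge_zero] obtain f
    where f: "half_space_data f \<bar>M'\<bar>" "AE y in lborel. indicator Omega y * \<phi> y = f y" .
  obtain L' where "AE y in lborel. \<bar>\<psi> y\<bar> \<le> L'" using psi_bdd by blast
  then have "AE y in lborel. \<bar>\<psi> y\<bar> \<le> \<bar>L'\<bar>" by eventually_elim auto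
  from bounded_representative_boundary[OF psi_meas[unfolded measurable_lborel2] this abs_ge_zero] obtain g
    where g: "g \<in> borel_measurable borel" "\<forall>y. \<bar>g y\<bar> \<le> \<bar>L'\<bar>" "AE y in lborel. \<psi> y = g y" .
  note g' = g(1) g(2)[rule_format] g(3)
  interpret F: half_space_data f "\<bar>M'\<bar>" by (rule f(1))
  have zk: "zk \<epsilon> k \<phi> x t = dyn_sol 0 k (t / \<epsilon>) f x" if "0 < t" "0 < \<epsilon>" for \<epsilon> k x t
    by (rule F.zk_eq_dyn_sol[OF phi_meas f(2) that])
  have zN: "zN \<epsilon> \<phi> x t = dyn_sol 0 0 (t / \<epsilon>) f x" if "0 < t" "0 < \<epsilon>" "0 \<le> snd x" for \<epsilon> x t
    by (rule F.zN_eq_dyn_sol[OF phi_meas f(2) that])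
  have QD: "0 \<le> snd x \<and> 0 < t \<and> R < snd x + t" if "(x, t) \<in> Q R" for x :: "'n pt" and t R
    using that closure_Omega_nonneg[of x] by (simp add: Q_def)
  \<comment> \<open>Stated for an abstract \<open>z\<close> so as to apply to z_k with \<kappa> = k
    and to z^N with \<kappa> = 0.\<close>
  have rate: "\<exists>C \<delta>0. \<delta>0 > 0 \<and> (\<forall>\<delta>. 0 < \<delta> \<and> \<delta> < \<delta>0 \<longrightarrow> (\<forall>(x, t)\<in>Q R. \<bar>usol \<epsilon> \<delta> \<kappa> \<phi> \<psi> x t - z x t\<bar> \<le> C * \<delta>))"
    if \<epsilon>: "0 < \<epsilon>" and \<kappa>: "0 \<le> \<kappa>" and R: "0 < R"
      and z: "\<And>x t. 0 < t \<Longrightarrow> 0 \<le> snd x \<Longrightarrow> z x t = dyn_sol 0 \<kappa> (t / \<epsilon>) f x" for \<epsilon> \<kappa> R z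
    using F.usol_rate[OF phi_meas f(2) psi_meas g' \<epsilon> \<kappa> R]
  proof (elim exE conjE)
    fix C \<delta>0 assume "\<delta>0 > 0" and *: "\<forall>\<delta>. 0 < \<delta> \<and> \<delta> < \<delta>0 \<longrightarrow> (\<forall>x t. 0 \<le> snd x \<and> 0 < t \<and> R < snd x + t \<longrightarrow>
        \<bar>usol \<epsilon> \<delta> \<kappa> \<phi> \<psi> x t - dyn_sol 0 \<kappa> (t / \<epsilon>) f x\<bar> \<le> C * \<delta>)"
    show ?thesis
    proof (intro exI conjI allI impI ballI)
      show "\<delta>0 > 0" by fact
      fix \<delta> and p :: "'n pt \<times> real" assume \<delta>: "0 < \<delta> \<and> \<delta> < \<delta>0" and p: "p \<in> Q R"
      obtain x t where [simp]: "p = (x, t)" by (metis surj_pair)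
      show "case p of (x, t) \<Rightarrow> \<bar>usol \<epsilon> \<delta> \<kappa> \<phi> \<psi> x t - z x t\<bar> \<le> C * \<delta>"
        using *[rule_format, OF \<delta> QD[of x t R]] p QD[of x t R] by (simp add: z)
    qed
  qed
  have part3: "\<exists>C k0. k0 > 0 \<and> (\<forall>k. 0 < k \<and> k < k0 \<longrightarrow> (\<forall>(x, t)\<in>Q R. \<bar>zk \<epsilon> k \<phi> x t - zN \<epsilon> \<phi> x t\<bar> \<le> C * k))"
    if \<epsilon>: "0 < \<epsilon>" and R: "0 < R" for \<epsilon> R
  proof -
    obtain C where C: "\<And>k x t. 0 \<le> k \<Longrightarrow> 0 \<le> snd x \<and> 0 < t \<and> R < snd x + t \<Longrightarrow>
        \<bar>dyn_sol 0 k (t / \<epsilon>) f x - dyn_sol 0 0 (t / \<epsilon>) f x\<bar> \<le> C * k"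
      using F.diffusion_rate[OF \<epsilon> R] by blast
    show ?thesis
    proof (intro exI conjI allI impI ballI)
      \<comment> \<open>The estimate holds for all k >= 0, so any positive threshold would
        do.\<close>
      show "0 < (1::real)" by simp
      fix k :: real and p :: "'n pt \<times> real" assume k: "0 < k \<and> k < 1" and p: "p \<in> Q R"
      obtain x t where [simp]: "p = (x, t)" by (metis surj_pair)
      show "case p of (x, t) \<Rightarrow> \<bar>zk \<epsilon> k \<phi> x t - zN \<epsilon> \<phi> x t\<bar> \<le> C * k"
        using C[of k x t] k p QD[of x t R] \<epsilon> by (simp add: zk zN)
    qed
  qed
  \<comment> \<open>A new representative is taken with the supremum bound of \<phi> in place of the
    essential one: then it equals \<phi> at every point of \<open>Omega\<close>, as pointwise
    initial values demand.\<close>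
  have BC: "\<exists>f M. half_space_data f M \<and> (AE y in lborel. indicator Omega y * \<phi> y = f y) \<and> (\<forall>y\<in>Omega. \<phi> y = f y) \<and> continuous_on Omega f"
    if cont: "continuous_on Omega \<phi>" and bdd: "bounded (\<phi> ` Omega)"
  proof -
    obtain B where B: "\<forall>y\<in>Omega. \<bar>\<phi> y\<bar> \<le> B" using bdd unfolding bounded_iff by (auto simp del: mem_Omega)
    have B': "\<bar>\<phi> y\<bar> \<le> \<bar>B\<bar>" if "y \<in> Omega" for y using bspec[OF B that] by linarith
    have "AE y in lborel. y \<in> Omega \<longrightarrow> \<bar>\<phi> y\<bar> \<le> \<bar>B\<bar>" using B' by (intro AE_I2) blast
    from bounded_representative[OF phi_meas this abs_ge_zero] obtain f where f: "half_space_data f \<bar>B\<bar>"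
      "AE y in lborel. indicator Omega y * \<phi> y = f y" "\<forall>y\<in>Omega. \<bar>\<phi> y\<bar> \<le> \<bar>B\<bar> \<longrightarrow> f y = \<phi> y" .
    have eq: "\<phi> y = f y" if "y \<in> Omega" for y using f(3) B'[OF that] that by simp
    have "continuous_on Omega f" using continuous_on_eq[OF cont] eq by blast
    then show ?thesis using f(1,2) eq by blast
  qed
  have part2: "classical_sol_HDN \<epsilon> k \<phi> (\<lambda>x t. if t = 0 then \<phi> x else zk \<epsilon> k \<phi> x t) \<and>
           bounded_sol (\<lambda>x t. if t = 0 then \<phi> x else zk \<epsilon> k \<phi> x t)"
    if c: "continuous_on Omega \<phi>" "bounded (\<phi> ` Omega)" and \<epsilon>: "0 < \<epsilon>" and k: "0 < k" for \<epsilon> k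
  proof -
    obtain f M where fM: "half_space_data f M" and ae: "AE y in lborel. indicator Omega y * \<phi> y = f y"
      and eq: "\<And>y. y \<in> Omega \<Longrightarrow> \<phi> y = f y" and cf: "continuous_on Omega f" using BC[OF c] by blast
    interpret D: dynamic_data f M k using fM k by (simp add: dynamic_data_def dynamic_data_axioms_def)
    have z: "zk \<epsilon> k \<phi> x t = dyn_sol 0 k (t / \<epsilon>) f x" if "0 < t" for x t
      by (rule D.zk_eq_dyn_sol[OF phi_meas ae that \<epsilon>])
    have "bounded_sol (\<lambda>x t. if t = 0 then \<phi> x else zk \<epsilon> k \<phi> x t)"
      unfolding bounded_sol_def
    proof (intro exI[of _ "6 * M"] ballI allI impI)
      fix x :: "'n pt" and t :: real assume x: "x \<in> closure Omega" and t: "0 \<le> t" "t = 0 \<longrightarrow> x \<in> Omega"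
      show "\<bar>if t = 0 then \<phi> x else zk \<epsilon> k \<phi> x t\<bar> \<le> 6 * M"
      proof (cases "t = 0")
        case True
        then show ?thesis using D.f_le[of x] D.M_nonneg t eq by simp
      next
        case False
        then show ?thesis
          using D.dyn_sol_bounded[of k "t / \<epsilon>" x] t k \<epsilon> closure_Omega_nonneg[OF x] z by simp
      qed
    qed
    then show ?thesis using D.classical_sol[OF \<epsilon> cf eq z] by blast
  qed
  have part4: "(\<forall>e>0. (\<forall>\<^sub>F \<epsilon> in at_top. \<forall>x\<in>K. \<forall>t\<in>{0<..<T}. \<bar>zk \<epsilon> k \<phi> x t - \<phi> x\<bar> \<le> e)) \<and>
           (\<forall>e>0. (\<forall>\<^sub>F \<epsilon> in at_top. \<forall>x\<in>K. \<forall>t\<in>{0<..<T}. \<bar>zN \<epsilon> \<phi> x t - \<phi> x\<bar> \<le> e))"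
    if c: "continuous_on Omega \<phi>" "bounded (\<phi> ` Omega)" and k: "0 < k" and T: "0 < T" and K: "compact K" "K \<subseteq> Omega" for k T K
  proof -
    obtain f M where fM: "half_space_data f M" and ae: "AE y in lborel. indicator Omega y * \<phi> y = f y"
      and eq: "\<And>y. y \<in> Omega \<Longrightarrow> \<phi> y = f y" and cf: "continuous_on Omega f" using BC[OF c] by blast
    interpret D: half_space_data f M by (rule fM)
    \<comment> \<open>The threshold is \<epsilon> > T/s0, which gives t/\<epsilon> < s0 for all t <
      T. Positivity of \<epsilon> is carried along because the passage from z_k and z^N to
      \<open>dyn_sol\<close> requires it.\<close>
    have ev: "\<forall>\<^sub>F \<epsilon> in at_top. 0 < \<epsilon> \<and> (\<forall>k\<ge>0. \<forall>x\<in>K. \<forall>t\<in>{0<..<T}. \<bar>dyn_sol 0 k (t / \<epsilon>) f x - f x\<bar> \<le> e)" if e: "0 < e" for e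
    proof -
      obtain s0 where s0: "0 < s0" "\<forall>k\<ge>0. \<forall>x\<in>K. \<forall>s. 0 < s \<and> s < s0 \<longrightarrow> \<bar>dyn_sol 0 k s f x - f x\<bar> \<le> e"
        using D.dyn_sol_initial[OF K cf e] by blast
      have "\<forall>\<^sub>F \<epsilon> in at_top. T / s0 < \<epsilon>" by (rule eventually_gt_at_top)
      then show ?thesis
      proof eventually_elim
        fix \<epsilon> assume "T / s0 < \<epsilon>"
        then have T': "T < \<epsilon> * s0" using s0(1) by (simp add: divide_less_eq)
        have "0 < T / s0" using s0(1) T by (rule divide_pos_pos[rotated])
        then have \<epsilon>: "0 < \<epsilon>" using \<open>T / s0 < \<epsilon>\<close> by linarith
        have "0 < t / \<epsilon> \<and> t / \<epsilon> < s0" if "t \<in> {0<..<T}" for t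
          using that T' \<epsilon> by (auto simp: divide_less_eq mult.commute)
        then show "0 < \<epsilon> \<and> (\<forall>k\<ge>0. \<forall>x\<in>K. \<forall>t\<in>{0<..<T}. \<bar>dyn_sol 0 k (t / \<epsilon>) f x - f x\<bar> \<le> e)"
          using s0(2) \<epsilon> by blast
      qed
    qed
    have Kx: "0 \<le> snd x" "\<phi> x = f x" if "x \<in> K" for x
      using K(2) that eq[of x] less_imp_le[of 0 "snd x"] by (auto simp: subset_eq)
    show ?thesis
    proof (intro conjI allI impI)
      fix e :: real assume e: "0 < e"
      show "\<forall>\<^sub>F \<epsilon> in at_top. \<forall>x\<in>K. \<forall>t\<in>{0<..<T}. \<bar>zk \<epsilon> k \<phi> x t - \<phi> x\<bar> \<le> e"
        using ev[OF e] by eventually_elim (use k Kx D.zk_eq_dyn_sol[OF phi_meas ae] in auto)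
      show "\<forall>\<^sub>F \<epsilon> in at_top. \<forall>x\<in>K. \<forall>t\<in>{0<..<T}. \<bar>zN \<epsilon> \<phi> x t - \<phi> x\<bar> \<le> e"
        using ev[OF e] by eventually_elim (use Kx D.zN_eq_dyn_sol[OF phi_meas ae] in auto)
    qed
  qed
  show ?thesis
    apply (rule conjI)
    subgoal by (intro allI impI conjI rate) (simp_all add: zk zN)
    apply (rule conjI)
    subgoal by (intro allI impI, elim conjE, rule part2; assumption)
    apply (rule conjI)
    subgoal by (intro allI impI, rule part3; assumption)
    subgoal by (intro allI impI, elim conjE, rule part4; assumption)
    done
qed

end
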